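(* For $n\ge 1$ and real $\theta>1$, let $P_\theta$ be the probability distribution on the symmetric group $S_n$ given by $P_\theta(\sigma)=\theta^{\gamma(\sigma)}/\theta^{(n)}$, and consider the random walk on $S_n$ which moves from $\sigma$ to $\tau$ with probability $P_\theta(\tau\sigma^{-1})$. Let $d_\theta(t)$ be the total variation distance between the law $P_\theta^t$ of the walk after $t$ steps (started at the identity) and the uniform distribution on $S_n$. (i) For every $\theta>1$ there is a constant $C(\theta)$, depending only on $\theta$ (in particular not on $n$), such that for every $n$, every $\alpha>1$ and every integer $t\ge \alpha\,\frac{\theta^2+1}{2}$, $$d_\theta(t)<C(\theta)\,e^{-\alpha}.$$ (ii) If $\theta=n$ (that is, for each $n\ge 2$ the walk on $S_n$ is taken with parameter $\theta=n$), then this sequence of chains has a total variation cutoff at $t_n=\frac{\log n}{\log 2}$.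
   Context: Here $\gamma(\sigma)$ is the number of cycles of the permutation $\sigma\in S_n$ (fixed points are counted as cycles), and $\theta^{(n)}=\theta(\theta+1)\cdots(\theta+n-1)=\sum_{\sigma\in S_n}\theta^{\gamma(\sigma)}$. $P_\theta^t$ denotes the $t$-fold convolution of $P_\theta$ with itself, where $(\mu*\nu)(g)=\sum_{h}\mu(gh^{-1})\nu(h)$. With $\pi$ the uniform distribution on $S_n$, $$d_\theta(t)=\|P_\theta^t-\pi\|_{TV}=\frac12\sum_{\sigma\in S_n}|P_\theta^t(\sigma)-\pi(\sigma)|.$$ Cutoff: a sequence of Markov chains indexed by $n$, with total variation distance to stationarity $d^{(n)}(t)$ after $t$ steps, exhibits a (total variation) cutoff at $\{t_n\}$ with window of size $\{w_n\}$ (where $w_n>0$) if (a) $\lim_{n\to\infty} w_n/t_n=0$; (b) $\lim_{\alpha\to-\infty}\liminf_{n\to\infty} d^{(n)}(t_n+\alpha w_n)=1$; (c) $\lim_{\alpha\to\infty}\limsup_{n\to\infty} d^{(n)}(t_n+\alpha w_n)=0$. The sequence has a cutoff at $\{t_n\}$ if this holds for some window sequence $\{w_n\}$. At a non-integer time $s$, $d^{(n)}(s)$ is read as $d^{(n)}(\lfloor s\rfloor)$ (for fixed $\alpha$ the time $t_n+\alpha w_n$ is nonnegative for all large $n$). *)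

theory Defs
  imports
    "HOL-Algebra.Sym_Groups"
    "HOL-Combinatorics.Orbits"
    "HOL-Library.Extended_Real"
    "HOL-Library.Liminf_Limsup"
begin

section \<open>Convolution on a finite group\<close>

text \<open>Distributions on a finite group are represented by their real-valued mass functions; only
  the values on the carrier matter.\<close>

definition convolution ::
    "('a, 'b) monoid_scheme \<Rightarrow> ('a \<Rightarrow> real) \<Rightarrow> ('a \<Rightarrow> real) \<Rightarrow> 'a \<Rightarrow> real" where
  "convolution G \<mu> \<nu> g = (\<Sum>h\<in>carrier G. \<mu> (g \<otimes>\<^bsub>G\<^esub> inv\<^bsub>G\<^esub> h) * \<nu> h)"

primrec conv_power ::
    "('a, 'b) monoid_scheme \<Rightarrow> ('a \<Rightarrow> real) \<Rightarrow> nat \<Rightarrow> 'a \<Rightarrow> real" where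
  "conv_power G \<mu> 0 = (\<lambda>g. if g = \<one>\<^bsub>G\<^esub> then 1 else 0)"
| "conv_power G \<mu> (Suc t) = convolution G \<mu> (conv_power G \<mu> t)"

text \<open>The convolution power is the law of the walk which starts at the identity and moves from
  \<open>\<sigma>\<close> to \<open>\<tau>\<close> with probability \<open>\<mu> (\<tau> \<sigma>\<inverse>)\<close>.\<close>

lemma conv_power_walk_step:
  "conv_power G \<mu> (Suc t) \<tau> =
     (\<Sum>\<sigma>\<in>carrier G. conv_power G \<mu> t \<sigma> * \<mu> (\<tau> \<otimes>\<^bsub>G\<^esub> inv\<^bsub>G\<^esub> \<sigma>))"
  by (simp add: convolution_def mult.commute)

definition tv_dist :: "'a set \<Rightarrow> ('a \<Rightarrow> real) \<Rightarrow> ('a \<Rightarrow> real) \<Rightarrow> real" where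
  "tv_dist A \<mu> \<nu> = 1/2 * (\<Sum>x\<in>A. \<bar>\<mu> x - \<nu> x\<bar>)"


section \<open>The walk on the symmetric group\<close>

text \<open>The cycles of \<open>\<sigma>\<close>, fixed points included, correspond to its orbits on \<open>{1..n}\<close>.\<close>

definition num_cycles :: "nat \<Rightarrow> (nat \<Rightarrow> nat) \<Rightarrow> nat" where
  "num_cycles n \<sigma> = card (orbit \<sigma> ` {1..n})"

text \<open>The rising factorial \<open>\<theta> (\<theta> + 1) \<dots> (\<theta> + n - 1)\<close> is \<^term>\<open>pochhammer \<theta> n\<close>.\<close>

definition cycle_measure :: "nat \<Rightarrow> real \<Rightarrow> (nat \<Rightarrow> nat) \<Rightarrow> real" where
  "cycle_measure n \<theta> \<sigma> = \<theta> ^ num_cycles n \<sigma> / pochhammer \<theta> n"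

definition walk_tv :: "nat \<Rightarrow> real \<Rightarrow> nat \<Rightarrow> real" where
  "walk_tv n \<theta> t =
     tv_dist (carrier (sym_group n))
       (conv_power (sym_group n) (cycle_measure n \<theta>) t)
       (\<lambda>_. 1 / real (card (carrier (sym_group n))))"


section \<open>Cutoff\<close>

text \<open>\<open>d n s\<close> is the distance to stationarity of the \<open>n\<close>-th chain after \<open>s\<close> steps. Real times are
  rounded down; \<^const>\<open>nat\<close> sends negative times to \<open>0\<close>, which for fixed \<open>\<alpha>\<close> does not affect the
  limits when \<open>t\<^sub>n > 0\<close> eventually, since \<open>w\<^sub>n / t\<^sub>n\<close> tends to \<open>0\<close>. The lower and upper limits over
  \<open>n\<close> are taken in the extended reals, where they always exist.\<close>

definition cutoff_with_window ::
    "(nat \<Rightarrow> nat \<Rightarrow> real) \<Rightarrow> (nat \<Rightarrow> real) \<Rightarrow> (nat \<Rightarrow> real) \<Rightarrow> bool" where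
  "cutoff_with_window d t w \<longleftrightarrow>
     (\<forall>n. w n > 0) \<and>
     (\<lambda>n. w n / t n) \<longlonglongrightarrow> 0 \<and>
     ((\<lambda>\<alpha>::real. liminf (\<lambda>n. ereal (d n (nat \<lfloor>t n + \<alpha> * w n\<rfloor>)))) \<longlongrightarrow> 1) at_bot \<and>
     ((\<lambda>\<alpha>::real. limsup (\<lambda>n. ereal (d n (nat \<lfloor>t n + \<alpha> * w n\<rfloor>)))) \<longlongrightarrow> 0) at_top"

definition has_cutoff :: "(nat \<Rightarrow> nat \<Rightarrow> real) \<Rightarrow> (nat \<Rightarrow> real) \<Rightarrow> bool" where
  "has_cutoff d t \<longleftrightarrow> (\<exists>w. cutoff_with_window d t w)"

end

theory Submission
  imports Defs "HOL-Analysis.Function_Topology" "HOL-Analysis.Convex" "HOL-Real_Asymp.Real_Asymp"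
begin

text \<open>The element \<open>\<Sum> \<theta>^\<gamma>(\<sigma>) \<sigma>\<close> of the group algebra is the product of the commuting factors
  \<open>\<theta> + J\<^sub>k\<close>, where \<open>J\<^sub>k\<close> is the Jucys-Murphy element \<open>\<Sum> (a k)\<close> over \<open>a < k\<close>. After normalisation,
  each factor is a mixture of the identity, with weight \<open>(\<theta> - 1) / (\<theta> + k - 1)\<close>, and of a uniform
  choice among the \<open>(a k)\<close> with \<open>a \<le> k\<close>. Since the factors commute, the law of the walk is uniform on the
  event that for every \<open>k\<close> the second alternative has occurred at least once. The union bound over
  \<open>k\<close> gives (i).

  For \<open>\<theta> = n\<close> the same mixture shows that \<open>o(log n)\<close> steps bring the law close to a measure with
  density at most \<open>n^(\<delta>n)\<close>. Afterwards an \<open>L\<^sup>2\<close> bound applies. It needs only the following piece of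
  the representation theory of the symmetric group: an eigenspace of a central operator contains a
  vector invariant under a Young subgroup for which the sum of the squared block sizes is
  maximal, and such a vector is a joint eigenvector of the Jucys-Murphy elements whose eigenvalues
  are the contents of the boxes of a Young diagram. If the first row has \<open>n - j\<close> boxes with \<open>j\<close> small
  compared with \<open>n\<close>, the eigenvalue of the walk is about \<open>2^(-j)\<close> and the multiplicities are at most
  \<open>n^(2j)\<close>, so \<open>(1 + \<epsilon>) log n / log 2\<close> steps suffice; for larger \<open>j\<close> the eigenvalue is exponentially
  small in \<open>n\<close>. For the lower bound, count the points that no step has moved: their number is
  about \<open>n 2^(-t)\<close> by the second moment method, whereas a uniform permutation has one fixed point on
  average.\<close>

section \<open>Symmetric operators on functions on a finite set\<close>

text \<open>A direct L2 argument from the identity would have to beat the density n!, and the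
  eigenvalue bound exp(-c n) for diagrams with many boxes outside the first row has a constant c too
  small for that within about log n / log 2 steps. This is what the preliminary steps are for: they
  lower the density to n^(c n), which the same bound does defeat.

  Neither characters nor dimensions of irreducible representations occur. An operator inequality
  replaces them: P^(2t) is compared with a combination of the identity and of the operators U_m,
  where U_m is the sum of the averages over Sym(A) for all m-sets A. U_m is central, and its
  quadratic form is at least 1 at a normalised Young vector whose first block has size m, so one
  vector in the least eigenspace of the difference decides the inequality. At a measure of mass at
  most 1 with its mean removed, the form of U_m is at most binomial(n, m) / m!; after multiplication
  by n! this yields the factor n^(2(n - m)).

  The estimates hold for each fixed \<epsilon> and large n, so the window is not explicit; a
  diagonal choice produces it.\<close>

definition symmetric_operator :: "'a set \<Rightarrow> (('a \<Rightarrow> real) \<Rightarrow> 'a \<Rightarrow> real) \<Rightarrow> bool" where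
  "symmetric_operator G Q \<longleftrightarrow>
     (\<forall>f h a b. Q (\<lambda>g. a * f g + b * h g) = (\<lambda>g. a * Q f g + b * Q h g)) \<and>
     (\<forall>f h. (\<forall>g\<in>G. f g = h g) \<longrightarrow> (\<forall>g\<in>G. Q f g = Q h g)) \<and>
     (\<forall>f h. (\<Sum>g\<in>G. f g * Q h g) = (\<Sum>g\<in>G. Q f g * h g))"

lemma symmetric_operator_lin:
  "symmetric_operator G Q \<Longrightarrow> Q (\<lambda>g. a * f g + b * h g) = (\<lambda>g. a * Q f g + b * Q h g)"
  by (simp add: symmetric_operator_def)

lemma symmetric_operator_cong:
  "symmetric_operator G Q \<Longrightarrow> (\<And>g. g \<in> G \<Longrightarrow> f g = h g) \<Longrightarrow> g \<in> G \<Longrightarrow> Q f g = Q h g"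
  by (simp add: symmetric_operator_def)

lemma symmetric_operator_sym:
  "symmetric_operator G Q \<Longrightarrow> (\<Sum>g\<in>G. f g * Q h g) = (\<Sum>g\<in>G. Q f g * h g)"
  by (simp add: symmetric_operator_def)

lemma symmetric_operator_scale:
  assumes "symmetric_operator G Q"
  shows "Q (\<lambda>g. a * f g) = (\<lambda>g. a * Q f g)"
  using symmetric_operator_lin[OF assms, of a f 0 f] by simp

lemma symmetric_operator_zero:
  assumes "symmetric_operator G Q"
  shows "Q (\<lambda>g. 0) = (\<lambda>g. 0)"
  using symmetric_operator_scale[OF assms, of 0 "\<lambda>_. 0"] by simp

lemma symmetric_operator_sum:
  assumes "symmetric_operator G Q" "finite I"
  shows "Q (\<lambda>g. \<Sum>i\<in>I. c i * f i g) = (\<lambda>g. \<Sum>i\<in>I. c i * Q (f i) g)"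
  using assms(2)
proof (induction I rule: finite_induct)
  case empty
  then show ?case using symmetric_operator_zero[OF assms(1)] by simp
next
  case (insert x F)
  then show ?case
    using symmetric_operator_lin[OF assms(1), of "c x" "f x" 1 "\<lambda>g. \<Sum>i\<in>F. c i * f i g"] by simp
qed

text \<open>Matrix form of \<open>Q\<close> in the basis of point masses. \<open>f\<close> agrees
  with its expansion only on \<open>G\<close>, so this rests on the clause of
  \<open>symmetric_operator\<close> that values outside \<open>G\<close> do not matter. It makes the
  quadratic form visibly continuous.\<close>

lemma symmetric_operator_kernel:
  assumes "symmetric_operator G Q" "finite G" "g \<in> G"
  shows "Q f g = (\<Sum>h\<in>G. f h * Q (\<lambda>u. if u = h then 1 else 0) g)"
proof -
  have "Q f g = Q (\<lambda>u. \<Sum>h\<in>G. f h * (if u = h then 1 else 0)) g"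
    by (rule symmetric_operator_cong[OF assms(1) _ assms(3)]) (simp add: assms(2) if_distrib cong: if_cong)
  then show ?thesis
    using symmetric_operator_sum[OF assms(1,2), of f "\<lambda>h u. if u = h then 1 else 0"] by simp
qed

lemma symmetric_operator_id: "symmetric_operator G (\<lambda>f. f)"
  by (simp add: symmetric_operator_def)

lemma symmetric_operator_comp:
  assumes "symmetric_operator G P" "symmetric_operator G Q" "\<And>f. P (Q f) = Q (P f)"
  shows "symmetric_operator G (\<lambda>f. P (Q f))"
  unfolding symmetric_operator_def
proof (intro conjI allI impI ballI)
  fix f h :: "'a \<Rightarrow> real" and a b
  show "P (Q (\<lambda>g. a * f g + b * h g)) = (\<lambda>g. a * P (Q f) g + b * P (Q h) g)"
    by (simp add: symmetric_operator_lin[OF assms(1)] symmetric_operator_lin[OF assms(2)])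
next
  fix f h :: "'a \<Rightarrow> real" and g assume *: "\<forall>g\<in>G. f g = h g" "g \<in> G"
  show "P (Q f) g = P (Q h) g"
    by (rule symmetric_operator_cong[OF assms(1) symmetric_operator_cong[OF assms(2)]])
      (use * in auto)
next
  fix f h :: "'a \<Rightarrow> real"
  show "(\<Sum>g\<in>G. f g * P (Q h) g) = (\<Sum>g\<in>G. P (Q f) g * h g)"
    using symmetric_operator_sym[OF assms(1), of f "Q h"] symmetric_operator_sym[OF assms(2), of "P f" h]
    by (simp add: assms(3))
qed

lemma symmetric_operator_funpow:
  assumes "symmetric_operator G P"
  shows "symmetric_operator G (P ^^ t)"
proof (induction t)
  case 0
  then show ?case using symmetric_operator_id by (simp add: id_def)
next
  case (Suc t)
  have "symmetric_operator G (\<lambda>f. P ((P ^^ t) f))"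
    by (rule symmetric_operator_comp[OF assms Suc]) (metis funpow_swap1)
  then show ?case by (simp add: comp_def)
qed

lemma symmetric_operator_add_scaled:
  assumes "symmetric_operator G P" "symmetric_operator G Q"
  shows "symmetric_operator G (\<lambda>f g. c * P f g + d * Q f g)"
  unfolding symmetric_operator_def
proof (intro conjI allI impI ballI)
  fix f h :: "'a \<Rightarrow> real" and a b
  show "(\<lambda>g. c * P (\<lambda>g. a * f g + b * h g) g + d * Q (\<lambda>g. a * f g + b * h g) g) =
        (\<lambda>g. a * (c * P f g + d * Q f g) + b * (c * P h g + d * Q h g))"
    unfolding symmetric_operator_lin[OF assms(1)] symmetric_operator_lin[OF assms(2)]
    by (simp add: algebra_simps)
next
  fix f h :: "'a \<Rightarrow> real" and g assume "\<forall>g\<in>G. f g = h g" "g \<in> G"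
  then show "c * P f g + d * Q f g = c * P h g + d * Q h g"
    using symmetric_operator_cong[OF assms(1), of f h g] symmetric_operator_cong[OF assms(2), of f h g]
    by simp
next
  fix f h :: "'a \<Rightarrow> real"
  have "(\<Sum>g\<in>G. f g * (c * P h g + d * Q h g)) = c * (\<Sum>g\<in>G. f g * P h g) + d * (\<Sum>g\<in>G. f g * Q h g)"
    by (simp add: sum.distrib sum_distrib_left algebra_simps)
  also have "\<dots> = c * (\<Sum>g\<in>G. P f g * h g) + d * (\<Sum>g\<in>G. Q f g * h g)"
    using assms by (simp add: symmetric_operator_sym)
  also have "\<dots> = (\<Sum>g\<in>G. (c * P f g + d * Q f g) * h g)"
    by (simp add: sum.distrib sum_distrib_left algebra_simps)
  finally show "(\<Sum>g\<in>G. f g * (c * P h g + d * Q h g)) = (\<Sum>g\<in>G. (c * P f g + d * Q f g) * h g)" .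
qed

lemma symmetric_operator_weighted_sum:
  assumes "finite I" "\<And>i. i \<in> I \<Longrightarrow> symmetric_operator G (P i)"
  shows "symmetric_operator G (\<lambda>f g. \<Sum>i\<in>I. c i * P i f g)"
  using assms
proof (induction I rule: finite_induct)
  case empty
  then show ?case by (simp add: symmetric_operator_def)
next
  case (insert x F)
  then have "symmetric_operator G (\<lambda>f g. c x * P x f g + 1 * (\<Sum>i\<in>F. c i * P i f g))"
    by (intro symmetric_operator_add_scaled) auto
  then show ?case using insert by simp
qed

section \<open>Least eigenvalue by minimising the quadratic form on the unit sphere\<close>

lemma unit_sphere_compact:
  fixes G :: "'a set"
  assumes "finite G"
  shows "compact {f :: 'a \<Rightarrow> real. (\<forall>g. g \<notin> G \<longrightarrow> f g = 0) \<and> (\<Sum>g\<in>G. (f g)\<^sup>2) = 1}"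
    (is "compact ?X")
proof -
  \<comment> \<open>Functions are made to vanish outside \<open>G\<close>, because free coordinates
    there would destroy compactness; Tychonoff's theorem then applies to the box.\<close>
  define B where "B = (\<lambda>g. if g \<in> G then {-1..1::real} else {0})"
  have "compactin (product_topology (\<lambda>_::'a. euclidean :: real topology) UNIV) (PiE UNIV B)"
    unfolding compactin_PiE by (auto simp: B_def)
  then have comp: "compact (PiE UNIV B)"
    by (simp add: euclidean_product_topology)
  have "continuous_on UNIV (\<lambda>f :: 'a \<Rightarrow> real. \<Sum>g\<in>G. (f g)\<^sup>2)"
    by (rule continuous_on_sum[OF continuous_on_power[OF continuous_on_product_coordinates]])
  then have cl: "closed {f :: 'a \<Rightarrow> real. (\<Sum>g\<in>G. (f g)\<^sup>2) = 1}"
    using closed_Collect_eq[OF _ continuous_on_const] by blast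
  have "?X = PiE UNIV B \<inter> {f. (\<Sum>g\<in>G. (f g)\<^sup>2) = 1}"
  proof -
    have "f g \<in> B g" if "\<forall>g. g \<notin> G \<longrightarrow> f g = 0" "(\<Sum>g\<in>G. (f g)\<^sup>2) = 1" for f g
    proof (cases "g \<in> G")
      case True
      have "(f g)\<^sup>2 \<le> 1"
        using member_le_sum[OF True, of "\<lambda>g. (f g)\<^sup>2"] that(2) assms by simp
      then show ?thesis using True by (simp add: B_def abs_le_iff abs_square_le_1)
    qed (use that in \<open>simp add: B_def\<close>)
    moreover have "f g = 0" if "f \<in> PiE UNIV B" "g \<notin> G" for f g
      using PiE_mem[OF that(1), of g] that(2) by (simp add: B_def)
    moreover have "f \<in> PiE UNIV B" if "\<forall>g. f g \<in> B g" for f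
      using that by (intro PiE_I) auto
    ultimately show ?thesis by blast
  qed
  then show ?thesis using compact_Int_closed[OF comp cl] by simp
qed

text \<open>A minimiser of the quadratic form on the unit sphere is an eigenvector: perturbing it in
  the direction of each point mass gives the eigenvalue equation one coordinate at a time.\<close>

lemma symmetric_operator_min_eigenvalue:
  assumes Q: "symmetric_operator G Q" and G: "finite G" "G \<noteq> {}"
  obtains l f where "\<exists>g\<in>G. f g \<noteq> 0" "\<And>g. g \<in> G \<Longrightarrow> Q f g = l * f g"
    "\<And>h. (\<Sum>g\<in>G. h g * Q h g) \<ge> l * (\<Sum>g\<in>G. (h g)\<^sup>2)"
proof -
  define X where "X = {f :: 'a \<Rightarrow> real. (\<forall>g. g \<notin> G \<longrightarrow> f g = 0) \<and> (\<Sum>g\<in>G. (f g)\<^sup>2) = 1}"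
  define q where "q = (\<lambda>f. \<Sum>g\<in>G. f g * Q f g)"
  have compX: "compact X" unfolding X_def by (rule unit_sphere_compact[OF G(1)])
  obtain g0 where g0: "g0 \<in> G" using G(2) by auto
  have "(\<lambda>g. if g = g0 then 1 else 0) \<in> X"
    using g0 G(1) by (simp add: X_def if_distrib[of "\<lambda>x. x\<^sup>2"] cong: if_cong)
  then have neX: "X \<noteq> {}" by auto
  have q_kernel: "q = (\<lambda>f. \<Sum>g\<in>G. f g * (\<Sum>h\<in>G. f h * Q (\<lambda>u. if u = h then 1 else 0) g))"
    unfolding q_def by (intro ext sum.cong refl) (simp add: symmetric_operator_kernel[OF Q G(1)])
  have "continuous_on X q"
    unfolding q_kernel
    by (intro continuous_intros continuous_on_subset[OF continuous_on_product_coordinates]) auto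
  then obtain f where f: "f \<in> X" "\<And>h. h \<in> X \<Longrightarrow> q f \<le> q h"
    using continuous_attains_inf[OF compX neX] by blast
  have bound: "q f * (\<Sum>g\<in>G. (h g)\<^sup>2) \<le> q h" for h
  proof (cases "(\<Sum>g\<in>G. (h g)\<^sup>2) = 0")
    case True
    then have "\<forall>g\<in>G. h g = 0" using G(1) by (simp add: sum_nonneg_eq_0_iff)
    then have "q h = 0" by (simp add: q_def)
    with True show ?thesis by simp
  next
    case False
    define N where "N = (\<Sum>g\<in>G. (h g)\<^sup>2)"
    have N: "N > 0" using False sum_nonneg[of G "\<lambda>g. (h g)\<^sup>2"] by (simp add: N_def less_le)
    define c where "c = 1 / sqrt N"
    have c2: "c * c = 1 / N" using N by (simp add: c_def)
    define h' where "h' = (\<lambda>g. if g \<in> G then c * h g else 0)"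
    have "(\<Sum>g\<in>G. (h' g)\<^sup>2) = c * c * N"
      by (simp add: h'_def N_def sum_distrib_left power2_eq_square algebra_simps)
    then have "h' \<in> X" using N c2 by (simp add: X_def h'_def)
    then have le: "q f \<le> q h'" by (rule f(2))
    have "q h' = (\<Sum>g\<in>G. c * h g * (c * Q h g))"
      unfolding q_def
    proof (intro sum.cong refl)
      fix g assume g: "g \<in> G"
      have "Q h' g = Q (\<lambda>g. c * h g) g"
        by (rule symmetric_operator_cong[OF Q _ g]) (simp add: h'_def)
      then show "h' g * Q h' g = c * h g * (c * Q h g)"
        using g by (simp add: h'_def symmetric_operator_scale[OF Q])
    qed
    also have "\<dots> = c * c * q h" by (simp add: q_def sum_distrib_left algebra_simps)
    finally have "q f \<le> q h / N" using le c2 by simp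
    then show ?thesis using N by (simp add: N_def[symmetric] field_simps)
  qed
  have normf: "(\<Sum>g\<in>G. (f g)\<^sup>2) = 1" using f(1) by (simp add: X_def)
  have eig: "Q f g = q f * f g" if g: "g \<in> G" for g
  proof -
    define \<delta> :: "'a \<Rightarrow> real" where "\<delta> = (\<lambda>u. if u = g then 1 else 0)"
    define B where "B = Q f g - q f * f g"
    define D where "D = q \<delta> - q f"
    have pick: "(\<Sum>u\<in>G. \<delta> u * F u) = F g" for F
    proof -
      have "(\<Sum>u\<in>G. \<delta> u * F u) = (\<Sum>u\<in>G. if u = g then F u else 0)"
        by (intro sum.cong refl) (simp add: \<delta>_def)
      then show ?thesis using g G(1) by simp
    qed
    have pos: "0 \<le> 2 * e * B + e * e * D" for e
    proof -
      define h where "h = (\<lambda>u. 1 * f u + e * \<delta> u)"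
      have Qh: "Q h = (\<lambda>u. 1 * Q f u + e * Q \<delta> u)" unfolding h_def by (rule symmetric_operator_lin[OF Q])
      have "q h = (\<Sum>u\<in>G. f u * Q f u + e * (\<delta> u * Q f u) + e * (f u * Q \<delta> u) + e * e * (\<delta> u * Q \<delta> u))"
        unfolding q_def Qh unfolding h_def by (intro sum.cong refl) (simp add: algebra_simps)
      also have "\<dots> = q f + e * Q f g + e * (\<Sum>u\<in>G. f u * Q \<delta> u) + e * e * q \<delta>"
        by (simp add: sum.distrib sum_distrib_left[symmetric] pick q_def)
      also have "(\<Sum>u\<in>G. f u * Q \<delta> u) = Q f g"
        using symmetric_operator_sym[OF Q, of f \<delta>] pick[of "Q f"] by (simp add: mult.commute)
      finally have 1: "q h = q f + 2 * e * Q f g + e * e * q \<delta>" by simp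
      have "(\<Sum>u\<in>G. (h u)\<^sup>2) = (\<Sum>u\<in>G. (f u)\<^sup>2 + 2 * e * (\<delta> u * f u) + e * e * (\<delta> u * \<delta> u))"
        unfolding h_def by (intro sum.cong refl) (simp add: algebra_simps power2_eq_square)
      also have "\<dots> = 1 + 2 * e * f g + e * e"
        by (simp add: sum.distrib sum_distrib_left[symmetric] pick normf) (simp add: \<delta>_def)
      finally have 2: "(\<Sum>u\<in>G. (h u)\<^sup>2) = 1 + 2 * e * f g + e * e" .
      show ?thesis using bound[of h] unfolding 1 2 B_def D_def by (simp add: algebra_simps)
    qed
    \<comment> \<open>\<open>2 * e * B + e * e * D\<close> is nonnegative for every
      \<open>e\<close>, so its linear coefficient must vanish: since \<open>k\<close> exceeds
      \<open>\<bar>D\<bar>\<close>, the choice \<open>e = - B / k\<close> would make it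
      negative.\<close>
    have "B = 0"
    proof (rule ccontr)
      assume B: "B \<noteq> 0"
      define k where "k = \<bar>D\<bar> + 1"
      define e where "e = - B / k"
      have k: "k > 0" by (simp add: k_def)
      then have Be: "B = - (e * k)" by (simp add: e_def)
      have "2 * e * B + e * e * D \<le> 2 * e * B + e * e * k"
        by (intro add_left_mono mult_left_mono) (auto simp: k_def)
      also have "\<dots> = - (e * e * k)" by (simp add: Be)
      finally have "e * e * k \<le> 0" using pos[of e] by simp
      moreover have "e * e > 0" using B Be by (auto simp: zero_less_mult_iff)
      ultimately show False using k by (meson mult_pos_pos not_le)
    qed
    then show ?thesis by (simp add: B_def)
  qed
  have "\<exists>g\<in>G. f g \<noteq> 0"
  proof (rule ccontr)
    assume "\<not> (\<exists>g\<in>G. f g \<noteq> 0)"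
    then have "(\<Sum>g\<in>G. (f g)\<^sup>2) = 0" by simp
    with normf show False by simp
  qed
  then show ?thesis using that[of f "q f"] eig bound by (auto simp: q_def)
qed

section \<open>The cycle measure as a product of Jucys-Murphy elements\<close>

lemma permutes_self_in_orbit:
  assumes "finite A" "q permutes A"
  shows "y \<in> orbit q y"
  using assms by (metis permutation_permutes permutation_self_in_orbit)

text \<open>\<open>transpose x b \<circ> q\<close> splices \<open>x\<close> into the cycle of
  \<open>q\<close> through \<open>b\<close>, just before \<open>b\<close>; all other transitions
  inside \<open>A\<close> are those of \<open>q\<close>.\<close>

lemma orbit_transpose_insert:
  assumes A: "finite A" "x \<notin> A" "b \<in> A" and q: "q permutes A" and y: "y \<in> A"
  defines "p \<equiv> transpose x b \<circ> q"
  shows "orbit p y - {x} = orbit q y"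
proof -
  have qx: "q x = x" using q A(2) by (rule permutes_not_in)
  have px: "p x = b" by (simp add: p_def qx)
  have pq: "p z = (if q z = b then x else q z)" if "z \<in> A" for z
    using that A q by (auto simp: p_def transpose_def permutes_in_image)
  have sub: "orbit q y \<subseteq> A" using q y by (rule permutes_orbit_subset)
  have qA: "q z \<in> A" if "z \<in> A" for z
    using permutes_in_image[OF q] that by simp
  have step: "q z \<in> orbit p z" if z: "z \<in> A" for z
  proof (cases "q z = b")
    case True
    then have "p z = x" using pq z by simp
    then have "x \<in> orbit p z" by (metis orbit.base)
    then have "b \<in> orbit p z" using px by (metis orbit.step)
    then show ?thesis using True by simp
  next
    case False
    then show ?thesis using pq[OF z] by (metis orbit.base)
  qed
  have 1: "z \<in> orbit p y" if "z \<in> orbit q y" for z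
    using that
  proof (induction rule: orbit.induct)
    case base
    then show ?case using step y by simp
  next
    case (step u)
    then show ?case using \<open>\<And>z. z \<in> A \<Longrightarrow> q z \<in> orbit p z\<close>[of u] sub
      by (meson orbit_trans subsetD)
  qed
  \<comment> \<open>\<open>x\<close> is not on the orbit of \<open>y\<close> under \<open>q\<close>,
    so the induction carries its successor \<open>b\<close> in its place.\<close>
  have 2: "if z = x then b \<in> orbit q y else z \<in> orbit q y" if "z \<in> orbit p y" for z
    using that
  proof (induction rule: orbit.induct)
    case base
    have "q y \<in> orbit q y" by (rule orbit.base)
    then show ?case using pq[OF y] A qA[OF y] by (auto split: if_splits)
  next
    case (step u)
    show ?case
    proof (cases "u = x")
      case True
      then show ?thesis using step px A by auto
    next
      case False
      then have u: "u \<in> orbit q y" "u \<in> A" using step sub by auto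
      then have "q u \<in> orbit q y" by (intro orbit.step)
      then show ?thesis using pq[OF u(2)] qA[OF u(2)] A by (auto split: if_splits)
    qed
  qed
  show ?thesis using 1 2 sub A by (fastforce split: if_splits)
qed

text \<open>The Chinese restaurant recursion: \<open>x\<close> either opens a cycle of its own or is
  spliced into an existing one. In the second case deleting \<open>x\<close> is a bijection from the
  new orbits to the old ones.\<close>

lemma card_orbits_insert:
  assumes A: "finite A" "x \<notin> A" "b \<in> insert x A" and q: "q permutes A"
  shows "card (orbit (transpose x b \<circ> q) ` insert x A) =
    card (orbit q ` A) + (if b = x then 1 else 0)"
proof (cases "b = x")
  case True
  have "orbit q x = {x}" using permutes_not_in[OF q A(2)] by (simp add: orbit_eq_singleton_iff)
  moreover have "{x} \<notin> orbit q ` A"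
    using permutes_orbit_subset[OF q] A(2) by blast
  ultimately show ?thesis using True A by simp
next
  case False
  then have b: "b \<in> A" using A by simp
  define p where "p = transpose x b \<circ> q"
  have p: "p permutes insert x A"
    unfolding p_def using q A b
    by (intro permutes_compose permutes_swap_id permutes_imp_permutes_insert) auto
  have px: "p x = b" using permutes_not_in[OF q A(2)] by (simp add: p_def)
  have self: "y \<in> orbit p y" for y by (rule permutes_self_in_orbit[OF _ p]) (simp add: A)
  have "orbit p x = orbit p b"
    using self[of x] px by (metis orbit_cyclic_eq3 orbit.base cyclic_on_orbit' A(1) finite_insert p permutation_permutes)
  then have 1: "orbit p ` insert x A = orbit p ` A" using b by auto
  have 2: "orbit q ` A = (\<lambda>C. C - {x}) ` (orbit p ` A)"
    unfolding image_image using orbit_transpose_insert[OF A(1,2) b q]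
    by (intro image_cong) (auto simp: p_def)
  have "inj_on (\<lambda>C. C - {x}) (orbit p ` A)"
  proof (rule inj_onI, clarify)
    fix y z assume yz: "y \<in> A" "z \<in> A" "orbit p y - {x} = orbit p z - {x}"
    then have "y \<in> orbit p z" using self[of y] A(2) by auto
    then show "orbit p y = orbit p z"
      by (metis A(1) cyclic_on_orbit' finite_insert orbit_cyclic_eq3 p permutation_permutes)
  qed
  then show ?thesis unfolding 2 p_def[symmetric] 1 using False by (simp add: card_image)
qed

text \<open>The transition operator of the walk. It acts on functions defined at all \<open>'a \<Rightarrow> 'a\<close>, and not just
  at the permutations of \<open>A\<close>, so that the operators for nested sets can be composed.\<close>

definition cycle_op :: "real \<Rightarrow> 'a set \<Rightarrow> (('a \<Rightarrow> 'a) \<Rightarrow> real) \<Rightarrow> ('a \<Rightarrow> 'a) \<Rightarrow> real" where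
  "cycle_op \<theta> A f g =
     (\<Sum>h | h permutes A. \<theta> ^ card (orbit h ` A) / pochhammer \<theta> (card A) * f (h \<circ> g))"

text \<open>The divisor is the next factor of the Pochhammer symbol; with it the operator preserves
  constants.\<close>

definition jm_op :: "real \<Rightarrow> 'a \<Rightarrow> 'a set \<Rightarrow> (('a \<Rightarrow> 'a) \<Rightarrow> real) \<Rightarrow> ('a \<Rightarrow> 'a) \<Rightarrow> real" where
  "jm_op \<theta> x A f g = (\<theta> * f g + (\<Sum>b\<in>A. f (transpose x b \<circ> g))) / (\<theta> + card A)"

section \<open>Factorisation of the transition operator\<close>

lemma cycle_op_empty [simp]: "cycle_op \<theta> {} f = f"
  by (rule ext) (simp add: cycle_op_def)

text \<open>Each permutation of \<open>insert x A\<close> is uniquely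
  \<open>transpose x b \<circ> q\<close> with \<open>q\<close> a permutation of \<open>A\<close>,
  and its orbit weight is that of \<open>q\<close>, times \<theta> if \<open>b = x\<close>. As
  \<open>q\<close> acts first, \<open>jm_op\<close> becomes the inner operator.\<close>

lemma cycle_op_insert:
  assumes A: "finite A" "x \<notin> A"
  shows "cycle_op \<theta> (insert x A) f = cycle_op \<theta> A (jm_op \<theta> x A f)"
proof
  fix g
  have "(\<Sum>h | h permutes insert x A. \<theta> ^ card (orbit h ` insert x A) * f (h \<circ> g))
      = (\<Sum>b\<in>insert x A. \<Sum>q | q permutes A.
          \<theta> ^ (card (orbit q ` A) + (if b = x then 1 else 0)) * f (transpose x b \<circ> (q \<circ> g)))"
    unfolding sum_over_permutations_insert[OF A]
  proof (intro sum.cong refl)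
    fix b q assume "b \<in> insert x A" "q \<in> {q. q permutes A}"
    then have "card (orbit (transpose x b \<circ> q) ` insert x A) = card (orbit q ` A) + (if b = x then 1 else 0)"
      by (intro card_orbits_insert[OF A]) auto
    then show "\<theta> ^ card (orbit (transpose x b \<circ> q) ` insert x A) * f (transpose x b \<circ> q \<circ> g) =
        \<theta> ^ (card (orbit q ` A) + (if b = x then 1 else 0)) * f (transpose x b \<circ> (q \<circ> g))"
      by (simp only: comp_assoc)
  qed
  also have "\<dots> = (\<Sum>q | q permutes A. \<Sum>b\<in>insert x A.
          \<theta> ^ (card (orbit q ` A) + (if b = x then 1 else 0)) * f (transpose x b \<circ> (q \<circ> g)))"
    by (rule sum.swap)
  also have "\<dots> = (\<Sum>q | q permutes A. \<theta> ^ card (orbit q ` A) *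
      (\<theta> * f (q \<circ> g) + (\<Sum>b\<in>A. f (transpose x b \<circ> (q \<circ> g)))))"
  proof (intro sum.cong refl)
    fix q :: "'a \<Rightarrow> 'a"
    have "(\<Sum>b\<in>A. \<theta> ^ (card (orbit q ` A) + (if b = x then 1 else 0)) * f (transpose x b \<circ> (q \<circ> g)))
        = (\<Sum>b\<in>A. \<theta> ^ card (orbit q ` A) * f (transpose x b \<circ> (q \<circ> g)))"
      using A by (intro sum.cong refl) auto
    then show "(\<Sum>b\<in>insert x A.
          \<theta> ^ (card (orbit q ` A) + (if b = x then 1 else 0)) * f (transpose x b \<circ> (q \<circ> g)))
      = \<theta> ^ card (orbit q ` A) * (\<theta> * f (q \<circ> g) + (\<Sum>b\<in>A. f (transpose x b \<circ> (q \<circ> g))))"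
      using A by (simp add: sum_distrib_left algebra_simps)
  qed
  finally have "(\<Sum>h | h permutes insert x A. \<theta> ^ card (orbit h ` insert x A) * f (h \<circ> g))
      = (\<Sum>q | q permutes A. \<theta> ^ card (orbit q ` A) *
      (\<theta> * f (q \<circ> g) + (\<Sum>b\<in>A. f (transpose x b \<circ> (q \<circ> g)))))" .
  then show "cycle_op \<theta> (insert x A) f g = cycle_op \<theta> A (jm_op \<theta> x A f) g"
    using A by (simp add: cycle_op_def jm_op_def pochhammer_Suc sum_divide_distrib[symmetric])
qed

text \<open>Conjugation by a permutation that fixes \<open>x\<close> merely permutes the
  transpositions \<open>transpose x b\<close> with \<open>b\<close> in \<open>A\<close>. Hence the
  Jucys-Murphy element commutes with the group algebra of Sym(A).\<close>

lemma sum_transpose_translate: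
  assumes "q permutes A" "x \<notin> A"
  shows "(\<Sum>b\<in>A. f (transpose x b \<circ> (q \<circ> g))) = (\<Sum>b\<in>A. f (q \<circ> (transpose x b \<circ> g)))"
proof -
  have "(\<Sum>b\<in>A. f (transpose x b \<circ> (q \<circ> g))) = (\<Sum>b\<in>A. f (transpose x (q b) \<circ> (q \<circ> g)))"
    using sum.permute[OF assms(1), of "\<lambda>b. f (transpose x b \<circ> (q \<circ> g))"] by (simp only: o_def)
  also have "\<dots> = (\<Sum>b\<in>A. f (q \<circ> (transpose x b \<circ> g)))"
  proof (intro sum.cong refl)
    fix b
    have "transpose (q x) (q b) \<circ> q = q \<circ> transpose x b"
      using permutes_inj[OF assms(1)] by (auto simp: fun_eq_iff transpose_def dest: injD)
    then have "transpose x (q b) \<circ> q = q \<circ> transpose x b"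
      by (simp only: permutes_not_in[OF assms])
    then show "f (transpose x (q b) \<circ> (q \<circ> g)) = f (q \<circ> (transpose x b \<circ> g))"
      by (simp only: comp_assoc[symmetric])
  qed
  finally show ?thesis .
qed

lemma jm_op_translate:
  assumes "q permutes A" "x \<notin> A"
  shows "jm_op \<theta> x A f (q \<circ> g) = jm_op \<theta> x A (\<lambda>u. f (q \<circ> u)) g"
  using sum_transpose_translate[OF assms, of f g] by (simp add: jm_op_def)

lemma cycle_op_jm_op_commute:
  assumes "finite A" "x \<notin> A"
  shows "cycle_op \<theta> A (jm_op \<theta> x A f) = jm_op \<theta> x A (cycle_op \<theta> A f)"
proof
  fix g
  have "cycle_op \<theta> A (jm_op \<theta> x A f) g =
    (\<Sum>h | h permutes A. \<theta> ^ card (orbit h ` A) / pochhammer \<theta> (card A) * jm_op \<theta> x A (\<lambda>u. f (h \<circ> u)) g)"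
    unfolding cycle_op_def using assms by (intro sum.cong refl) (simp add: jm_op_translate)
  also have "\<dots> = jm_op \<theta> x A (cycle_op \<theta> A f) g"
    unfolding jm_op_def cycle_op_def
    by (simp add: sum_distrib_left sum.distrib sum_divide_distrib[symmetric] algebra_simps
        sum.swap[of _ A])
  finally show "cycle_op \<theta> A (jm_op \<theta> x A f) g = jm_op \<theta> x A (cycle_op \<theta> A f) g" .
qed

text \<open>Because the factors commute, a power of the product is a product of powers. The law
  after \<open>t\<close> steps can therefore be built up point by point, with all \<open>t\<close>
  choices for one point made together.\<close>

lemma cycle_op_funpow_insert:
  assumes "finite A" "x \<notin> A"
  shows "(cycle_op \<theta> (insert x A) ^^ t) f = (jm_op \<theta> x A ^^ t) ((cycle_op \<theta> A ^^ t) f)"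
proof (induction t)
  case 0
  then show ?case by simp
next
  case (Suc t)
  have comm: "cycle_op \<theta> A ((jm_op \<theta> x A ^^ s) f) = (jm_op \<theta> x A ^^ s) (cycle_op \<theta> A f)" for s f
    by (induction s) (simp_all add: cycle_op_jm_op_commute[OF assms])
  show ?case
    using comm[of "Suc t" "(cycle_op \<theta> A ^^ t) f"] Suc
    by (simp add: cycle_op_insert[OF assms])
qed

lemma cycle_op_const:
  assumes "finite A" "\<theta> > 0"
  shows "cycle_op \<theta> A (\<lambda>_. c) = (\<lambda>_. c)"
  using assms(1)
proof (induction A rule: finite_induct)
  case empty
  then show ?case by simp
next
  case (insert x A)
  have "\<theta> + card A > 0" using assms by (simp add: add_pos_nonneg)
  then have "jm_op \<theta> x A (\<lambda>_. c) = (\<lambda>_. c)"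
    by (auto simp: jm_op_def field_simps)
  then show ?case using insert by (simp add: cycle_op_insert)
qed

lemma sum_cycle_weights:
  fixes \<theta> :: real
  assumes "finite A" "\<theta> > 0"
  shows "(\<Sum>h | h permutes A. \<theta> ^ card (orbit h ` A)) = pochhammer \<theta> (card A)"
proof -
  have "pochhammer \<theta> (card A) > 0" using assms(2) by (rule pochhammer_pos)
  moreover have "cycle_op \<theta> A (\<lambda>_. 1) id = 1" using cycle_op_const[OF assms] by metis
  ultimately show ?thesis
    by (simp add: cycle_op_def sum_divide_distrib[symmetric])
qed

section \<open>The law of the walk as a mixture of spread-out measures\<close>

definition walk_law :: "real \<Rightarrow> 'a set \<Rightarrow> nat \<Rightarrow> ('a \<Rightarrow> 'a) \<Rightarrow> real" where
  "walk_law \<theta> A t = (cycle_op \<theta> A ^^ t) (\<lambda>g. if g = id then 1 else 0)"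

lemma orbit_inv_permutes:
  assumes "finite A" "q permutes A"
  shows "orbit (inv' q) x = orbit q x"
  using assms by (metis orbit_inv_eq permutation_permutes)

text \<open>After the substitution \<open>h = u \<circ> g\<close> the convolution gives the
  increment \<open>inv' u\<close>, whereas \<open>cycle_op\<close> weights by \<open>u\<close>. The
  two agree because a permutation and its inverse have the same orbits.\<close>

lemma conv_power_sym_group:
  assumes "g permutes {1..n}"
  shows "conv_power (sym_group n) (cycle_measure n \<theta>) t g = walk_law \<theta> {1..n} t g"
  using assms
proof (induction t arbitrary: g)
  case 0
  then show ?case by (simp add: walk_law_def sym_group_def)
next
  case (Suc t)
  let ?\<mu> = "cycle_measure n \<theta>" and ?\<nu> = "walk_law \<theta> {1..n} t"
  have "conv_power (sym_group n) ?\<mu> (Suc t) g = (\<Sum>h | h permutes {1..n}. ?\<mu> (g \<circ> inv' h) * ?\<nu> h)"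
    unfolding conv_power.simps convolution_def
    by (intro sum.cong) (auto simp: sym_group_carrier sym_group_mult Suc.IH)
  also have "\<dots> = (\<Sum>u | u permutes {1..n}. ?\<mu> (g \<circ> inv' (u \<circ> g)) * ?\<nu> (u \<circ> g))"
    by (rule sum_permutations_compose_right[OF Suc.prems])
  also have "\<dots> = cycle_op \<theta> {1..n} ?\<nu> g"
    unfolding cycle_op_def
  proof (intro sum.cong refl)
    fix u assume "u \<in> {u. u permutes {1..n}}"
    then have u: "u permutes {1..n}" by simp
    have "g \<circ> inv' (u \<circ> g) = inv' u"
      using Suc.prems u by (simp add: o_inv_distrib permutes_bij comp_assoc[symmetric] permutes_inv_o)
    moreover have "?\<mu> (inv' u) = \<theta> ^ card (orbit u ` {1..n}) / pochhammer \<theta> (card {1..n})"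
      using orbit_inv_permutes[OF _ u] by (simp add: cycle_measure_def num_cycles_def)
    ultimately show "?\<mu> (g \<circ> inv' (u \<circ> g)) * ?\<nu> (u \<circ> g) =
        \<theta> ^ card (orbit u ` {1..n}) / pochhammer \<theta> (card {1..n}) * ?\<nu> (u \<circ> g)" by simp
  qed
  finally show ?case by (simp add: walk_law_def)
qed

section \<open>One factor as a mixture, and the resulting mixture for the law\<close>

lemma jm_op_add_scaled:
  "jm_op \<theta> x A (\<lambda>g. a * f g + b * h g) = (\<lambda>g. a * jm_op \<theta> x A f g + b * jm_op \<theta> x A h g)"
  by (rule ext)
    (simp add: jm_op_def sum.distrib sum_distrib_left[symmetric] add_divide_distrib algebra_simps)

lemma jm_op_nonneg:
  assumes "\<And>g. 0 \<le> f g" "\<theta> \<ge> 0"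
  shows "0 \<le> jm_op \<theta> x A f g"
  unfolding jm_op_def using assms by (intro divide_nonneg_nonneg add_nonneg_nonneg mult_nonneg_nonneg sum_nonneg) auto

lemma jm_op_le:
  assumes "\<And>g. f g \<le> M" "\<theta> > 0" "finite A"
  shows "jm_op \<theta> x A f g \<le> M"
proof -
  have "\<theta> * f g + (\<Sum>b\<in>A. f (transpose x b \<circ> g)) \<le> \<theta> * M + (\<Sum>b\<in>A. M)"
    using assms by (intro add_mono mult_left_mono sum_mono) auto
  moreover have "\<theta> + card A > 0" using assms by (simp add: add_pos_nonneg)
  ultimately show ?thesis by (simp add: jm_op_def divide_le_eq algebra_simps)
qed

lemma transpose_comp_permutes_iff:
  assumes "b \<in> insert x A"
  shows "transpose x b \<circ> g permutes insert x A \<longleftrightarrow> g permutes insert x A"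
proof -
  have t: "transpose x b permutes insert x A" using assms by (intro permutes_swap_id) auto
  have "g = transpose x b \<circ> (transpose x b \<circ> g)" by (simp add: comp_assoc[symmetric])
  then show ?thesis using permutes_compose[OF _ t] by metis
qed

lemma jm_op_support:
  assumes "\<And>g. \<not> g permutes insert x A \<Longrightarrow> f g = 0" "\<not> g permutes insert x A"
  shows "jm_op \<theta> x A f g = 0"
proof -
  have "(\<Sum>b\<in>A. f (transpose x b \<circ> g)) = 0"
    using assms transpose_comp_permutes_iff[of _ x A g] by (intro sum.neutral) auto
  then show ?thesis using assms by (simp add: jm_op_def)
qed

lemma sum_transpose_comp:
  assumes "b \<in> insert x A"
  shows "(\<Sum>g | g permutes insert x A. f (transpose x b \<circ> g)) = (\<Sum>g | g permutes insert x A. f g)"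
  using setum_permutations_compose_left[of "transpose x b" "insert x A" f] assms
  by (simp add: permutes_swap_id)

lemma jm_op_sum:
  assumes "\<theta> > 0" "finite A"
  shows "(\<Sum>g | g permutes insert x A. jm_op \<theta> x A f g) = (\<Sum>g | g permutes insert x A. f g)"
proof -
  let ?S = "\<Sum>g | g permutes insert x A. f g"
  have "(\<Sum>g | g permutes insert x A. jm_op \<theta> x A f g) =
      (\<theta> * ?S + (\<Sum>b\<in>A. \<Sum>g | g permutes insert x A. f (transpose x b \<circ> g))) / (\<theta> + card A)"
    by (simp add: jm_op_def sum_divide_distrib[symmetric] sum.distrib sum_distrib_left sum.swap[of _ A])
  also have "\<dots> = (\<theta> * ?S + (\<Sum>b\<in>A. ?S)) / (\<theta> + card A)"
    by (simp add: sum_transpose_comp)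
  also have "\<dots> = ?S"
  proof -
    have "\<theta> + card A > 0" using assms by (simp add: add_pos_nonneg)
    then show ?thesis by (simp add: field_simps)
  qed
  finally show ?thesis .
qed

text \<open>\<open>b\<close> is the only point with \<open>transpose x b \<circ> g\<close> fixing \<open>x\<close> if \<open>b = g x\<close>; so the average over
  \<open>b\<close> of a measure carried by the permutations of \<open>A\<close> has its density divided by \<open>card A + 1\<close>.\<close>

lemma sum_transpose_le:
  assumes A: "finite A" "x \<notin> A" and f: "\<And>g. 0 \<le> f g" "\<And>g. f g \<le> M" "\<And>g. \<not> g permutes A \<Longrightarrow> f g = 0"
  shows "(\<Sum>b\<in>insert x A. f (transpose x b \<circ> g)) \<le> (M :: real)"
proof -
  have M: "M \<ge> 0" using f(1,2)[of g] by linarith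
  have "f (transpose x b \<circ> g) = 0" if "b \<noteq> g x" for b
  proof (rule f(3))
    show "\<not> transpose x b \<circ> g permutes A"
    proof
      assume "transpose x b \<circ> g permutes A"
      then have "transpose x b (g x) = x" using permutes_not_in[OF _ A(2)] by fastforce
      then have "g x = b" by (metis transpose_apply_first transpose_involutory)
      then show False using that by simp
    qed
  qed
  then have "(\<Sum>b\<in>insert x A. f (transpose x b \<circ> g)) = (\<Sum>b\<in>insert x A. if b = g x then f (transpose x b \<circ> g) else 0)"
    by (intro sum.cong) auto
  also have "\<dots> \<le> M" using A f(2) M by (subst sum.delta) auto
  finally show ?thesis .
qed

lemma sum_permutes_insert_support:
  fixes f :: "('a \<Rightarrow> 'a) \<Rightarrow> real"
  assumes "finite A" "\<And>g. \<not> g permutes A \<Longrightarrow> f g = 0"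
  shows "(\<Sum>g | g permutes insert x A. f g) = (\<Sum>g | g permutes A. f g)"
proof (rule sum.mono_neutral_right)
  show "finite {g. g permutes insert x A}" using assms(1) by (simp add: finite_permutations)
  show "{g. g permutes A} \<subseteq> {g. g permutes insert x A}"
    by (rule Collect_mono, rule impI) (erule permutes_imp_permutes_insert)
  show "\<forall>g\<in>{g. g permutes insert x A} - {g. g permutes A}. f g = 0" using assms(2) by simp
qed

text \<open>One of the \<theta> units of weight on the identity is counted as the choice
  \<open>b = x\<close>. A step then stays put with probability \<open>q\<close> and otherwise makes
  a uniform choice among \<open>card A + 1\<close> elements. \<open>Z\<close> collects what has been
  spread at least once; later steps only average it, so its density bound survives.\<close>

lemma jm_op_funpow_mixture:
  fixes \<theta> :: real and A :: "'a set" and x :: 'a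
  defines "q \<equiv> (\<theta> - 1) / (\<theta> + card A)"
  assumes A: "finite A" "x \<notin> A" and \<theta>: "\<theta> \<ge> 1"
    and f: "\<And>g. 0 \<le> f g" "\<And>g. f g \<le> M" "\<And>g. \<not> g permutes A \<Longrightarrow> f g = 0"
  shows "\<exists>Z. (\<forall>g. (jm_op \<theta> x A ^^ s) f g = q ^ s * f g + Z g) \<and> (\<forall>g. 0 \<le> Z g) \<and>
    (\<forall>g. \<not> g permutes insert x A \<longrightarrow> Z g = 0) \<and> (\<forall>g. Z g \<le> (1 - q ^ s) * (M / (card A + 1))) \<and>
    (\<Sum>g | g permutes insert x A. Z g) = (1 - q ^ s) * (\<Sum>g | g permutes A. f g)"
proof (induction s)
  case 0
  then show ?case by (intro exI[of _ "\<lambda>_. 0"]) auto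
next
  case (Suc s)
  then obtain Z where Z: "\<And>g. (jm_op \<theta> x A ^^ s) f g = q ^ s * f g + Z g" "\<And>g. 0 \<le> Z g"
    "\<And>g. \<not> g permutes insert x A \<Longrightarrow> Z g = 0" "\<And>g. Z g \<le> (1 - q ^ s) * (M / (card A + 1))"
    "(\<Sum>g | g permutes insert x A. Z g) = (1 - q ^ s) * (\<Sum>g | g permutes A. f g)"
    by blast
  define R where "R = (\<lambda>g. (\<Sum>b\<in>insert x A. f (transpose x b \<circ> g)) / (\<theta> + card A))"
  define Z' where "Z' = (\<lambda>g. jm_op \<theta> x A Z g + q ^ s * R g)"
  have pos: "\<theta> + card A > 0" using \<theta> by (simp add: add_pos_nonneg)
  have q: "0 \<le> q" "1 - q = (card A + 1) / (\<theta> + card A)" using \<theta> pos by (auto simp: q_def field_simps)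
  have supp: "f g = 0" if "\<not> g permutes insert x A" for g
  proof (rule f(3))
    show "\<not> g permutes A" using that permutes_imp_permutes_insert[of g A x] by auto
  qed
  have jf: "jm_op \<theta> x A f g = q * f g + R g" for g
    using A pos by (simp add: jm_op_def R_def q_def add_divide_distrib diff_divide_distrib algebra_simps)
  have fun_Z: "(jm_op \<theta> x A ^^ s) f = (\<lambda>g. q ^ s * f g + 1 * Z g)"
    by (rule ext) (simp add: Z(1))
  have 1: "(jm_op \<theta> x A ^^ Suc s) f g = q ^ Suc s * f g + Z' g" for g
    unfolding funpow.simps comp_def fun_Z jm_op_add_scaled by (simp add: Z'_def jf algebra_simps)
  have 2: "0 \<le> Z' g" for g
    unfolding Z'_def R_def using Z(2) f(1) q pos \<theta>
    by (intro add_nonneg_nonneg mult_nonneg_nonneg jm_op_nonneg divide_nonneg_pos sum_nonneg) auto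
  have 3: "Z' g = 0" if "\<not> g permutes insert x A" for g
  proof -
    have "(\<Sum>b\<in>insert x A. f (transpose x b \<circ> g)) = 0"
      using supp transpose_comp_permutes_iff[of _ x A g] that by (intro sum.neutral) blast
    then show ?thesis using jm_op_support[OF Z(3) that] by (simp add: Z'_def R_def)
  qed
  have 4: "Z' g \<le> (1 - q ^ Suc s) * (M / (card A + 1))" for g
  proof -
    have "R g \<le> M / (\<theta> + card A)"
      unfolding R_def using sum_transpose_le[OF A f] pos by (intro divide_right_mono) auto
    also have "M / (\<theta> + card A) = (1 - q) * (M / (card A + 1))"
    proof -
      have "M / r = (p / r) * (M / p)" if "p \<noteq> 0" for p r :: real using that by simp
      then show ?thesis unfolding q(2) by (metis of_nat_eq_0_iff add_is_0 one_neq_zero)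
    qed
    finally have "q ^ s * R g \<le> q ^ s * ((1 - q) * (M / (card A + 1)))"
      using q by (intro mult_left_mono) auto
    moreover have "jm_op \<theta> x A Z g \<le> (1 - q ^ s) * (M / (card A + 1))"
      using Z(4) \<theta> A by (intro jm_op_le) auto
    ultimately have "Z' g \<le> (1 - q ^ s) * (M / (card A + 1)) + q ^ s * ((1 - q) * (M / (card A + 1)))"
      by (simp add: Z'_def)
    also have "\<dots> = (1 - q ^ Suc s) * (M / (card A + 1))"
    proof -
      have "(1 - p) * D + p * ((1 - q) * D) = (1 - q * p) * D" for p D :: real
        by (simp add: algebra_simps)
      then show ?thesis by (simp only: power_Suc)
    qed
    finally show ?thesis .
  qed
  have supp_sum: "(\<Sum>g | g permutes insert x A. f g) = (\<Sum>g | g permutes A. f g)"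
    by (rule sum_permutes_insert_support[OF A(1) f(3)])
  have "(\<Sum>g | g permutes insert x A. \<Sum>b\<in>insert x A. f (transpose x b \<circ> g)) =
      (\<Sum>b\<in>insert x A. \<Sum>g | g permutes insert x A. f (transpose x b \<circ> g))"
    by (rule sum.swap)
  also have "\<dots> = (\<Sum>b\<in>insert x A. \<Sum>g | g permutes A. f g)"
    by (rule sum.cong[OF refl])
      (simp only: sum_transpose_comp supp_sum)
  finally have "(\<Sum>g | g permutes insert x A. \<Sum>b\<in>insert x A. f (transpose x b \<circ> g)) =
      (\<Sum>b\<in>insert x A. \<Sum>g | g permutes A. f g)" .
  then have "(\<Sum>g | g permutes insert x A. R g) = (1 - q) * (\<Sum>g | g permutes A. f g)"
    using A by (simp add: R_def sum_divide_distrib[symmetric] q(2) algebra_simps)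
  moreover have "(\<Sum>g | g permutes insert x A. Z' g) =
      (\<Sum>g | g permutes insert x A. Z g) + q ^ s * (\<Sum>g | g permutes insert x A. R g)"
    using \<theta> A by (simp add: Z'_def sum.distrib sum_distrib_left jm_op_sum)
  ultimately have 5: "(\<Sum>g | g permutes insert x A. Z' g) = (1 - q ^ Suc s) * (\<Sum>g | g permutes A. f g)"
    by (simp only: Z(5)) (simp add: algebra_simps)
  show ?case using 1 2 3 4 5 by (intro exI[of _ Z']) auto
qed

text \<open>\<open>X i\<close> is the part of the law on which exactly \<open>i\<close> points have not been randomised.\<close>

lemma walk_law_mixture:
  fixes A :: "'a set" and \<theta> :: real
  assumes "finite A" "\<theta> \<ge> 1" "card A \<le> N"
  shows "\<exists>X. (\<forall>g. walk_law \<theta> A s g = (\<Sum>i\<le>card A. X i g)) \<and> (\<forall>i g. 0 \<le> X i g) \<and>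
    (\<forall>i g. \<not> g permutes A \<longrightarrow> X i g = 0) \<and> (\<forall>i g. card A < i \<longrightarrow> X i g = 0) \<and>
    (\<forall>i g. X i g \<le> real N ^ i / fact (card A) * (\<Sum>h | h permutes A. X i h)) \<and>
    (\<Sum>i\<le>card A. \<Sum>h | h permutes A. X i h) = 1 \<and>
    (\<Sum>i\<le>card A. real i * (\<Sum>h | h permutes A. X i h)) = (\<Sum>k<card A. ((\<theta> - 1) / (\<theta> + k)) ^ s)"
  using assms
proof (induction A rule: finite_induct)
  case empty
  have "(cycle_op \<theta> {} ^^ s) f = f" for f :: "('a \<Rightarrow> 'a) \<Rightarrow> real" by (induction s) auto
  then show ?case
    by (intro exI[of _ "\<lambda>i g. if i = 0 \<and> g = id then 1 else 0"]) (auto simp: walk_law_def)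
next
  case (insert x A)
  define a where "a = card A"
  define q where "q = (\<theta> - 1) / (\<theta> + card A)"
  have cardi: "card (insert x A) = Suc a" using insert by (simp add: a_def)
  have pos: "\<theta> + card A > 0" using insert.prems by (simp add: add_pos_nonneg)
  have q: "0 \<le> q ^ s" "q ^ s \<le> 1"
    using insert.prems pos by (auto simp: q_def power_le_one)
  obtain X where X: "\<And>g. walk_law \<theta> A s g = (\<Sum>i\<le>a. X i g)" "\<And>i g. 0 \<le> X i g"
    "\<And>i g. \<not> g permutes A \<Longrightarrow> X i g = 0" "\<And>i g. a < i \<Longrightarrow> X i g = 0"
    "\<And>i g. X i g \<le> real N ^ i / fact a * (\<Sum>h | h permutes A. X i h)"
    "(\<Sum>i\<le>a. \<Sum>h | h permutes A. X i h) = 1"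
    "(\<Sum>i\<le>a. real i * (\<Sum>h | h permutes A. X i h)) = (\<Sum>k<a. ((\<theta> - 1) / (\<theta> + k)) ^ s)"
    using insert.IH insert.prems insert.hyps by (auto simp: a_def)
  define m where "m = (\<lambda>i. \<Sum>h | h permutes A. X i h)"
  define M where "M = (\<lambda>i. real N ^ i / fact a * m i)"
  have m0: "0 \<le> m i" for i unfolding m_def by (intro sum_nonneg X(2))
  have "\<exists>Z. (\<forall>g. (jm_op \<theta> x A ^^ s) (X i) g = q ^ s * X i g + Z g) \<and> (\<forall>g. 0 \<le> Z g) \<and>
    (\<forall>g. \<not> g permutes insert x A \<longrightarrow> Z g = 0) \<and> (\<forall>g. Z g \<le> (1 - q ^ s) * (M i / (card A + 1))) \<and>
    (\<Sum>g | g permutes insert x A. Z g) = (1 - q ^ s) * (\<Sum>g | g permutes A. X i g)" for i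
    unfolding q_def
    by (rule jm_op_funpow_mixture[OF insert.hyps insert.prems(1)])
      (use X in \<open>auto simp: M_def m_def\<close>)
  then obtain Z where Z: "\<And>i g. (jm_op \<theta> x A ^^ s) (X i) g = q ^ s * X i g + Z i g" "\<And>i g. 0 \<le> Z i g"
    "\<And>i g. \<not> g permutes insert x A \<Longrightarrow> Z i g = 0" "\<And>i g. Z i g \<le> (1 - q ^ s) * (M i / (card A + 1))"
    "\<And>i. (\<Sum>g | g permutes insert x A. Z i g) = (1 - q ^ s) * m i"
    unfolding m_def by metis
  \<comment> \<open>With weight \<open>q ^ s\<close> the new point stays unrandomised and the index
    rises by one; the part \<open>Z i\<close> keeps its index. \<open>m'\<close> is the same
    recursion for the masses.\<close>
  define X' where "X' = (\<lambda>i g. (if i = 0 then 0 else q ^ s * X (i - 1) g) + Z i g)"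
  define m' where "m' = (\<lambda>i. (if i = 0 then 0 else q ^ s * m (i - 1)) + (1 - q ^ s) * m i)"
  have mS: "m (Suc a) = 0" unfolding m_def by (intro sum.neutral) (simp add: X(4))
  have ZS: "Z i g = 0" if "a < i" for i g
  proof -
    have "m i = 0" unfolding m_def by (intro sum.neutral) (simp add: X(4) that)
    then show ?thesis using Z(2)[of i g] Z(4)[of i g] by (simp add: M_def)
  qed
  have mass: "(\<Sum>h | h permutes insert x A. X' i h) = m' i" for i
  proof -
    have "(\<Sum>g | g permutes insert x A. X j g) = m j" for j
      unfolding m_def by (rule sum_permutes_insert_support[OF insert.hyps(1) X(3)])
    then show ?thesis using Z(5)[of i]
      by (simp add: X'_def m'_def sum.distrib sum_distrib_left[symmetric])
  qed
  have shift: "(\<Sum>i\<le>Suc a. F i + G i) = (\<Sum>i\<le>a. F (Suc i) + G i)"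
    if "F 0 = 0" "G (Suc a) = 0" for F G :: "nat \<Rightarrow> real"
  proof -
    have "(\<Sum>i\<le>Suc a. F i) = (\<Sum>i\<le>a. F (Suc i))" "(\<Sum>i\<le>Suc a. G i) = (\<Sum>i\<le>a. G i)"
      using that sum.atMost_Suc_shift[of F a] by simp_all
    then show ?thesis by (simp only: sum.distrib)
  qed
  have 1: "walk_law \<theta> (insert x A) s g = (\<Sum>i\<le>Suc a. X' i g)" for g
  proof -
    have lin: "(jm_op \<theta> x A ^^ s) (\<lambda>g. \<Sum>i\<le>n. X i g) = (\<lambda>g. \<Sum>i\<le>n. (jm_op \<theta> x A ^^ s) (X i) g)" for n
    proof (induction n)
      case (Suc n)
      have "(jm_op \<theta> x A ^^ s) (\<lambda>g. 1 * f g + 1 * h g) = (\<lambda>g. 1 * (jm_op \<theta> x A ^^ s) f g + 1 * (jm_op \<theta> x A ^^ s) h g)" for f h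
      proof (induction s)
        case (Suc s)
        then show ?case using jm_op_add_scaled[of \<theta> x A 1 "(jm_op \<theta> x A ^^ s) f" 1 "(jm_op \<theta> x A ^^ s) h"] by simp
      qed simp
      then show ?case using Suc by simp
    qed simp
    have "walk_law \<theta> (insert x A) s = (jm_op \<theta> x A ^^ s) (walk_law \<theta> A s)"
      unfolding walk_law_def by (rule cycle_op_funpow_insert[OF insert.hyps])
    also have "walk_law \<theta> A s = (\<lambda>g. \<Sum>i\<le>a. X i g)" using X(1) by auto
    finally have "walk_law \<theta> (insert x A) s g = (\<Sum>i\<le>a. q ^ s * X i g + Z i g)"
      by (simp add: lin Z(1))
    then show ?thesis unfolding X'_def by (subst shift) (auto simp: ZS)
  qed
  have 2: "X' i g \<le> real N ^ i / fact (Suc a) * m' i" for i g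
  proof -
    define K where "K = real N ^ i / fact (Suc a)"
    have "Z i g \<le> K * ((1 - q ^ s) * m i)"
      using Z(4)[of i g] by (simp add: M_def a_def K_def algebra_simps)
    \<comment> \<open>An unrandomised point does not divide the density by \<open>Suc a\<close>.
      Inserting that divisor all the same costs a factor \<open>Suc a\<close>, at most
      \<open>N\<close>; this is the origin of the power \<open>N ^ i\<close>.\<close>
    moreover have "q ^ s * X (i - 1) g \<le> K * (q ^ s * m (i - 1))" if i: "i > 0"
    proof -
      have "real N ^ (i - 1) * real (Suc a) \<le> real N ^ (i - 1) * real N"
        using insert.prems cardi by (intro mult_left_mono) auto
      also have "\<dots> = real N ^ i" using i by (metis Suc_diff_1 power_Suc2)
      finally have "real N ^ (i - 1) * real (Suc a) / fact (Suc a) \<le> real N ^ i / fact (Suc a)"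
        by (intro divide_right_mono) auto
      moreover have "real N ^ (i - 1) * real (Suc a) / fact (Suc a) = real N ^ (i - 1) / fact a"
        unfolding fact_Suc by (subst mult.commute) (rule mult_divide_mult_cancel_left, simp)
      ultimately have "real N ^ (i - 1) / fact a \<le> K" by (simp only: K_def)
      then have "X (i - 1) g \<le> K * m (i - 1)"
        using X(5)[of "i - 1" g] m0[of "i - 1"] unfolding m_def
        by (meson mult_right_mono order_trans)
      then have "q ^ s * X (i - 1) g \<le> q ^ s * (K * m (i - 1))"
        using q by (intro mult_left_mono) auto
      then show ?thesis by (simp only: mult_ac)
    qed
    ultimately have "X' i g \<le> K * m' i" by (cases "i = 0") (auto simp: X'_def m'_def algebra_simps)
    then show ?thesis by (simp only: K_def)
  qed
  have X7: "(\<Sum>i\<le>a. real i * m i) = (\<Sum>k<a. ((\<theta> - 1) / (\<theta> + k)) ^ s)" and X6: "(\<Sum>i\<le>a. m i) = 1"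
    using X(6,7) by (simp_all add: m_def)
  have 3: "(\<Sum>i\<le>Suc a. m' i) = 1"
    unfolding m'_def by (subst shift) (auto simp: mS X6 algebra_simps)
  have "(\<Sum>i\<le>Suc a. real i * m' i) =
      (\<Sum>i\<le>Suc a. (if i = 0 then 0 else real i * q ^ s * m (i - 1)) + real i * (1 - q ^ s) * m i)"
    unfolding m'_def by (intro sum.cong refl) (auto simp: algebra_simps)
  also have "\<dots> = (\<Sum>i\<le>a. real i * m i + q ^ s * m i)"
    by (subst shift) (auto simp: mS algebra_simps)
  also have "\<dots> = (\<Sum>k<Suc a. ((\<theta> - 1) / (\<theta> + k)) ^ s)"
    by (simp add: sum.distrib sum_distrib_left[symmetric] X6[unfolded a_def] X7[unfolded a_def] q_def a_def)
  finally have 4: "(\<Sum>i\<le>Suc a. real i * m' i) = (\<Sum>k<Suc a. ((\<theta> - 1) / (\<theta> + k)) ^ s)" .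
  have 5: "0 \<le> X' i g" for i g using X(2) Z(2) q by (simp add: X'_def)
  have 6: "X' i g = 0" if "\<not> g permutes insert x A" for i g
    using that X(3)[of g] Z(3)[of g] permutes_imp_permutes_insert[of g A x] by (auto simp: X'_def)
  have 7: "X' i g = 0" if "Suc a < i" for i g
    using that ZS X(4) by (simp add: X'_def)
  show ?case unfolding cardi
    by (intro exI[of _ X']) (use 1 2 3 4 5 6 7 mass in auto)
qed

section \<open>Upper bound for a fixed parameter\<close>

lemma walk_tv_eq:
  "walk_tv n \<theta> t = 1/2 * (\<Sum>g | g permutes {1..n}. \<bar>walk_law \<theta> {1..n} t g - 1 / fact n\<bar>)"
proof -
  have "card (carrier (sym_group n)) = fact n"
    by (simp add: sym_group_def card_permutations)
  moreover have "carrier (sym_group n) = {g. g permutes {1..n}}" by (simp add: sym_group_def)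
  ultimately show ?thesis
    unfolding walk_tv_def tv_dist_def
    by (intro arg_cong[where f = "\<lambda>x. 1/2 * x"] sum.cong) (auto simp: conv_power_sym_group)
qed

lemma sum_permutes_const:
  assumes "finite A"
  shows "(\<Sum>g | g permutes A. c) = fact (card A) * (c :: real)"
  using assms by (simp add: card_permutations)

text \<open>The component with index 0 has mass \<open>m 0\<close> and density at most
  \<open>m 0 / fact n\<close>, so it is a multiple of the uniform law. The mass of the rest is at
  most the mean number of unrandomised points.\<close>

lemma walk_tv_le_sum:
  fixes \<theta> :: real
  assumes \<theta>: "\<theta> \<ge> 1"
  shows "walk_tv n \<theta> t \<le> (\<Sum>k<n. ((\<theta> - 1) / (\<theta> + real k)) ^ t)"
proof -
  let ?G = "{g. g permutes {1..n}}"
  obtain X where X: "\<And>g. walk_law \<theta> {1..n} t g = (\<Sum>i\<le>n. X i g)" "\<And>i g. 0 \<le> X i g"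
    "\<And>i g. X i g \<le> real n ^ i / fact n * (\<Sum>h\<in>?G. X i h)" "(\<Sum>i\<le>n. \<Sum>h\<in>?G. X i h) = 1"
    "(\<Sum>i\<le>n. real i * (\<Sum>h\<in>?G. X i h)) = (\<Sum>k<n. ((\<theta> - 1) / (\<theta> + k)) ^ t)"
    using walk_law_mixture[of "{1..n}" \<theta> n t] \<theta> by auto
  define m where "m = (\<lambda>i. \<Sum>h\<in>?G. X i h)"
  have m: "0 \<le> m i" for i unfolding m_def by (intro sum_nonneg X(2))
  have fin: "finite ?G" by (simp add: finite_permutations)
  have split: "(\<Sum>i\<le>n. F i) = F 0 + (\<Sum>i\<in>{1..n}. F i)" for F :: "nat \<Rightarrow> real"
    by (simp add: atMost_atLeast0 sum.atLeast_Suc_atMost)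
  have le: "X 0 g \<le> m 0 / fact n" for g using X(3)[of 0 g] by (simp add: m_def)
  have eq: "X 0 g = m 0 / fact n" if "g \<in> ?G" for g
  proof -
    have "(\<Sum>h\<in>?G. m 0 / fact n - X 0 h) = 0"
      using sum_permutes_const[of "{1..n}" "m 0 / fact n"] by (simp add: sum_subtractf m_def)
    then have "m 0 / fact n - X 0 g = 0"
      using sum_nonneg_eq_0_iff[OF fin, of "\<lambda>h. m 0 / fact n - X 0 h"] le that by auto
    then show ?thesis by simp
  qed
  have m1: "m 0 + (\<Sum>i\<in>{1..n}. m i) = 1" using X(4) by (simp add: split m_def)
  have m01: "m 0 \<le> 1" using m1 m by (metis le_add_same_cancel1 sum_nonneg)
  have "(\<Sum>g\<in>?G. \<bar>walk_law \<theta> {1..n} t g - 1 / fact n\<bar>) \<le> (\<Sum>g\<in>?G. (1 - m 0) / fact n + (\<Sum>i\<in>{1..n}. X i g))"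
  proof (rule sum_mono)
    fix g assume "g \<in> ?G"
    then have "walk_law \<theta> {1..n} t g = m 0 / fact n + (\<Sum>i\<in>{1..n}. X i g)"
      using eq by (simp only: X(1) split)
    then have "walk_law \<theta> {1..n} t g - 1 / fact n = (\<Sum>i\<in>{1..n}. X i g) - (1 - m 0) / fact n"
      by (simp only: diff_divide_distrib)
    moreover have "(\<Sum>i\<in>{1..n}. X i g) \<ge> 0" by (intro sum_nonneg X(2))
    moreover have "(1 - m 0) / fact n \<ge> 0" using m01 by simp
    ultimately show "\<bar>walk_law \<theta> {1..n} t g - 1 / fact n\<bar> \<le> (1 - m 0) / fact n + (\<Sum>i\<in>{1..n}. X i g)"
      by linarith
  qed
  also have "\<dots> = (1 - m 0) + (\<Sum>i\<in>{1..n}. m i)"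
  proof -
    have "(\<Sum>g\<in>?G. \<Sum>i\<in>{1..n}. X i g) = (\<Sum>i\<in>{1..n}. m i)"
      unfolding m_def by (rule sum.swap)
    moreover have "(\<Sum>g\<in>?G. (1 - m 0) / fact n) = 1 - m 0"
      using sum_permutes_const[of "{1..n}" "(1 - m 0) / fact n"] by simp
    ultimately show ?thesis by (simp only: sum.distrib)
  qed
  also have "\<dots> = 2 * (\<Sum>i\<in>{1..n}. m i)" using m1 by simp
  finally have "walk_tv n \<theta> t \<le> (\<Sum>i\<in>{1..n}. m i)" by (simp add: walk_tv_eq)
  also have "\<dots> \<le> (\<Sum>i\<in>{1..n}. real i * m i)"
  proof (rule sum_mono)
    fix i assume "i \<in> {1..n}"
    then show "m i \<le> real i * m i" using mult_right_mono[of 1 "real i" "m i"] m[of i] by simp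
  qed
  also have "\<dots> = (\<Sum>k<n. ((\<theta> - 1) / (\<theta> + k)) ^ t)" using X(5) by (simp add: split m_def)
  finally show ?thesis .
qed

lemma sum_inverse_squares_le: "(\<Sum>k<n. 1 / (1 + real k) ^ 2) \<le> 2"
proof -
  have "(\<Sum>k<n. 1 / (1 + real k) ^ 2) \<le> 2 - 1 / real n" if "n \<ge> 1" for n
    using that
  proof (induction n rule: nat_induct_at_least)
    case (Suc n)
    have "1 / (1 + real n) ^ 2 \<le> 1 / real n - 1 / (1 + real n)"
    proof -
      define x where "x = real n"
      have x: "x \<ge> 1" using Suc.hyps by (simp add: x_def)
      have "1 / (1 + x) ^ 2 \<le> 1 / (x * (1 + x))"
        using x by (intro divide_left_mono) (auto simp: power2_eq_square)
      also have "\<dots> = 1 / x - 1 / (1 + x)" using x by (simp add: field_simps)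
      finally show ?thesis by (simp only: x_def)
    qed
    then show ?case using Suc.IH by simp
  qed simp
  from this[of n] show ?thesis by (cases "n = 0") (auto intro: order_trans)
qed

text \<open>The elementary inequality behind the exponent: \<open>t / \<theta> \<ge> \<alpha> (\<theta>\<^sup>2 + 1) / (2 \<theta>) \<ge> \<alpha>\<close>.\<close>

lemma walk_tv_fixed_parameter:
  fixes \<theta> :: real
  assumes \<theta>: "\<theta> > 1" and \<alpha>: "\<alpha> > 1" and t: "real t \<ge> \<alpha> * ((\<theta>\<^sup>2 + 1) / 2)"
  shows "walk_tv n \<theta> t < (2 * \<theta>\<^sup>2 + 1) * exp (- \<alpha>)"
proof -
  define q where "q = (\<theta> - 1) / \<theta>"
  have q: "0 \<le> q" "q \<le> exp (- (1 / \<theta>))"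
    using \<theta> exp_ge_add_one_self[of "- (1 / \<theta>)"] by (auto simp: q_def field_simps)
  have "\<theta>\<^sup>2 > 1" using \<theta> by (simp add: one_less_power)
  then have "(\<theta>\<^sup>2 + 1) / 2 > 1" by simp
  then have "\<alpha> * ((\<theta>\<^sup>2 + 1) / 2) > 1" using \<alpha> by (metis less_trans mult.right_neutral mult_strict_left_mono zero_less_one)
  then have t2: "t \<ge> 2" using t by linarith
  \<comment> \<open>\<open>q ^ t\<close> carries the exponential decay; \<open>t \<ge> 2\<close>
    leaves a square over, whose sum over \<open>k\<close> is bounded independently of
    \<open>n\<close>.\<close>
  have ratio: "((\<theta> - 1) / (\<theta> + k)) ^ t \<le> q ^ t * (\<theta>\<^sup>2 * (1 / (1 + real k) ^ 2))" for k
  proof -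
    have r: "0 \<le> \<theta> / (\<theta> + k)" "\<theta> / (\<theta> + k) \<le> 1" using \<theta> by (auto simp: divide_le_eq)
    have "((\<theta> - 1) / (\<theta> + k)) ^ t = q ^ t * (\<theta> / (\<theta> + k)) ^ t"
      using \<theta> by (simp add: q_def power_mult_distrib[symmetric])
    also have "\<dots> \<le> q ^ t * (\<theta> / (\<theta> + k)) ^ 2"
      using r q t2 by (intro mult_left_mono power_decreasing) auto
    also have "\<dots> \<le> q ^ t * (\<theta> / (1 + k)) ^ 2"
      using \<theta> q by (intro mult_left_mono power_mono divide_left_mono) (auto intro!: mult_pos_pos)
    finally show ?thesis by (simp add: power_divide)
  qed
  have "walk_tv n \<theta> t \<le> (\<Sum>k<n. ((\<theta> - 1) / (\<theta> + k)) ^ t)"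
    using walk_tv_le_sum[of \<theta> n t] \<theta> by simp
  also have "\<dots> \<le> (\<Sum>k<n. q ^ t * (\<theta>\<^sup>2 * (1 / (1 + real k) ^ 2)))"
    by (intro sum_mono ratio)
  also have "\<dots> = q ^ t * (\<theta>\<^sup>2 * (\<Sum>k<n. 1 / (1 + real k) ^ 2))"
    by (simp add: sum_distrib_left)
  also have "\<dots> \<le> q ^ t * (\<theta>\<^sup>2 * 2)"
    using q by (intro mult_left_mono sum_inverse_squares_le) auto
  also have "\<dots> \<le> exp (- \<alpha>) * (\<theta>\<^sup>2 * 2)"
  proof (intro mult_right_mono)
    have "q ^ t \<le> exp (- (1 / \<theta>)) ^ t" using q by (intro power_mono) auto
    also have "\<dots> = exp (- (real t / \<theta>))" by (simp add: exp_of_nat_mult[symmetric])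
    also have "\<dots> \<le> exp (- \<alpha>)"
    proof -
      have "2 * \<theta> \<le> \<theta>\<^sup>2 + 1" using zero_le_power2[of "\<theta> - 1"] by (simp add: power2_eq_square algebra_simps)
      then have "\<alpha> * \<theta> \<le> \<alpha> * ((\<theta>\<^sup>2 + 1) / 2)" using \<alpha> by (intro mult_left_mono) auto
      then have "\<alpha> * \<theta> \<le> real t" using t by linarith
      then show ?thesis using \<theta> by (simp add: le_divide_eq)
    qed
    finally show "q ^ t \<le> exp (- \<alpha>)" .
  qed simp
  \<comment> \<open>The extra 1 in the constant is there to make the inequality strict.\<close>
  also have "\<dots> < (2 * \<theta>\<^sup>2 + 1) * exp (- \<alpha>)" by (simp add: algebra_simps)
  finally show ?thesis .
qed

section \<open>Central operators\<close>

text \<open>The operators considered here multiply by elements of the group algebra from the left.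
  For these, commuting with left translations is a genuine condition: it says that the element is
  central.\<close>

definition central_operator :: "'a set \<Rightarrow> ((('a \<Rightarrow> 'a) \<Rightarrow> real) \<Rightarrow> ('a \<Rightarrow> 'a) \<Rightarrow> real) \<Rightarrow> bool" where
  "central_operator S Q \<longleftrightarrow>
     (\<forall>u f g. u permutes S \<longrightarrow> Q f (u \<circ> g) = Q (\<lambda>v. f (u \<circ> v)) g)"

definition avg_op :: "'a set \<Rightarrow> (('a \<Rightarrow> 'a) \<Rightarrow> real) \<Rightarrow> ('a \<Rightarrow> 'a) \<Rightarrow> real" where
  "avg_op A f g = (\<Sum>h | h permutes A. f (h \<circ> g)) / fact (card A)"

lemma symmetric_operator_group_algebra:
  assumes S: "finite S" "A \<subseteq> S" and a: "\<And>h. h permutes A \<Longrightarrow> a (inv' h) = a h"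
  shows "symmetric_operator {g. g permutes S} (\<lambda>f g. \<Sum>h | h permutes A. a h * f (h \<circ> g))"
  unfolding symmetric_operator_def
proof (intro conjI allI impI ballI)
  fix f k :: "('a \<Rightarrow> 'a) \<Rightarrow> real" and c d
  show "(\<lambda>g. \<Sum>h | h permutes A. a h * (c * f (h \<circ> g) + d * k (h \<circ> g))) =
      (\<lambda>g. c * (\<Sum>h | h permutes A. a h * f (h \<circ> g)) + d * (\<Sum>h | h permutes A. a h * k (h \<circ> g)))"
    by (simp add: sum_distrib_left sum.distrib algebra_simps)
next
  fix f k :: "('a \<Rightarrow> 'a) \<Rightarrow> real" and g
  assume fk: "\<forall>g\<in>{g. g permutes S}. f g = k g" and g: "g \<in> {g. g permutes S}"
  show "(\<Sum>h | h permutes A. a h * f (h \<circ> g)) = (\<Sum>h | h permutes A. a h * k (h \<circ> g))"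
  proof (intro sum.cong refl)
    fix h assume "h \<in> {h. h permutes A}"
    then have "h permutes S" using S(2) permutes_subset by blast
    then have "h \<circ> g permutes S" using g permutes_compose by blast
    then show "a h * f (h \<circ> g) = a h * k (h \<circ> g)" using fk by simp
  qed
next
  fix f k :: "('a \<Rightarrow> 'a) \<Rightarrow> real"
  let ?G = "{g. g permutes S}"
  have "(\<Sum>g\<in>?G. f g * (\<Sum>h | h permutes A. a h * k (h \<circ> g))) =
      (\<Sum>h | h permutes A. a h * (\<Sum>g\<in>?G. f g * k (h \<circ> g)))"
    by (simp add: sum_distrib_left sum.swap[of _ ?G] algebra_simps)
  also have "\<dots> = (\<Sum>h | h permutes A. a h * (\<Sum>g\<in>?G. f (inv' h \<circ> g) * k g))"
  proof (rule sum.cong[OF refl])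
    fix h assume "h \<in> {h. h permutes A}"
    then have h: "h permutes S" using S(2) permutes_subset by blast
    have "(\<Sum>g\<in>?G. f (inv' h \<circ> g) * k g) = (\<Sum>g\<in>?G. f (inv' h \<circ> (h \<circ> g)) * k (h \<circ> g))"
      by (rule setum_permutations_compose_left[OF h])
    also have "\<dots> = (\<Sum>g\<in>?G. f g * k (h \<circ> g))"
      using permutes_inv_o(2)[OF h] by (simp add: comp_assoc[symmetric])
    finally show "a h * (\<Sum>g\<in>?G. f g * k (h \<circ> g)) = a h * (\<Sum>g\<in>?G. f (inv' h \<circ> g) * k g)" by simp
  qed
  also have "\<dots> = (\<Sum>h | h permutes A. a (inv' h) * (\<Sum>g\<in>?G. f (inv' (inv' h) \<circ> g) * k g))"
    by (rule sum_permutations_inverse)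
  also have "\<dots> = (\<Sum>h | h permutes A. a h * (\<Sum>g\<in>?G. f (h \<circ> g) * k g))"
    by (rule sum.cong[OF refl]) (simp add: a permutes_inv_inv)
  also have "\<dots> = (\<Sum>g\<in>?G. (\<Sum>h | h permutes A. a h * f (h \<circ> g)) * k g)"
    by (simp add: sum_distrib_left sum_distrib_right sum.swap[of _ ?G] algebra_simps)
  finally show "(\<Sum>g\<in>?G. f g * (\<Sum>h | h permutes A. a h * k (h \<circ> g))) =
      (\<Sum>g\<in>?G. (\<Sum>h | h permutes A. a h * f (h \<circ> g)) * k g)" .
qed

lemma symmetric_operator_cycle_op:
  assumes "finite S"
  shows "symmetric_operator {g. g permutes S} (cycle_op \<theta> S)"
proof -
  have "symmetric_operator {g. g permutes S}
      (\<lambda>f g. \<Sum>h | h permutes S. \<theta> ^ card (orbit h ` S) / pochhammer \<theta> (card S) * f (h \<circ> g))"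
    by (intro symmetric_operator_group_algebra assms order_refl)
      (simp add: orbit_inv_permutes[OF assms])
  then show ?thesis by (simp add: cycle_op_def[abs_def])
qed

lemma avg_op_group_algebra: "avg_op A = (\<lambda>f g. \<Sum>h | h permutes A. 1 / fact (card A) * f (h \<circ> g))"
  by (intro ext) (simp add: avg_op_def sum_divide_distrib)

lemma symmetric_operator_avg_op:
  assumes "finite S" "A \<subseteq> S"
  shows "symmetric_operator {g. g permutes S} (avg_op A)"
  unfolding avg_op_group_algebra by (intro symmetric_operator_group_algebra assms) auto

lemma avg_op_invariant:
  assumes "finite A" "u permutes A"
  shows "avg_op A f (u \<circ> g) = avg_op A f g"
  using sum_permutations_compose_right[OF assms(2), of "\<lambda>h. f (h \<circ> g)"]
  by (simp add: avg_op_def comp_assoc)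

lemma avg_op_of_invariant:
  assumes "finite A" "\<And>h. h permutes A \<Longrightarrow> f (h \<circ> g) = f g"
  shows "avg_op A f g = f g"
proof -
  have "(\<Sum>h | h permutes A. f (h \<circ> g)) = fact (card A) * f g"
    using assms by (simp add: card_permutations)
  then show ?thesis by (simp add: avg_op_def)
qed

text \<open>\<open>avg_op A\<close> is the orthogonal projection onto the functions invariant under
  left multiplication by permutations of \<open>A\<close>.\<close>

lemma avg_op_inner_eq:
  assumes "finite S" "A \<subseteq> S"
  shows "(\<Sum>g | g permutes S. f g * avg_op A f g) = (\<Sum>g | g permutes S. (avg_op A f g)\<^sup>2)"
proof -
  have A: "finite A" using assms by (rule finite_subset[rotated])
  have "avg_op A (avg_op A f) = avg_op A f"
    by (intro ext avg_op_of_invariant avg_op_invariant A)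
  then show ?thesis
    using symmetric_operator_sym[OF symmetric_operator_avg_op[OF assms], of f "avg_op A f"]
    by (simp add: power2_eq_square)
qed

section \<open>Conjugation invariance of cycle counts and of sums of averages\<close>

lemma orbit_conjugate:
  assumes "inj u" "\<And>z. p (u z) = u (q z)"
  shows "orbit p (u y) = u ` orbit q y"
proof (intro equalityI subsetI)
  fix z assume "z \<in> orbit p (u y)"
  then show "z \<in> u ` orbit q y"
    by (induction rule: orbit.induct) (auto simp: assms(2) intro: orbit.intros)
next
  fix z assume "z \<in> u ` orbit q y"
  then obtain w where w: "w \<in> orbit q y" "z = u w" by auto
  from w(1) have "u w \<in> orbit p (u y)"
    by (induction rule: orbit.induct) (metis assms(2) orbit.intros)+
  then show "z \<in> orbit p (u y)" by (simp add: w(2))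
qed

lemma card_orbits_conjugate:
  assumes u: "u permutes S" and eq: "\<And>z. p (u z) = u (q z)"
  shows "card (orbit p ` S) = card (orbit q ` S)"
proof -
  have "orbit p ` S = orbit p ` (u ` S)" by (simp only: permutes_image[OF u])
  also have "\<dots> = (\<lambda>C. u ` C) ` (orbit q ` S)"
    using orbit_conjugate[of u p q] permutes_inj[OF u] eq by (auto simp: image_image)
  finally show ?thesis
    using permutes_inj[OF u] by (simp add: card_image inj_on_def inj_image_eq_iff)
qed

lemma conjugate_permutes_image:
  assumes u: "u permutes S" and A: "A \<subseteq> S"
  shows "bij_betw (\<lambda>h. u \<circ> h \<circ> inv' u) {h. h permutes A} {h. h permutes u ` A}"
proof (rule bij_betw_byWitness[where f' = "\<lambda>h. inv' u \<circ> h \<circ> u"])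
  have iu: "inv' u \<circ> u = id" "u \<circ> inv' u = id" "bij u"
    using u by (simp_all add: permutes_inv_o permutes_bij)
  have conj: "v \<circ> h \<circ> inv' v permutes v ` B" if v: "bij v" and h: "h permutes B" for v h :: "'a \<Rightarrow> 'a" and B
  proof (rule bij_imp_permutes)
    have inv: "inv' v (v z) = z" "v (inv' v z) = z" for z
      using v by (simp_all add: bij_is_inj bij_is_surj surj_f_inv_f)
    show "bij_betw (v \<circ> h \<circ> inv' v) (v ` B) (v ` B)"
    proof (rule bij_betw_trans[of "inv' v" _ B, unfolded comp_assoc[symmetric], rotated])
      show "bij_betw (v \<circ> h) B (v ` B)"
        using permutes_imp_bij[OF h] v
        by (metis bij_betw_trans bij_betw_subset subset_UNIV inj_on_imp_bij_betw inj_on_subset bij_is_inj)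
      show "bij_betw (inv' v) (v ` B) B"
        using inv by (intro bij_betw_byWitness[where f' = v]) auto
    qed
    show "(v \<circ> h \<circ> inv' v) x = x" if "x \<notin> v ` B" for x
    proof -
      have "inv' v x \<notin> B" using that inv(2)[of x] by (metis imageI)
      then show ?thesis using permutes_not_in[OF h] inv by simp
    qed
  qed
  show "\<forall>h\<in>{h. h permutes A}. inv' u \<circ> (u \<circ> h \<circ> inv' u) \<circ> u = h"
    using iu by (simp add: fun_eq_iff)
  show "\<forall>h\<in>{h. h permutes u ` A}. u \<circ> (inv' u \<circ> h \<circ> u) \<circ> inv' u = h"
    using iu by (simp add: fun_eq_iff)
  show "(\<lambda>h. u \<circ> h \<circ> inv' u) ` {h. h permutes A} \<subseteq> {h. h permutes u ` A}"
    using conj[OF iu(3)] by auto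
  have "inv' u ` u ` A = A" using iu by (simp add: image_comp)
  then show "(\<lambda>h. inv' u \<circ> h \<circ> u) ` {h. h permutes u ` A} \<subseteq> {h. h permutes A}"
    using conj[of "inv' u" _ "u ` A"] iu(3) by (auto simp: bij_imp_bij_inv inv_inv_eq)
qed

lemma sum_conjugate:
  assumes u: "u permutes S" and A: "A \<subseteq> S"
  shows "(\<Sum>h | h permutes u ` A. F h) = (\<Sum>h | h permutes A. F (u \<circ> h \<circ> inv' u))"
  using sum.reindex_bij_betw[OF conjugate_permutes_image[OF assms], of F] by simp

lemma central_operator_cycle_op: "central_operator S (cycle_op \<theta> S)"
  unfolding central_operator_def
proof (intro allI impI)
  fix u g :: "'a \<Rightarrow> 'a" and f :: "('a \<Rightarrow> 'a) \<Rightarrow> real" assume u: "u permutes S"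
  have iu: "inv' u \<circ> u = id" using u by (simp add: permutes_inv_o)
  have "cycle_op \<theta> S f (u \<circ> g) =
      (\<Sum>h | h permutes u ` S. \<theta> ^ card (orbit h ` S) / pochhammer \<theta> (card S) * f (h \<circ> (u \<circ> g)))"
    by (simp only: cycle_op_def permutes_image[OF u])
  also have "\<dots> = (\<Sum>h | h permutes S. \<theta> ^ card (orbit (u \<circ> h \<circ> inv' u) ` S) / pochhammer \<theta> (card S) *
      f (u \<circ> h \<circ> inv' u \<circ> (u \<circ> g)))"
    by (rule sum_conjugate[OF u order_refl])
  also have "\<dots> = cycle_op \<theta> S (\<lambda>v. f (u \<circ> v)) g"
    unfolding cycle_op_def
  proof (rule sum.cong[OF refl])
    fix h :: "'a \<Rightarrow> 'a"
    have "card (orbit (u \<circ> h \<circ> inv' u) ` S) = card (orbit h ` S)"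
      using iu by (intro card_orbits_conjugate[OF u]) (simp add: fun_eq_iff)
    moreover have "u \<circ> h \<circ> inv' u \<circ> (u \<circ> g) = u \<circ> (h \<circ> g)"
      using iu by (simp add: fun_eq_iff)
    ultimately show "\<theta> ^ card (orbit (u \<circ> h \<circ> inv' u) ` S) / pochhammer \<theta> (card S) *
        f (u \<circ> h \<circ> inv' u \<circ> (u \<circ> g)) = \<theta> ^ card (orbit h ` S) / pochhammer \<theta> (card S) * f (u \<circ> (h \<circ> g))"
      by simp
  qed
  finally show "cycle_op \<theta> S f (u \<circ> g) = cycle_op \<theta> S (\<lambda>v. f (u \<circ> v)) g" .
qed

lemma central_operator_sum_avg_op:
  assumes S: "finite S"
  shows "central_operator S (\<lambda>f g. \<Sum>A | A \<subseteq> S \<and> card A = m. avg_op A f g)"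
  unfolding central_operator_def
proof (intro allI impI)
  fix u g :: "'a \<Rightarrow> 'a" and f :: "('a \<Rightarrow> 'a) \<Rightarrow> real" assume u: "u permutes S"
  have iu: "inv' u \<circ> u = id" "u \<circ> inv' u = id" using u by (simp_all add: permutes_inv_o)
  let ?C = "{A. A \<subseteq> S \<and> card A = m}"
  have img: "u ` A \<in> ?C" if "A \<in> ?C" "u permutes S" for u :: "'a \<Rightarrow> 'a" and A
  proof -
    have "card (u ` A) = card A" using permutes_inj_on[OF that(2)] by (rule card_image)
    moreover have "u ` A \<subseteq> S" using that permutes_image[OF that(2)] by blast
    ultimately show ?thesis using that by simp
  qed
  have "bij_betw (\<lambda>A. u ` A) ?C ?C"
  proof (rule bij_betw_byWitness[where f' = "\<lambda>A. inv' u ` A"])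
    show "\<forall>a\<in>?C. inv' u ` u ` a = a" "\<forall>a\<in>?C. u ` inv' u ` a = a"
      by (simp_all add: image_comp iu)
    show "(\<lambda>A. u ` A) ` ?C \<subseteq> ?C" using img u by blast
    show "(\<lambda>A. inv' u ` A) ` ?C \<subseteq> ?C" using img permutes_inv[OF u] by blast
  qed
  then have "(\<Sum>A\<in>?C. avg_op A f (u \<circ> g)) = (\<Sum>A\<in>?C. avg_op (u ` A) f (u \<circ> g))"
    by (rule sum.reindex_bij_betw[symmetric])
  also have "\<dots> = (\<Sum>A\<in>?C. avg_op A (\<lambda>v. f (u \<circ> v)) g)"
  proof (rule sum.cong[OF refl])
    fix A assume A: "A \<in> ?C"
    have "(\<Sum>h | h permutes u ` A. f (h \<circ> (u \<circ> g))) = (\<Sum>h | h permutes A. f (u \<circ> h \<circ> inv' u \<circ> (u \<circ> g)))"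
      using A by (intro sum_conjugate[OF u]) auto
    also have "\<dots> = (\<Sum>h | h permutes A. f (u \<circ> (h \<circ> g)))"
    proof (rule sum.cong[OF refl])
      fix h :: "'a \<Rightarrow> 'a"
      have "u \<circ> h \<circ> inv' u \<circ> (u \<circ> g) = u \<circ> (h \<circ> g)" using iu by (simp add: fun_eq_iff)
      then show "f (u \<circ> h \<circ> inv' u \<circ> (u \<circ> g)) = f (u \<circ> (h \<circ> g))" by simp
    qed
    moreover have "card (u ` A) = card A" using permutes_inj_on[OF u] by (rule card_image)
    ultimately show "avg_op (u ` A) f (u \<circ> g) = avg_op A (\<lambda>v. f (u \<circ> v)) g" by (simp add: avg_op_def)
  qed
  finally show "(\<Sum>A\<in>?C. avg_op A f (u \<circ> g)) = (\<Sum>A\<in>?C. avg_op A (\<lambda>v. f (u \<circ> v)) g)" .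
qed

lemma central_operator_funpow:
  assumes "central_operator S Q"
  shows "central_operator S (Q ^^ t)"
proof (induction t)
  case (Suc t)
  show ?case unfolding central_operator_def
  proof (intro allI impI)
    fix u g :: "'a \<Rightarrow> 'a" and f :: "('a \<Rightarrow> 'a) \<Rightarrow> real" assume u: "u permutes S"
    have "(\<lambda>v. (Q ^^ t) f (u \<circ> v)) = (Q ^^ t) (\<lambda>v. f (u \<circ> v))"
      using Suc u by (auto simp: central_operator_def)
    then show "(Q ^^ Suc t) f (u \<circ> g) = (Q ^^ Suc t) (\<lambda>v. f (u \<circ> v)) g"
      using assms u by (simp add: central_operator_def)
  qed
qed (simp add: central_operator_def)

section \<open>Vectors invariant under a maximal Young subgroup\<close>

text \<open>A set partition of \<open>S\<close> is given by a labelling \<open>\<kappa>\<close> whose fibres are the blocks.\<close>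

lemma card_same_label_insert:
  fixes \<kappa> :: "nat \<Rightarrow> nat"
  assumes S: "finite S" "y \<in> S"
  shows "card {(a, b). a \<in> S \<and> b \<in> S \<and> \<kappa> a = \<kappa> b} =
    card {(a, b). a \<in> S - {y} \<and> b \<in> S - {y} \<and> \<kappa> a = \<kappa> b} + 2 * card {b \<in> S - {y}. \<kappa> b = \<kappa> y} + 1"
proof -
  let ?B = "{b \<in> S - {y}. \<kappa> b = \<kappa> y}"
  let ?R = "{(a, b). a \<in> S - {y} \<and> b \<in> S - {y} \<and> \<kappa> a = \<kappa> b}"
  have "{(a, b). a \<in> S \<and> b \<in> S \<and> \<kappa> a = \<kappa> b} = ?R \<union> (Pair y ` ?B \<union> ((\<lambda>b. (b, y)) ` ?B \<union> {(y, y)}))"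
    using S by auto
  moreover have "finite ?R" using S by (intro finite_subset[of ?R "S \<times> S"]) auto
  moreover have "card (Pair y ` ?B) = card ?B" "card ((\<lambda>b. (b, y)) ` ?B) = card ?B"
    by (auto intro!: card_image inj_onI)
  moreover have "card ((\<lambda>b. (b, y)) ` ?B \<union> {(y, y)}) = card ((\<lambda>b. (b, y)) ` ?B) + 1"
    using S by (subst card_Un_disjoint) auto
  moreover have "card (Pair y ` ?B \<union> ((\<lambda>b. (b, y)) ` ?B \<union> {(y, y)})) =
      card (Pair y ` ?B) + card ((\<lambda>b. (b, y)) ` ?B \<union> {(y, y)})"
    using S by (subst card_Un_disjoint) auto
  moreover have "card (?R \<union> (Pair y ` ?B \<union> ((\<lambda>b. (b, y)) ` ?B \<union> {(y, y)}))) =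
      card ?R + card (Pair y ` ?B \<union> ((\<lambda>b. (b, y)) ` ?B \<union> {(y, y)}))"
    using S \<open>finite ?R\<close> by (subst card_Un_disjoint) auto
  ultimately show ?thesis by simp
qed

lemma disjoint_permutes_commute:
  assumes h: "h permutes B" and k: "k permutes C" and disj: "B \<inter> C = {}"
  shows "h \<circ> k = k \<circ> h"
proof
  fix z
  consider "z \<in> B" | "z \<in> C" | "z \<notin> B" "z \<notin> C" by blast
  then show "(h \<circ> k) z = (k \<circ> h) z"
  proof cases
    case 1
    then have "h z \<in> B" using h by (simp add: permutes_in_image)
    then have "z \<notin> C" "h z \<notin> C" using 1 disj by auto
    then show ?thesis using k by (simp add: permutes_not_in)
  next
    case 2
    then have "k z \<in> C" using k by (simp add: permutes_in_image)
    then have "z \<notin> B" "k z \<notin> B" using 2 disj by auto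
    then show ?thesis using h by (simp add: permutes_not_in)
  next
    case 3
    then show ?thesis using h k by (simp add: permutes_not_in)
  qed
qed

text \<open>Merging a point into a block that is at least as large as its own increases the sum of the
  squared block sizes. Hence for a maximal labelling the symmetrisation over such an enlarged block
  annihilates the invariant vector.\<close>

lemma ex_maximal_young_vector:
  fixes S :: "nat set" and E :: "((nat \<Rightarrow> nat) \<Rightarrow> real) \<Rightarrow> bool"
  assumes S: "finite S"
    and ne: "E f0" "\<exists>g. g permutes S \<and> f0 g \<noteq> 0"
    and avg: "\<forall>f A. E f \<longrightarrow> A \<subseteq> S \<longrightarrow> E (avg_op A f)"
  shows "\<exists>f \<kappa>. E f \<and> (\<exists>g. g permutes S \<and> f g \<noteq> 0) \<and>
    (\<forall>c h g. h permutes {y\<in>S. \<kappa> y = (c::nat)} \<longrightarrow> g permutes S \<longrightarrow> f (h \<circ> g) = f g) \<and>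
    (\<forall>x y g. x \<in> S \<longrightarrow> y \<in> S \<longrightarrow> \<kappa> x \<noteq> \<kappa> y \<longrightarrow>
       card {b\<in>S. \<kappa> b = \<kappa> y} \<le> card {b\<in>S. \<kappa> b = \<kappa> x} \<longrightarrow> g permutes S \<longrightarrow>
       avg_op (insert y {b\<in>S. \<kappa> b = \<kappa> x}) f g = 0)"
proof -
  define P where "P = (\<lambda>\<kappa> :: nat \<Rightarrow> nat. \<exists>f. E f \<and> (\<exists>g. g permutes S \<and> f g \<noteq> 0) \<and>
    (\<forall>c h g. h permutes {y\<in>S. \<kappa> y = c} \<longrightarrow> g permutes S \<longrightarrow> f (h \<circ> g) = f g))"
  \<comment> \<open>The sum of the squared block sizes, written as a number of pairs so that the
    effect of relabelling one point can be computed. It is bounded, and singleton blocks with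
    \<open>f0\<close> satisfy \<open>P\<close>, so a maximal labelling exists.\<close>
  define \<Phi> where "\<Phi> = (\<lambda>\<kappa> :: nat \<Rightarrow> nat. card {(a, b). a \<in> S \<and> b \<in> S \<and> \<kappa> a = \<kappa> b})"
  have Pid: "P id"
    unfolding P_def
  proof (intro exI[of _ f0] conjI allI impI ne)
    fix c h g assume h: "h permutes {y\<in>S. id y = c}"
    have "{y\<in>S. id y = c} \<subseteq> {c}" by auto
    then have "h permutes {c}" using h permutes_subset by blast
    then have "h = id" by simp
    then show "f0 (h \<circ> g) = f0 g" by simp
  qed
  have bound: "\<Phi> \<kappa> \<le> card (S \<times> S)" for \<kappa>
    unfolding \<Phi>_def using S by (intro card_mono) auto
  have "\<exists>\<kappa>. P \<kappa> \<and> (\<forall>\<kappa>'. P \<kappa>' \<longrightarrow> \<Phi> \<kappa>' \<le> \<Phi> \<kappa>)"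
    using bound
    by (intro ex_has_greatest_nat[where P = P and k = id and f = \<Phi> and b = "Suc (card (S \<times> S))"])
      (auto simp only: Pid less_Suc_eq_le)
  then obtain \<kappa> where \<kappa>: "P \<kappa>" "\<And>\<kappa>'. P \<kappa>' \<Longrightarrow> \<Phi> \<kappa>' \<le> \<Phi> \<kappa>"
    by metis
  from \<kappa>(1) obtain f where f: "E f" "\<exists>g. g permutes S \<and> f g \<noteq> 0"
    "\<And>c h g. h permutes {y\<in>S. \<kappa> y = c} \<Longrightarrow> g permutes S \<Longrightarrow> f (h \<circ> g) = f g"
    unfolding P_def by blast
  have "avg_op (insert y {b\<in>S. \<kappa> b = \<kappa> x}) f g = 0"
    if x: "x \<in> S" and y: "y \<in> S" and xy: "\<kappa> x \<noteq> \<kappa> y"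
      and le: "card {b\<in>S. \<kappa> b = \<kappa> y} \<le> card {b\<in>S. \<kappa> b = \<kappa> x}" and g: "g permutes S" for x y g
  proof (rule ccontr)
    assume nz: "avg_op (insert y {b\<in>S. \<kappa> b = \<kappa> x}) f g \<noteq> 0"
    define C where "C = insert y {b\<in>S. \<kappa> b = \<kappa> x}"
    define \<kappa>' where "\<kappa>' = \<kappa>(y := \<kappa> x)"
    have C: "C \<subseteq> S" "finite C" using y S by (auto simp: C_def)
    have "P \<kappa>'"
      unfolding P_def
    proof (intro exI[of _ "avg_op C f"] conjI allI impI)
      show "E (avg_op C f)" using f(1) C avg by simp
      show "\<exists>g. g permutes S \<and> avg_op C f g \<noteq> 0" using nz g by (auto simp: C_def)
      fix c h g assume h: "h permutes {z\<in>S. \<kappa>' z = c}" and g: "g permutes S"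
      show "avg_op C f (h \<circ> g) = avg_op C f g"
      proof (cases "c = \<kappa> x")
        case True
        then have "{z\<in>S. \<kappa>' z = c} = C" using y by (auto simp: \<kappa>'_def C_def)
        then show ?thesis using h C by (simp add: avg_op_invariant)
      next
        case False
        \<comment> \<open>Such a block lies inside a block of \<open>\<kappa>\<close> and misses
          \<open>C\<close>. Its permutations commute with those of \<open>C\<close>, so the average
          over \<open>C\<close> inherits the invariance.\<close>
        then have disj: "{z\<in>S. \<kappa>' z = c} \<inter> C = {}" by (auto simp: \<kappa>'_def C_def split: if_splits)
        have "{z\<in>S. \<kappa>' z = c} \<subseteq> {z\<in>S. \<kappa> z = c}" using False by (auto simp: \<kappa>'_def split: if_splits)
        then have h': "h permutes {z\<in>S. \<kappa> z = c}" using h permutes_subset by blast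
        have "f (k \<circ> (h \<circ> g)) = f (k \<circ> g)" if "k permutes C" for k
        proof -
          have "k permutes S" using that C permutes_subset by blast
          then have "k \<circ> g permutes S" using g permutes_compose by blast
          moreover have "k \<circ> (h \<circ> g) = h \<circ> (k \<circ> g)"
            using disjoint_permutes_commute[OF h that disj] by (simp add: comp_assoc[symmetric])
          ultimately show ?thesis using f(3)[OF h'] by simp
        qed
        then show ?thesis unfolding avg_op_def by (intro arg_cong2[where f = "(/)"] sum.cong) auto
      qed
    qed
    then have "\<Phi> \<kappa>' \<le> \<Phi> \<kappa>" by (rule \<kappa>(2))
    moreover have e1: "{(a, b). a \<in> S - {y} \<and> b \<in> S - {y} \<and> \<kappa>' a = \<kappa>' b} =
        {(a, b). a \<in> S - {y} \<and> b \<in> S - {y} \<and> \<kappa> a = \<kappa> b}"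
      by (auto simp: \<kappa>'_def)
    have e2: "{b \<in> S - {y}. \<kappa>' b = \<kappa>' y} = {b\<in>S. \<kappa> b = \<kappa> x}"
      using xy by (auto simp: \<kappa>'_def)
    \<comment> \<open>Moving \<open>y\<close> loses two pairs for each other point of its old block
      and gains two for each point of the block of \<open>x\<close>. The old block without
      \<open>y\<close> is strictly smaller, so even equal block sizes give an increase.\<close>
    have "card {b \<in> S - {y}. \<kappa> b = \<kappa> y} < card {b\<in>S. \<kappa> b = \<kappa> y}"
      using S y by (intro psubset_card_mono) auto
    then have "\<Phi> \<kappa> < \<Phi> \<kappa>'"
      using le unfolding \<Phi>_def card_same_label_insert[OF S y] e1 e2 by linarith
    ultimately show False by simp
  qed
  then show ?thesis
    using f by - (rule exI[of _ f], rule exI[of _ \<kappa>], simp)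
qed

lemma transpose_permutes_comp:
  assumes "a \<in> S" "b \<in> S" "g permutes S"
  shows "transpose a b \<circ> g permutes S"
  using assms by (intro permutes_compose permutes_swap_id)

text \<open>As \<open>f\<close> is invariant under Sym(\<open>B\<close>), the average over
  Sym(\<open>insert y B\<close>) reduces to the coset representatives, namely the identity and the
  \<open>transpose y b\<close>. A vanishing average thus evaluates a part of a Jucys-Murphy
  sum.\<close>

lemma avg_op_insert_eq_0:
  assumes S: "finite S" "insert y B \<subseteq> S" "y \<notin> B" and g: "g permutes S"
    and inv: "\<And>h g. h permutes B \<Longrightarrow> g permutes S \<Longrightarrow> f (h \<circ> g) = f g"
    and zero: "avg_op (insert y B) f g = 0"
  shows "f g + (\<Sum>b\<in>B. f (transpose y b \<circ> g)) = 0"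
proof -
  have B: "finite B" using S by (meson finite_subset subset_insertI)
  have "0 = (\<Sum>h | h permutes insert y B. f (h \<circ> g))" using zero by (simp add: avg_op_def)
  also have "\<dots> = (\<Sum>b\<in>insert y B. \<Sum>q | q permutes B. f (transpose y b \<circ> q \<circ> g))"
    by (rule sum_over_permutations_insert[OF B S(3)])
  also have "\<dots> = (\<Sum>q | q permutes B. \<Sum>b\<in>insert y B. f (transpose y b \<circ> q \<circ> g))"
    by (rule sum.swap)
  also have "\<dots> = (\<Sum>q | q permutes B. f g + (\<Sum>b\<in>B. f (transpose y b \<circ> g)))"
  proof (rule sum.cong[OF refl])
    fix q assume "q \<in> {q. q permutes B}"
    then have q: "q permutes B" by simp
    have "(\<Sum>b\<in>B. f (transpose y b \<circ> (q \<circ> g))) = (\<Sum>b\<in>B. f (q \<circ> (transpose y b \<circ> g)))"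
      by (rule sum_transpose_translate[OF q S(3)])
    also have "\<dots> = (\<Sum>b\<in>B. f (transpose y b \<circ> g))"
      using S g by (intro sum.cong refl inv q transpose_permutes_comp) auto
    finally show "(\<Sum>b\<in>insert y B. f (transpose y b \<circ> q \<circ> g)) = f g + (\<Sum>b\<in>B. f (transpose y b \<circ> g))"
      using B S(3) inv[OF q g] by (simp add: comp_assoc)
  qed
  also have "\<dots> = fact (card B) * (f g + (\<Sum>b\<in>B. f (transpose y b \<circ> g)))"
    using B by (simp add: card_permutations)
  finally show ?thesis by simp
qed

text \<open>Renaming the blocks in order of decreasing size lets the order of the labels imply the
  comparison of sizes, so that the blocks act as the successive rows of a Young diagram.\<close>

lemma ex_ordered_young_vector:
  fixes S :: "nat set" and E :: "((nat \<Rightarrow> nat) \<Rightarrow> real) \<Rightarrow> bool"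
  assumes S: "finite S"
    and ne: "E f0" "\<exists>g. g permutes S \<and> f0 g \<noteq> 0"
    and avg: "\<forall>f A. E f \<longrightarrow> A \<subseteq> S \<longrightarrow> E (avg_op A f)"
  shows "\<exists>f \<kappa>. E f \<and> (\<exists>g. g permutes S \<and> f g \<noteq> 0) \<and>
    (\<forall>c h g. h permutes {y\<in>S. \<kappa> y = (c::nat)} \<longrightarrow> g permutes S \<longrightarrow> f (h \<circ> g) = f g) \<and>
    (\<forall>x y g. x \<in> S \<longrightarrow> y \<in> S \<longrightarrow> \<kappa> x < \<kappa> y \<longrightarrow> g permutes S \<longrightarrow>
       f g + (\<Sum>b | b \<in> S \<and> \<kappa> b = \<kappa> x. f (transpose y b \<circ> g)) = 0) \<and>
    (\<forall>x y. x \<in> S \<longrightarrow> y \<in> S \<longrightarrow> \<kappa> x < \<kappa> y \<longrightarrow>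
       card {b\<in>S. \<kappa> b = \<kappa> y} \<le> card {b\<in>S. \<kappa> b = \<kappa> x})"
proof -
  obtain f \<kappa> where *: "E f \<and> (\<exists>g. g permutes S \<and> f g \<noteq> 0) \<and>
    (\<forall>c h g. h permutes {y\<in>S. \<kappa> y = (c::nat)} \<longrightarrow> g permutes S \<longrightarrow> f (h \<circ> g) = f g) \<and>
    (\<forall>x y g. x \<in> S \<longrightarrow> y \<in> S \<longrightarrow> \<kappa> x \<noteq> \<kappa> y \<longrightarrow>
       card {b\<in>S. \<kappa> b = \<kappa> y} \<le> card {b\<in>S. \<kappa> b = \<kappa> x} \<longrightarrow> g permutes S \<longrightarrow>
       avg_op (insert y {b\<in>S. \<kappa> b = \<kappa> x}) f g = 0)"
    using ex_maximal_young_vector[OF S ne avg] by (elim exE) (rule that)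
  have f: "E f" "\<exists>g. g permutes S \<and> f g \<noteq> 0"
    "\<And>c h g. h permutes {y\<in>S. \<kappa> y = (c::nat)} \<Longrightarrow> g permutes S \<Longrightarrow> f (h \<circ> g) = f g"
    "\<And>x y g. x \<in> S \<Longrightarrow> y \<in> S \<Longrightarrow> \<kappa> x \<noteq> \<kappa> y \<Longrightarrow>
       card {b\<in>S. \<kappa> b = \<kappa> y} \<le> card {b\<in>S. \<kappa> b = \<kappa> x} \<Longrightarrow> g permutes S \<Longrightarrow>
       avg_op (insert y {b\<in>S. \<kappa> b = \<kappa> x}) f g = 0"
    using * by simp_all
  define s where "s = (\<lambda>x. card {b\<in>S. \<kappa> b = \<kappa> x})"
  define M where "M = Suc (\<Sum>x\<in>S. \<kappa> x)"
  \<comment> \<open>Base \<open>M\<close> encoding of the pair \<open>card S - s x\<close>,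
    \<open>\<kappa> x\<close>: larger blocks come first, and the old label keeps distinct blocks of
    equal size apart.\<close>
  define \<mu> where "\<mu> = (\<lambda>x. (card S - s x) * M + \<kappa> x)"
  have M: "\<kappa> x < M" if "x \<in> S" for x
    using member_le_sum[OF that, of \<kappa>] S by (simp add: M_def)
  have sS: "s x \<le> card S" for x unfolding s_def using S by (intro card_mono) auto
  have eq: "\<mu> b = \<mu> x \<longleftrightarrow> \<kappa> b = \<kappa> x" if "b \<in> S" "x \<in> S" for b x
  proof
    assume "\<mu> b = \<mu> x"
    then have "\<mu> b mod M = \<mu> x mod M" by simp
    then show "\<kappa> b = \<kappa> x" using M that by (simp add: \<mu>_def)
  qed (simp add: \<mu>_def s_def)
  have block: "{b\<in>S. \<mu> b = \<mu> x} = {b\<in>S. \<kappa> b = \<kappa> x}" if "x \<in> S" for x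
    using eq that by blast
  have size: "s y \<le> s x" if "x \<in> S" "y \<in> S" "\<mu> x < \<mu> y" for x y
  proof (rule ccontr)
    assume "\<not> s y \<le> s x"
    then have "card S - s y + 1 \<le> card S - s x" using sS[of y] by linarith
    then have "(card S - s y + 1) * M \<le> (card S - s x) * M" by (intro mult_right_mono) auto
    moreover have "\<mu> y < (card S - s y + 1) * M" using M[OF that(2)] by (simp add: \<mu>_def)
    ultimately show False using that(3) by (simp add: \<mu>_def)
  qed
  show ?thesis
  proof (rule exI[of _ f], rule exI[of _ \<mu>], intro conjI allI impI)
    fix c h g assume h: "h permutes {y\<in>S. \<mu> y = c}" and g: "g permutes S"
    show "f (h \<circ> g) = f g"
    proof (cases "{y\<in>S. \<mu> y = c} = {}")
      case True
      then have "h permutes {}" using h by (simp only:)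
      then show ?thesis by simp
    next
      case False
      then obtain x where "x \<in> S" "c = \<mu> x" by auto
      then show ?thesis using h block[of x] f(3) g by simp
    qed
  next
    fix x y g assume xy: "x \<in> S" "y \<in> S" "\<mu> x < \<mu> y" and g: "g permutes S"
    have neq: "\<kappa> x \<noteq> \<kappa> y" using eq[of x y] xy by auto
    have "avg_op (insert y {b\<in>S. \<kappa> b = \<kappa> x}) f g = 0"
      using f(4)[OF xy(1,2) neq] size[OF xy] g by (simp add: s_def)
    then have "f g + (\<Sum>b\<in>{b\<in>S. \<kappa> b = \<kappa> x}. f (transpose y b \<circ> g)) = 0"
    proof (intro avg_op_insert_eq_0[where S = S and f = f] S g)
      show "insert y {b\<in>S. \<kappa> b = \<kappa> x} \<subseteq> S" "y \<notin> {b\<in>S. \<kappa> b = \<kappa> x}"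
        using xy neq by auto
    qed (use f(3) in blast)+
    then show "f g + (\<Sum>b | b \<in> S \<and> \<mu> b = \<mu> x. f (transpose y b \<circ> g)) = 0"
      using block[OF xy(1)] by simp
  next
    fix x y assume "x \<in> S" "y \<in> S" "\<mu> x < \<mu> y"
    then show "card {b\<in>S. \<mu> b = \<mu> y} \<le> card {b\<in>S. \<mu> b = \<mu> x}"
      using size[of x y] by (simp add: block s_def)
  qed (use f(1,2) in blast)+
qed

section \<open>Eigenvalues of the walk\<close>

text \<open>A set is an initial segment if it contains all blocks before any block that it meets. Adding
  a point to an initial segment multiplies the eigenvalue by \<open>\<theta> + c\<close>, where \<open>c\<close> is the content of
  the corresponding box of the Young diagram.\<close>

lemma jm_op_young_vector:
  fixes S :: "nat set" and \<kappa> :: "nat \<Rightarrow> nat" and \<theta> :: real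
  assumes S: "finite S" "A \<subseteq> S" "x \<in> S" "x \<notin> A"
    and init: "{y\<in>S. \<kappa> y < \<kappa> x} \<subseteq> A" "\<And>y. y \<in> A \<Longrightarrow> \<kappa> y \<le> \<kappa> x"
    and g: "g permutes S"
    and inv: "\<And>c h g. h permutes {y\<in>S. \<kappa> y = c} \<Longrightarrow> g permutes S \<Longrightarrow> f (h \<circ> g) = f g"
    and zero: "\<And>x y g. x \<in> S \<Longrightarrow> y \<in> S \<Longrightarrow> \<kappa> x < \<kappa> y \<Longrightarrow> g permutes S \<Longrightarrow>
       f g + (\<Sum>b | b \<in> S \<and> \<kappa> b = \<kappa> x. f (transpose y b \<circ> g)) = 0"
  shows "jm_op \<theta> x A f g =
    (\<theta> + card {b\<in>A. \<kappa> b = \<kappa> x} - card (\<kappa> ` {y\<in>S. \<kappa> y < \<kappa> x})) / (\<theta> + card A) * f g"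
proof -
  define L where "L = {y\<in>S. \<kappa> y < \<kappa> x}"
  define B where "B = {b\<in>A. \<kappa> b = \<kappa> x}"
  have fin: "finite A" "finite L" "finite B" using S by (auto simp: L_def B_def intro: finite_subset)
  have A: "A = L \<union> B" "L \<inter> B = {}" using init S(2) by (fastforce simp: L_def B_def)+
  have "f (transpose x b \<circ> g) = f g" if "b \<in> B" for b
  proof (rule inv[OF _ g])
    show "transpose x b permutes {y\<in>S. \<kappa> y = \<kappa> x}"
      using that S by (intro permutes_swap_id) (auto simp: B_def)
  qed
  then have 1: "(\<Sum>b\<in>B. f (transpose x b \<circ> g)) = card B * f g" by simp
  \<comment> \<open>Each earlier block lies entirely in \<open>A\<close>, so its transpositions add
    up to \<open>- f g\<close>. The number of earlier blocks is the row index of the new box and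
    \<open>card B\<close> its column index; column minus row is the content.\<close>
  have "(\<Sum>b\<in>L. f (transpose x b \<circ> g)) = (\<Sum>c\<in>\<kappa> ` L. \<Sum>b | b \<in> L \<and> \<kappa> b = c. f (transpose x b \<circ> g))"
    by (rule sum.image_gen[OF fin(2)])
  also have "\<dots> = (\<Sum>c\<in>\<kappa> ` L. - f g)"
  proof (rule sum.cong[OF refl])
    fix c assume "c \<in> \<kappa> ` L"
    then obtain z where z: "z \<in> L" "c = \<kappa> z" by auto
    then have "{b. b \<in> L \<and> \<kappa> b = c} = {b. b \<in> S \<and> \<kappa> b = \<kappa> z}" by (auto simp: L_def)
    moreover have "f g + (\<Sum>b | b \<in> S \<and> \<kappa> b = \<kappa> z. f (transpose x b \<circ> g)) = 0"
      using z S g by (intro zero) (auto simp: L_def)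
    ultimately show "(\<Sum>b | b \<in> L \<and> \<kappa> b = c. f (transpose x b \<circ> g)) = - f g" by simp
  qed
  finally have 2: "(\<Sum>b\<in>L. f (transpose x b \<circ> g)) = - (card (\<kappa> ` L) * f g)" by simp
  have "(\<Sum>b\<in>A. f (transpose x b \<circ> g)) = card B * f g - card (\<kappa> ` L) * f g"
    using A(2) fin unfolding A(1) by (subst sum.union_disjoint) (auto simp: 1 2)
  then show ?thesis
    by (simp add: jm_op_def L_def[symmetric] B_def[symmetric] algebra_simps)
qed

text \<open>A point of maximal label is split off at each stage, so the remainder is still an
  initial segment. A box outside the first row has content at most its column index, hence at most
  \<open>l\<close>. The condition \<open>real (card S) \<le> \<theta>\<close> keeps all factors
  nonnegative, so that their upper bounds may be multiplied.\<close>

lemma cycle_op_young_vector: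
  fixes S :: "nat set" and \<kappa> :: "nat \<Rightarrow> nat" and \<theta> :: real
  assumes S: "finite S" "real (card S) \<le> \<theta>" "S \<noteq> {}"
    and inv: "\<And>c h g. h permutes {y\<in>S. \<kappa> y = c} \<Longrightarrow> g permutes S \<Longrightarrow> f (h \<circ> g) = f g"
    and zero: "\<And>x y g. x \<in> S \<Longrightarrow> y \<in> S \<Longrightarrow> \<kappa> x < \<kappa> y \<Longrightarrow> g permutes S \<Longrightarrow>
       f g + (\<Sum>b | b \<in> S \<and> \<kappa> b = \<kappa> x. f (transpose y b \<circ> g)) = 0"
    and M: "M = {y\<in>S. \<forall>z\<in>S. \<kappa> y \<le> \<kappa> z}"
    and l: "\<And>y. y \<in> S \<Longrightarrow> y \<notin> M \<Longrightarrow> card {b\<in>S. \<kappa> b = \<kappa> y} \<le> l"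
    and A: "A \<subseteq> S" "\<And>x y. x \<in> A \<Longrightarrow> y \<in> S \<Longrightarrow> \<kappa> y < \<kappa> x \<Longrightarrow> y \<in> A"
  shows "\<exists>c\<ge>0. c \<le> pochhammer \<theta> (card (A \<inter> M)) * (\<theta> + l) ^ card (A - M) / pochhammer \<theta> (card A) \<and>
    (\<forall>g. g permutes S \<longrightarrow> cycle_op \<theta> A f g = c * f g)"
  using A
proof (induction "card A" arbitrary: A)
  case 0
  have "finite A" by (rule finite_subset[OF "0.prems"(1) S(1)])
  then have "A = {}" using "0.hyps" by simp
  then show ?case by (intro exI[of _ 1]) simp
next
  case (Suc k)
  have finA: "finite A" using Suc.prems(1) S(1) by (rule finite_subset)
  have "A \<noteq> {}" using Suc.hyps(2) by auto
  then have "Max (\<kappa> ` A) \<in> \<kappa> ` A" using finA by (intro Max_in) auto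
  then obtain x where x1: "x \<in> A" "Max (\<kappa> ` A) = \<kappa> x" by (rule imageE)
  have x: "x \<in> A" "\<And>y. y \<in> A \<Longrightarrow> \<kappa> y \<le> \<kappa> x"
    using x1 Max_ge[of "\<kappa> ` A"] finA by auto
  define A' where "A' = A - {x}"
  have A': "A = insert x A'" "x \<notin> A'" "finite A'" "A' \<subseteq> S" using x finA Suc.prems(1) by (auto simp: A'_def)
  have xS: "x \<in> S" using x Suc.prems(1) by auto
  have cardA: "card A = Suc (card A')" using A' by simp
  have init: "y \<in> A'" if "z \<in> A'" "y \<in> S" "\<kappa> y < \<kappa> z" for y z
    using that Suc.prems(2)[of z y] x(2)[of z] by (auto simp: A'_def)
  obtain c where c: "0 \<le> c" "c \<le> pochhammer \<theta> (card (A' \<inter> M)) * (\<theta> + l) ^ card (A' - M) / pochhammer \<theta> (card A')"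
    "\<And>g. g permutes S \<Longrightarrow> cycle_op \<theta> A' f g = c * f g"
    using Suc.hyps(1)[of A'] Suc.hyps(2) cardA A' init by auto
  define L where "L = {y\<in>S. \<kappa> y < \<kappa> x}"
  define B where "B = {b\<in>A'. \<kappa> b = \<kappa> x}"
  define d where "d = (\<theta> + card B - card (\<kappa> ` L)) / (\<theta> + card A')"
  have LA: "L \<subseteq> A'" using Suc.prems(2)[OF x(1)] by (auto simp: L_def A'_def)
  have finL: "finite L" using LA A' finite_subset by blast
  have "S \<noteq> {} \<Longrightarrow> card S > 0" using S by (simp add: card_gt_0_iff)
  then have \<theta>: "\<theta> > 0" using S by linarith
  have pos: "\<theta> + card A' > 0" using \<theta> by (simp add: add_pos_nonneg)
  have jm: "jm_op \<theta> x A' f g = d * f g" if "g permutes S" for g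
    unfolding d_def L_def B_def
  proof (rule jm_op_young_vector[OF S(1) A'(4) xS A'(2) _ _ that])
    show "{y\<in>S. \<kappa> y < \<kappa> x} \<subseteq> A'" using LA by (simp only: L_def)
    show "\<kappa> y \<le> \<kappa> x" if "y \<in> A'" for y using that x(2) by (simp add: A'_def)
  qed (rule inv zero; assumption)+
  have d0: "0 \<le> d"
  proof -
    have "card (\<kappa> ` L) \<le> card L" using finL by (rule card_image_le)
    also have "\<dots> \<le> card S" using S by (intro card_mono) (auto simp: L_def)
    finally have "real (card (\<kappa> ` L)) \<le> \<theta>" using S(2) by linarith
    then show ?thesis using pos by (simp add: d_def)
  qed
  have "cycle_op \<theta> A f g = c * d * f g" if g: "g permutes S" for g
  proof -
    have "cycle_op \<theta> A f g = cycle_op \<theta> A' (jm_op \<theta> x A' f) g"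
      using A' by (simp add: cycle_op_insert)
    also have "\<dots> = d * cycle_op \<theta> A' f g"
      unfolding cycle_op_def sum_distrib_left
    proof (rule sum.cong[OF refl])
      fix h assume "h \<in> {h. h permutes A'}"
      then have "h permutes S" using A'(4) permutes_subset by blast
      then have "h \<circ> g permutes S" using g permutes_compose by blast
      then show "\<theta> ^ card (orbit h ` A') / pochhammer \<theta> (card A') * jm_op \<theta> x A' f (h \<circ> g) =
          d * (\<theta> ^ card (orbit h ` A') / pochhammer \<theta> (card A') * f (h \<circ> g))"
        by (simp add: jm)
    qed
    finally show ?thesis using c(3)[OF g] by simp
  qed
  moreover have "c * d \<le> pochhammer \<theta> (card (A \<inter> M)) * (\<theta> + l) ^ card (A - M) / pochhammer \<theta> (card A)"
  proof (cases "x \<in> M")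
    case True
    \<comment> \<open>\<open>x\<close> has the largest label in \<open>A\<close>, so here
      \<open>A\<close> consists of boxes of the first row and the claimed bound is 1.\<close>
    have AM: "A \<subseteq> M"
    proof
      fix y assume y: "y \<in> A"
      then have "\<kappa> y \<le> \<kappa> z" if "z \<in> S" for z
        using x(2)[OF y] True that by (auto simp: M intro: order_trans)
      then show "y \<in> M" using y Suc.prems(1) by (auto simp: M)
    qed
    have p: "pochhammer \<theta> k > 0" for k using \<theta> by (rule pochhammer_pos)
    have A'M: "A' \<inter> M = A'" "A' - M = {}" "A \<inter> M = A" "A - M = {}" using AM A' by auto
    have "L = {}" using True by (auto simp: M L_def)
    moreover have "card B \<le> card A'" using A' by (intro card_mono) (auto simp: B_def)
    ultimately have "d \<le> 1" using pos by (simp add: d_def)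
    moreover have "c \<le> 1" using c(2) p[of "card A'"] unfolding A'M by simp
    ultimately have "c * d \<le> 1" using c(1) d0 by (simp add: mult_le_one)
    then show ?thesis unfolding A'M using p[of "card A"] by simp
  next
    case False
    have "insert x B \<subseteq> {b\<in>S. \<kappa> b = \<kappa> x}" using A' xS by (auto simp: B_def)
    then have "card (insert x B) \<le> card {b\<in>S. \<kappa> b = \<kappa> x}" using S by (intro card_mono) auto
    then have "card B \<le> l" using l[OF xS False] A' by (simp add: B_def)
    then have "d \<le> (\<theta> + l) / (\<theta> + card A')"
      unfolding d_def using pos by (intro divide_right_mono) auto
    then have "c * d \<le> pochhammer \<theta> (card (A' \<inter> M)) * (\<theta> + l) ^ card (A' - M) / pochhammer \<theta> (card A') *
        ((\<theta> + l) / (\<theta> + card A'))"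
      using c d0 \<theta> by (intro mult_mono) (auto simp: pochhammer_nonneg)
    moreover have "A \<inter> M = A' \<inter> M" "A - M = insert x (A' - M)" using False A' by auto
    ultimately show ?thesis using A' by (simp add: cardA pochhammer_Suc mult_ac)
  qed
  ultimately show ?case using c(1) d0 by (intro exI[of _ "c * d"]) auto
qed

text \<open>Eigenvalue bound for a diagram whose first row has \<open>m\<close> boxes. Every other
  box has content at most \<open>min m (n - m)\<close>, since a lower row is no longer than the
  first and has to fit into the remaining \<open>n - m\<close> boxes.\<close>

definition eig_bound :: "nat \<Rightarrow> nat \<Rightarrow> real" where
  "eig_bound n m = pochhammer (real n) m * (real n + min m (n - m)) ^ (n - m) / pochhammer (real n) n"

text \<open>The quadratic form of the difference of the two sides is bounded below by its least eigenvalue,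
  and on the corresponding eigenspace it suffices to look at one vector.\<close>

lemma walk_spectral_bound:
  fixes n :: nat and w :: "nat \<Rightarrow> real"
  defines "S \<equiv> {1..n}"
  assumes n: "n \<ge> 1" and w: "\<And>m. w m \<ge> 0" "c \<ge> 0"
    and bound: "\<And>m. 1 \<le> m \<Longrightarrow> m \<le> n \<Longrightarrow> eig_bound n m ^ (2 * t) \<le> w m + c"
  shows "(\<Sum>g | g permutes S. ((cycle_op (real n) S ^^ t) \<phi> g)\<^sup>2) \<le>
    (\<Sum>m=1..n. w m * (\<Sum>A | A \<subseteq> S \<and> card A = m. \<Sum>g | g permutes S. (avg_op A \<phi> g)\<^sup>2)) +
    c * (\<Sum>g | g permutes S. (\<phi> g)\<^sup>2)"
proof -
  let ?G = "{g. g permutes S}" and ?P = "cycle_op (real n) S"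
  let ?C = "\<lambda>m. {A. A \<subseteq> S \<and> card A = m}"
  define U where "U = (\<lambda>m f g. \<Sum>A\<in>?C m. avg_op A f g)"
  \<comment> \<open>The claim is that the quadratic form of this operator is nonnegative at
    \<open>\<phi>\<close>; it is shown to be nonnegative everywhere.\<close>
  define Q where "Q = (\<lambda>f g. (\<Sum>m=1..n. w m * U m f g) + c * f g - (?P ^^ (2 * t)) f g)"
  have S: "finite S" "card S = n" by (simp_all add: S_def)
  have finC: "finite (?C m)" for m using S by (auto intro: rev_finite_subset[of "Pow S"])
  have finG: "finite ?G" using S by (simp add: finite_permutations)
  have neG: "?G \<noteq> {}" using permutes_id by blast
  have symP: "symmetric_operator ?G (?P ^^ k)" for k
    by (rule symmetric_operator_funpow[OF symmetric_operator_cycle_op[OF S(1)]])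
  have "symmetric_operator ?G (\<lambda>f g. \<Sum>A\<in>?C m. 1 * avg_op A f g)" for m
    by (intro symmetric_operator_weighted_sum finC symmetric_operator_avg_op S) auto
  then have symU: "symmetric_operator ?G (U m)" for m by (simp add: U_def)
  have "symmetric_operator ?G (\<lambda>f g. 1 * (1 * (\<Sum>m=1..n. w m * U m f g) + c * f g) + (- 1) * (?P ^^ (2 * t)) f g)"
    by (intro symmetric_operator_add_scaled symmetric_operator_weighted_sum symU symP symmetric_operator_id) auto
  then have symQ: "symmetric_operator ?G Q" by (simp add: Q_def)
  have cen: "Q f (u \<circ> g) = Q (\<lambda>v. f (u \<circ> v)) g" if u: "u permutes S" for u f g
    using central_operator_sum_avg_op[OF S(1)] central_operator_funpow[OF central_operator_cycle_op, of S "2 * t" "real n"] u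
    by (simp add: Q_def U_def central_operator_def)
  have quad: "(\<Sum>g\<in>?G. f g * Q f g) = (\<Sum>m=1..n. w m * (\<Sum>A\<in>?C m. \<Sum>g\<in>?G. (avg_op A f g)\<^sup>2)) +
      c * (\<Sum>g\<in>?G. (f g)\<^sup>2) - (\<Sum>g\<in>?G. ((?P ^^ t) f g)\<^sup>2)" for f
  proof -
    have "(\<Sum>g\<in>?G. f g * Q f g) = (\<Sum>m=1..n. w m * (\<Sum>g\<in>?G. f g * U m f g)) + c * (\<Sum>g\<in>?G. f g * f g)
        - (\<Sum>g\<in>?G. f g * (?P ^^ (2 * t)) f g)"
      by (simp add: Q_def algebra_simps sum.distrib sum_subtractf sum_distrib_left sum.swap[of _ ?G])
    moreover have "(\<Sum>g\<in>?G. f g * U m f g) = (\<Sum>A\<in>?C m. \<Sum>g\<in>?G. (avg_op A f g)\<^sup>2)" for m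
    proof -
      have "(\<Sum>g\<in>?G. f g * U m f g) = (\<Sum>A\<in>?C m. \<Sum>g\<in>?G. f g * avg_op A f g)"
        by (simp add: U_def sum_distrib_left sum.swap[of _ ?G])
      also have "\<dots> = (\<Sum>A\<in>?C m. \<Sum>g\<in>?G. (avg_op A f g)\<^sup>2)"
        by (intro sum.cong refl avg_op_inner_eq S) auto
      finally show ?thesis .
    qed
    moreover have "(\<Sum>g\<in>?G. f g * (?P ^^ (2 * t)) f g) = (\<Sum>g\<in>?G. ((?P ^^ t) f g)\<^sup>2)"
      using symmetric_operator_sym[OF symP[of t], of f "(?P ^^ t) f"]
      by (simp add: mult_2 funpow_add power2_eq_square)
    ultimately show ?thesis by (simp add: power2_eq_square)
  qed
  obtain l f0 where f0: "\<exists>g\<in>?G. f0 g \<noteq> 0" "\<And>g. g \<in> ?G \<Longrightarrow> Q f0 g = l * f0 g"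
    and min: "\<And>h. l * (\<Sum>g\<in>?G. (h g)\<^sup>2) \<le> (\<Sum>g\<in>?G. h g * Q h g)"
    by (rule symmetric_operator_min_eigenvalue[OF symQ finG neG]) (rule that, assumption+)
  define E where "E = (\<lambda>f. \<forall>g\<in>?G. Q f g = l * f g)"
  \<comment> \<open>Centrality enters here: the eigenspaces of \<open>Q\<close> are stable under
    left translations and hence under averages, as the construction of a Young vector inside
    \<open>E\<close> demands.\<close>
  have avgE: "\<forall>f A. E f \<longrightarrow> A \<subseteq> S \<longrightarrow> E (avg_op A f)"
    unfolding E_def
  proof (intro allI impI ballI)
    fix f A g assume f: "\<forall>g\<in>?G. Q f g = l * f g" and A: "A \<subseteq> S" and g: "g \<in> ?G"
    have perm: "h \<circ> g permutes S" if "h permutes A" for h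
      using that A g permutes_subset permutes_compose by blast
    have finA: "finite {h. h permutes A}" using A S by (simp add: finite_permutations finite_subset)
    have "Q (avg_op A f) g = Q (\<lambda>v. \<Sum>h | h permutes A. 1 / fact (card A) * f (h \<circ> v)) g"
      by (simp add: avg_op_group_algebra)
    also have "\<dots> = (\<Sum>h | h permutes A. 1 / fact (card A) * Q (\<lambda>v. f (h \<circ> v)) g)"
      by (simp only: symmetric_operator_sum[OF symQ finA])
    also have "\<dots> = (\<Sum>h | h permutes A. 1 / fact (card A) * (l * f (h \<circ> g)))"
    proof (rule sum.cong[OF refl])
      fix h assume "h \<in> {h. h permutes A}"
      then have h: "h permutes A" by simp
      then have "h permutes S" using A permutes_subset by blast
      then have "Q (\<lambda>v. f (h \<circ> v)) g = l * f (h \<circ> g)" using cen[of h f g] f perm[OF h] by simp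
      then show "1 / fact (card A) * Q (\<lambda>v. f (h \<circ> v)) g = 1 / fact (card A) * (l * f (h \<circ> g))" by simp
    qed
    also have "\<dots> = l * avg_op A f g" by (simp add: avg_op_group_algebra sum_distrib_left mult_ac)
    finally show "Q (avg_op A f) g = l * avg_op A f g" .
  qed
  have E0: "E f0" "\<exists>g. g permutes S \<and> f0 g \<noteq> 0" using f0 by (auto simp: E_def)
  obtain f \<kappa> where *: "E f \<and> (\<exists>g. g permutes S \<and> f g \<noteq> 0) \<and>
    (\<forall>c h g. h permutes {y\<in>S. \<kappa> y = (c::nat)} \<longrightarrow> g permutes S \<longrightarrow> f (h \<circ> g) = f g) \<and>
    (\<forall>x y g. x \<in> S \<longrightarrow> y \<in> S \<longrightarrow> \<kappa> x < \<kappa> y \<longrightarrow> g permutes S \<longrightarrow>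
       f g + (\<Sum>b | b \<in> S \<and> \<kappa> b = \<kappa> x. f (transpose y b \<circ> g)) = 0) \<and>
    (\<forall>x y. x \<in> S \<longrightarrow> y \<in> S \<longrightarrow> \<kappa> x < \<kappa> y \<longrightarrow>
       card {b\<in>S. \<kappa> b = \<kappa> y} \<le> card {b\<in>S. \<kappa> b = \<kappa> x})"
    using ex_ordered_young_vector[OF S(1) E0 avgE] by (elim exE) (rule that)
  have f: "E f" "\<exists>g. g permutes S \<and> f g \<noteq> 0"
    and inv: "\<And>c h g. h permutes {y\<in>S. \<kappa> y = c} \<Longrightarrow> g permutes S \<Longrightarrow> f (h \<circ> g) = f g"
    and zero: "\<And>x y g. x \<in> S \<Longrightarrow> y \<in> S \<Longrightarrow> \<kappa> x < \<kappa> y \<Longrightarrow> g permutes S \<Longrightarrow>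
       f g + (\<Sum>b | b \<in> S \<and> \<kappa> b = \<kappa> x. f (transpose y b \<circ> g)) = 0"
    and size: "\<And>x y. x \<in> S \<Longrightarrow> y \<in> S \<Longrightarrow> \<kappa> x < \<kappa> y \<Longrightarrow>
       card {b\<in>S. \<kappa> b = \<kappa> y} \<le> card {b\<in>S. \<kappa> b = \<kappa> x}"
    using * by simp_all
  define M where "M = {y\<in>S. \<forall>z\<in>S. \<kappa> y \<le> \<kappa> z}"
  define m where "m = card M"
  have Sne: "S \<noteq> {}" using n by (simp add: S_def)
  obtain y0 where y0: "y0 \<in> S" "\<And>z. z \<in> S \<Longrightarrow> \<kappa> y0 \<le> \<kappa> z"
    using ex_has_least_nat[of "\<lambda>y. y \<in> S" _ \<kappa>] Sne by blast
  have M_eq: "M = {y\<in>S. \<kappa> y = \<kappa> y0}" using y0 by (auto simp: M_def intro: antisym)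
  have MS: "M \<subseteq> S" by (auto simp: M_def)
  have m: "1 \<le> m" "m \<le> n"
  proof -
    have "y0 \<in> M" using y0 by (auto simp: M_def)
    then show "1 \<le> m" using S MS finite_subset[OF MS] card_gt_0_iff[of M] by (auto simp: m_def)
    show "m \<le> n" using card_mono[OF S(1) MS] S by (simp add: m_def)
  qed
  have cardSM: "card (S - M) = n - m" using card_Diff_subset[OF finite_subset[OF MS S(1)] MS] S by (simp add: m_def)
  have l: "card {b\<in>S. \<kappa> b = \<kappa> y} \<le> min m (n - m)" if y: "y \<in> S" "y \<notin> M" for y
  proof -
    have lt: "\<kappa> y0 < \<kappa> y" using y y0(2)[of y] by (auto simp: M_eq)
    then have "card {b\<in>S. \<kappa> b = \<kappa> y} \<le> m" using size[OF y0(1) y(1)] by (simp add: m_def M_eq)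
    moreover have "card {b\<in>S. \<kappa> b = \<kappa> y} \<le> card (S - M)"
      using lt S by (intro card_mono) (auto simp: M_eq)
    ultimately show ?thesis using cardSM by simp
  qed
  obtain \<beta> where \<beta>: "0 \<le> \<beta>" "\<beta> \<le> pochhammer (real n) (card (S \<inter> M)) * (real n + min m (n - m)) ^ card (S - M) / pochhammer (real n) (card S)"
    "\<And>g. g permutes S \<Longrightarrow> ?P f g = \<beta> * f g"
  proof -
    have "\<exists>c\<ge>0. c \<le> pochhammer (real n) (card (S \<inter> M)) * (real n + min m (n - m)) ^ card (S - M) / pochhammer (real n) (card S) \<and>
      (\<forall>g. g permutes S \<longrightarrow> ?P f g = c * f g)"
    proof (rule cycle_op_young_vector[where S = S and \<kappa> = \<kappa> and M = M and l = "min m (n - m)" and A = S,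
          OF S(1) _ Sne _ _ M_def])
      show "real (card S) \<le> real n" by (simp add: S)
    qed (rule inv zero l order_refl; assumption?)+
    then show ?thesis using that by blast
  qed
  have "\<beta> \<le> eig_bound n m"
    using \<beta>(2) MS S cardSM by (simp add: eig_bound_def m_def Int_absorb1)
  then have \<beta>w: "\<beta> ^ (2 * t) \<le> w m + c"
    using bound[OF m] \<beta>(1) power_mono[of \<beta> "eig_bound n m" "2 * t"] by linarith
  have P2: "(?P ^^ k) f g = \<beta> ^ k * f g" if "g \<in> ?G" for k g
    using that
  proof (induction k arbitrary: g)
    case (Suc k)
    have "(?P ^^ Suc k) f g = ?P ((?P ^^ k) f) g" by simp
    also have "\<dots> = ?P (\<lambda>g. \<beta> ^ k * f g) g"
      by (rule symmetric_operator_cong[OF symmetric_operator_cycle_op[OF S(1)] Suc.IH Suc.prems])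
    also have "\<dots> = \<beta> ^ k * ?P f g"
      by (simp add: symmetric_operator_scale[OF symmetric_operator_cycle_op[OF S(1)]])
    finally show ?case using \<beta>(3) Suc.prems by simp
  qed simp
  define N where "N = (\<Sum>g\<in>?G. (f g)\<^sup>2)"
  have N: "N > 0"
  proof -
    obtain g where "g \<in> ?G" "f g \<noteq> 0" using f(2) by auto
    then show ?thesis unfolding N_def using finG by (intro sum_pos2[of _ g]) auto
  qed
  \<comment> \<open>The first block is one of the sets summed over, and averaging over it fixes
    \<open>f\<close>; the remaining sets contribute nonnegative terms.\<close>
  have "avg_op M f g = f g" if "g \<in> ?G" for g
    using that inv MS S by (intro avg_op_of_invariant) (auto simp: M_eq)
  then have UM: "N \<le> (\<Sum>A\<in>?C m. \<Sum>g\<in>?G. (avg_op A f g)\<^sup>2)"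
    using member_le_sum[of M "?C m" "\<lambda>A. \<Sum>g\<in>?G. (avg_op A f g)\<^sup>2"] MS finC
    by (simp add: N_def m_def sum_nonneg)
  have "w m * N \<le> w m * (\<Sum>A\<in>?C m. \<Sum>g\<in>?G. (avg_op A f g)\<^sup>2)"
    using UM w(1) by (intro mult_left_mono) auto
  also have "\<dots> \<le> (\<Sum>m=1..n. w m * (\<Sum>A\<in>?C m. \<Sum>g\<in>?G. (avg_op A f g)\<^sup>2))"
    using m w(1) by (intro member_le_sum mult_nonneg_nonneg sum_nonneg) auto
  finally have wN: "w m * N \<le> (\<Sum>m=1..n. w m * (\<Sum>A\<in>?C m. \<Sum>g\<in>?G. (avg_op A f g)\<^sup>2))" .
  have "(\<Sum>g\<in>?G. ((?P ^^ t) f g)\<^sup>2) = (\<Sum>g\<in>?G. \<beta> ^ (2 * t) * (f g)\<^sup>2)"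
    using P2 by (intro sum.cong refl) (simp add: power_mult_distrib power_mult[symmetric] mult.commute)
  then have "(\<Sum>g\<in>?G. ((?P ^^ t) f g)\<^sup>2) = \<beta> ^ (2 * t) * N" by (simp add: N_def sum_distrib_left)
  moreover have "\<beta> ^ (2 * t) * N \<le> (w m + c) * N" using \<beta>w N by (intro mult_right_mono) auto
  ultimately have "(\<Sum>g\<in>?G. f g * Q f g) \<ge> 0"
    using wN unfolding quad N_def[symmetric] by (simp add: algebra_simps)
  moreover have "(\<Sum>g\<in>?G. f g * Q f g) = l * N"
    using f(1) by (simp add: E_def N_def sum_distrib_left power2_eq_square mult_ac)
  ultimately have "l \<ge> 0" using N by (simp add: zero_le_mult_iff)
  then have "0 \<le> l * (\<Sum>g\<in>?G. (\<phi> g)\<^sup>2)" by (intro mult_nonneg_nonneg sum_nonneg) auto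
  also have "\<dots> \<le> (\<Sum>g\<in>?G. \<phi> g * Q \<phi> g)" by (rule min)
  finally show ?thesis unfolding quad by simp
qed

section \<open>Points that have never been moved\<close>

text \<open>Expectation of a function of the state of the walk after \<open>t\<close> steps and of the set of points
  fixed by each of these steps.\<close>

primrec walk_expect :: "real \<Rightarrow> 'a set \<Rightarrow> nat \<Rightarrow> (('a \<Rightarrow> 'a) \<Rightarrow> 'a set \<Rightarrow> real) \<Rightarrow> real" where
  "walk_expect \<theta> S 0 F = F id S"
| "walk_expect \<theta> S (Suc t) F = (\<Sum>h | h permutes S. \<theta> ^ card (orbit h ` S) / pochhammer \<theta> (card S) *
     walk_expect \<theta> S t (\<lambda>g V. F (h \<circ> g) (V \<inter> {x. h x = x})))"

lemma walk_expect_add_scaled: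
  "walk_expect \<theta> S t (\<lambda>g V. a * F g V + b * H g V) = a * walk_expect \<theta> S t F + b * walk_expect \<theta> S t H"
  by (induction t arbitrary: F H) (simp_all add: sum.distrib sum_distrib_left algebra_simps)

lemma walk_expect_sum:
  assumes "finite I"
  shows "walk_expect \<theta> S t (\<lambda>g V. \<Sum>i\<in>I. F i g V) = (\<Sum>i\<in>I. walk_expect \<theta> S t (F i))"
  using assms
proof (induction I rule: finite_induct)
  case empty
  show ?case using walk_expect_add_scaled[of \<theta> S t 0 "\<lambda>_ _. 0" 0 "\<lambda>_ _. 0"] by simp
next
  case (insert x I)
  then show ?case
    using walk_expect_add_scaled[of \<theta> S t 1 "F x" 1 "\<lambda>g V. \<Sum>i\<in>I. F i g V"] by simp
qed

text \<open>The comparison is asked for only at pairs that the walk can reach: a point fixed by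
  every step is fixed by their product. This is how the untouched points come to bound the fixed
  points from below.\<close>

lemma walk_expect_mono:
  assumes "\<theta> > 0" "\<And>g V. V \<subseteq> S \<Longrightarrow> (\<forall>x\<in>V. g x = x) \<Longrightarrow> F g V \<le> H g V"
  shows "walk_expect \<theta> S t F \<le> walk_expect \<theta> S t H"
  using assms(2)
proof (induction t arbitrary: F H)
  case 0
  then show ?case by simp
next
  case (Suc t)
  have "pochhammer \<theta> (card S) > 0" using assms(1) by (rule pochhammer_pos)
  moreover have "walk_expect \<theta> S t (\<lambda>g V. F (h \<circ> g) (V \<inter> {x. h x = x})) \<le>
      walk_expect \<theta> S t (\<lambda>g V. H (h \<circ> g) (V \<inter> {x. h x = x}))" for h
  proof (rule Suc.IH)
    fix g V assume "V \<subseteq> S" "\<forall>x\<in>V. g x = x"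
    then have "V \<inter> {x. h x = x} \<subseteq> S" "\<forall>x\<in>V \<inter> {x. h x = x}. (h \<circ> g) x = x" by auto
    then show "F (h \<circ> g) (V \<inter> {x. h x = x}) \<le> H (h \<circ> g) (V \<inter> {x. h x = x})" by (rule Suc.prems)
  qed
  ultimately show ?case
    using assms(1) unfolding walk_expect.simps
    by (intro sum_mono mult_left_mono divide_nonneg_pos) simp_all
qed

lemma walk_expect_state:
  "walk_expect \<theta> S t (\<lambda>g V. f g) = (cycle_op \<theta> S ^^ t) f id"
proof (induction t arbitrary: f)
  case (Suc t)
  have "walk_expect \<theta> S (Suc t) (\<lambda>g V. f g) = (\<Sum>h | h permutes S. \<theta> ^ card (orbit h ` S) / pochhammer \<theta> (card S) *
     walk_expect \<theta> S t (\<lambda>g V. f (h \<circ> g)))" by simp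
  also have "\<dots> = walk_expect \<theta> S t (\<lambda>g V. \<Sum>h | h permutes S. \<theta> ^ card (orbit h ` S) / pochhammer \<theta> (card S) * f (h \<circ> g))"
  proof (cases "finite {h. h permutes S}")
    case True
    have "walk_expect \<theta> S t (\<lambda>g V. c * H g V) = c * walk_expect \<theta> S t H" for c H
      using walk_expect_add_scaled[of \<theta> S t c H 0 H] by simp
    then show ?thesis by (simp only: walk_expect_sum[OF True])
  next
    case False
    show ?thesis using walk_expect_add_scaled[of \<theta> S t 0 "\<lambda>_ _. 0" 0 "\<lambda>_ _. 0"] False by simp
  qed
  also have "\<dots> = walk_expect \<theta> S t (\<lambda>g V. cycle_op \<theta> S f g)" by (simp add: cycle_op_def)
  also have "\<dots> = (cycle_op \<theta> S ^^ Suc t) f id" unfolding Suc.IH by (simp only: funpow_Suc_right comp_def)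
  finally show ?case .
qed simp

lemma walk_expect_state_eq_sum:
  assumes "finite S"
  shows "walk_expect \<theta> S t (\<lambda>g V. f g) = (\<Sum>g | g permutes S. walk_law \<theta> S t g * f g)"
proof -
  have id: "id \<in> {g. g permutes S}" by (simp add: permutes_id)
  have fin: "finite {g. g permutes S}" using assms by (simp add: finite_permutations)
  have "(\<Sum>g | g permutes S. walk_law \<theta> S t g * f g) =
      (\<Sum>g | g permutes S. (if g = id then 1 else 0) * (cycle_op \<theta> S ^^ t) f g)"
    unfolding walk_law_def
    by (rule symmetric_operator_sym[OF symmetric_operator_funpow[OF symmetric_operator_cycle_op[OF assms]], symmetric])
  also have "\<dots> = (\<Sum>g | g permutes S. if g = id then (cycle_op \<theta> S ^^ t) f g else 0)"
    by (intro sum.cong refl) auto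
  also have "\<dots> = (cycle_op \<theta> S ^^ t) f id" using id fin by simp
  finally show ?thesis by (simp add: walk_expect_state)
qed

text \<open>The steps are independent and each has to fix \<open>B\<close> pointwise. Counting
  untouched points rather than fixed points of the product makes the moments exact
  \<open>t\<close>-th powers.\<close>

lemma walk_expect_untouched:
  assumes "finite S" "B \<subseteq> S"
  shows "walk_expect \<theta> S t (\<lambda>g V. if B \<subseteq> V then 1 else 0) =
    ((\<Sum>h | h permutes (S - B). \<theta> ^ card (orbit h ` S)) / pochhammer \<theta> (card S)) ^ t"
proof (induction t)
  case 0
  then show ?case using assms by simp
next
  case (Suc t)
  let ?p = "((\<Sum>h | h permutes (S - B). \<theta> ^ card (orbit h ` S)) / pochhammer \<theta> (card S))"
  have fix_iff: "h permutes (S - B) \<longleftrightarrow> h permutes S \<and> B \<subseteq> {x. h x = x}" for h :: "'a \<Rightarrow> 'a"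
  proof
    assume h: "h permutes (S - B)"
    then have "h permutes S" using permutes_subset by blast
    then show "h permutes S \<and> B \<subseteq> {x. h x = x}" using h by (auto simp: permutes_not_in)
  next
    assume h: "h permutes S \<and> B \<subseteq> {x. h x = x}"
    then show "h permutes (S - B)" by (intro permutes_superset[of h S "S - B"]) auto
  qed
  have zero: "walk_expect \<theta> S t (\<lambda>g V. 0) = 0"
    using walk_expect_add_scaled[of \<theta> S t 0 "\<lambda>_ _. 0" 0 "\<lambda>_ _. 0"] by simp
  have "walk_expect \<theta> S (Suc t) (\<lambda>g V. if B \<subseteq> V then 1 else 0) =
      (\<Sum>h | h permutes S. if h permutes (S - B) then \<theta> ^ card (orbit h ` S) / pochhammer \<theta> (card S) * ?p ^ t else 0)"
    unfolding walk_expect.simps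
  proof (rule sum.cong[OF refl])
    fix h assume h: "h \<in> {h. h permutes S}"
    show "\<theta> ^ card (orbit h ` S) / pochhammer \<theta> (card S) *
        walk_expect \<theta> S t (\<lambda>g V. if B \<subseteq> V \<inter> {x. h x = x} then 1 else 0) =
      (if h permutes (S - B) then \<theta> ^ card (orbit h ` S) / pochhammer \<theta> (card S) * ?p ^ t else 0)"
    proof (cases "h permutes (S - B)")
      case True
      then have "(\<lambda>(g :: 'a \<Rightarrow> 'a) V. if B \<subseteq> V \<inter> {x. h x = x} then 1 else 0) = (\<lambda>g V. if B \<subseteq> V then 1 else (0::real))"
        using fix_iff[of h] by auto
      then show ?thesis by (simp only: True Suc.IH if_True)
    next
      case False
      then have "\<not> B \<subseteq> {x. h x = x}" using fix_iff[of h] h by simp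
      then have "(\<lambda>(g :: 'a \<Rightarrow> 'a) V. if B \<subseteq> V \<inter> {x. h x = x} then 1 else 0) = (\<lambda>g V. 0 :: real)" by auto
      then show ?thesis using False zero by simp
    qed
  qed
  also have "\<dots> = (\<Sum>h | h permutes (S - B). \<theta> ^ card (orbit h ` S) / pochhammer \<theta> (card S) * ?p ^ t)"
  proof -
    have "{h. h permutes S} \<inter> {h. h permutes (S - B)} = {h. h permutes (S - B)}" using fix_iff by blast
    then show ?thesis
      using sum.inter_restrict[of "{h. h permutes S}" _ "{h. h permutes (S - B)}"] finite_permutations[OF assms(1)]
      by (simp add: sum.If_cases)
  qed
  also have "\<dots> = ?p ^ Suc t" by (simp add: sum_distrib_right sum_divide_distrib)
  finally show ?case .
qed

section \<open>Moments of untouched and fixed points, and the lower bound\<close>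

lemma card_orbits_fixed_point:
  assumes "finite A" "x \<notin> A" "q permutes A"
  shows "card (orbit q ` insert x A) = card (orbit q ` A) + 1"
  using card_orbits_insert[OF assms(1,2) _ assms(3), of x] by simp

lemma sum_weights_fixing_one:
  fixes \<theta> :: real
  assumes "finite S" "x \<in> S" "\<theta> > 0"
  shows "(\<Sum>h | h permutes (S - {x}). \<theta> ^ card (orbit h ` S)) = \<theta> * pochhammer \<theta> (card S - 1)"
proof -
  have S: "S = insert x (S - {x})" using assms by auto
  have "(\<Sum>h | h permutes (S - {x}). \<theta> ^ card (orbit h ` S)) =
      (\<Sum>h | h permutes (S - {x}). \<theta> * \<theta> ^ card (orbit h ` (S - {x})))"
  proof (rule sum.cong[OF refl])
    fix h assume "h \<in> {h. h permutes (S - {x})}"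
    then have eq: "card (orbit h ` insert x (S - {x})) = card (orbit h ` (S - {x})) + 1"
      using assms by (intro card_orbits_fixed_point) auto
    then show "\<theta> ^ card (orbit h ` S) = \<theta> * \<theta> ^ card (orbit h ` (S - {x}))"
      using eq unfolding S[symmetric] by simp
  qed
  then show ?thesis
    using sum_cycle_weights[of "S - {x}" \<theta>] assms by (simp add: sum_distrib_left[symmetric])
qed

lemma sum_weights_fixing_two:
  fixes \<theta> :: real
  assumes "finite S" "x \<in> S" "y \<in> S" "x \<noteq> y" "\<theta> > 0"
  shows "(\<Sum>h | h permutes (S - {x, y}). \<theta> ^ card (orbit h ` S)) = \<theta>\<^sup>2 * pochhammer \<theta> (card S - 2)"
proof -
  let ?T = "S - {y}"
  have S: "S = insert y ?T" using assms by auto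
  have ST: "S - {x, y} = ?T - {x}" by auto
  have "(\<Sum>h | h permutes (?T - {x}). \<theta> ^ card (orbit h ` S)) =
      (\<Sum>h | h permutes (?T - {x}). \<theta> * \<theta> ^ card (orbit h ` ?T))"
  proof (rule sum.cong[OF refl])
    fix h assume "h \<in> {h. h permutes (?T - {x})}"
    then have "h permutes ?T" using permutes_subset by blast
    then have eq: "card (orbit h ` insert y ?T) = card (orbit h ` ?T) + 1"
      using assms by (intro card_orbits_fixed_point) auto
    then show "\<theta> ^ card (orbit h ` S) = \<theta> * \<theta> ^ card (orbit h ` ?T)"
      using eq unfolding S[symmetric] by simp
  qed
  also have "\<dots> = \<theta> * (\<theta> * pochhammer \<theta> (card ?T - 1))"
    using sum_weights_fixing_one[of ?T x \<theta>] assms by (simp add: sum_distrib_left[symmetric])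
  finally show ?thesis using assms by (simp add: ST power2_eq_square numeral_2_eq_2)
qed

lemma sum_card_fixed_points:
  assumes "finite S" "S \<noteq> {}"
  shows "(\<Sum>g | g permutes S. real (card {x\<in>S. g x = x})) = fact (card S)"
proof -
  have "(\<Sum>g | g permutes S. real (card {x\<in>S. g x = x})) =
      (\<Sum>g | g permutes S. \<Sum>x\<in>S. if g x = x then 1 else 0)"
    using assms by (intro sum.cong refl) (simp add: sum.If_cases Int_def)
  also have "\<dots> = (\<Sum>x\<in>S. \<Sum>g | g permutes S. if g x = x then 1 else 0)" by (rule sum.swap)
  also have "\<dots> = (\<Sum>x\<in>S. fact (card S - 1))"
  proof (rule sum.cong[OF refl])
    fix x assume x: "x \<in> S"
    have "{g. g permutes S} \<inter> {g. g x = x} = {g. g permutes (S - {x})}"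
    proof (intro equalityI subsetI)
      fix g assume "g \<in> {g. g permutes S} \<inter> {g. g x = x}"
      then show "g \<in> {g. g permutes (S - {x})}" by (auto intro: permutes_superset[of g S])
    next
      fix g assume "g \<in> {g. g permutes (S - {x})}"
      then have g: "g permutes (S - {x})" by simp
      then have "g permutes S" using permutes_subset by blast
      then show "g \<in> {g. g permutes S} \<inter> {g. g x = x}" using permutes_not_in[OF g] by simp
    qed
    then have "(\<Sum>g | g permutes S. if g x = x then 1 else 0 :: real) = real (card {g. g permutes (S - {x})})"
      using finite_permutations[OF assms(1)] by (simp add: sum.If_cases)
    also have "\<dots> = fact (card S - 1)" using card_permutations[of "S - {x}" "card S - 1"] assms(1) x by simp
    finally show "(\<Sum>g | g permutes S. if g x = x then 1 else 0 :: real) = fact (card S - 1)" .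
  qed
  also have "\<dots> = fact (card S)"
  proof -
    have "card S > 0" using assms by (simp add: card_gt_0_iff)
    then show ?thesis by (simp add: fact_reduce)
  qed
  finally show ?thesis .
qed

text \<open>The test event is to have at least half as many fixed points as the mean number
  \<open>real n * p\<close> of untouched points. \<open>r\<close> is the ratio of the pair
  probability to \<open>p\<^sup>2\<close>, so \<open>r - 1\<close> measures the correlation.
  Chebyshev's inequality under the walk loses \<open>4 / (real n * p) + 4 * (r - 1)\<close>, and
  Markov's inequality under the uniform law, with mean 1, loses
  \<open>2 / (real n * p)\<close>.\<close>

lemma walk_tv_ge:
  fixes \<theta> :: real and t :: nat
  assumes n: "n \<ge> 2" and \<theta>: "\<theta> > 0"
  defines "p \<equiv> (\<theta> / (\<theta> + real n - 1)) ^ t" and "r \<equiv> ((\<theta> + real n - 1) / (\<theta> + real n - 2)) ^ t"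
  shows "walk_tv n \<theta> t \<ge> 1 - 6 / (real n * p) - 4 * (r - 1)"
proof -
  define S where "S = {1..n}"
  have S: "finite S" "card S = n" "S \<noteq> {}" using n by (auto simp: S_def)
  let ?G = "{g. g permutes S}"
  have finG: "finite ?G" using S by (simp add: finite_permutations)
  have \<theta>n: "\<theta> + real n - 1 > 0" "\<theta> + real n - 2 > 0" using n \<theta> by auto
  have p0: "p > 0" using \<theta> \<theta>n by (simp add: p_def)
  define a where "a = real n * p"
  have a: "a > 0" using n p0 by (simp add: a_def)
  let ?ex = "walk_expect \<theta> S t"
  have pSuc: "pochhammer \<theta> n = pochhammer \<theta> (n - 1) * (\<theta> + real n - 1)"
    using n pochhammer_Suc[of \<theta> "n - 1"] by (simp add: algebra_simps of_nat_diff)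
  have pSuc2: "pochhammer \<theta> (n - 1) = pochhammer \<theta> (n - 2) * (\<theta> + real n - 2)"
    using n pochhammer_Suc[of \<theta> "n - 2"] by (simp add: algebra_simps of_nat_diff Suc_diff_Suc numeral_2_eq_2)
  have pSuc3: "pochhammer \<theta> n = pochhammer \<theta> (n - 2) * ((\<theta> + real n - 1) * (\<theta> + real n - 2))"
    unfolding pSuc pSuc2 by (simp only: mult_ac)
  have ppos: "pochhammer \<theta> k > 0" for k using \<theta> by (rule pochhammer_pos)
  have one: "?ex (\<lambda>g V. if {x} \<subseteq> V then 1 else 0) = p" if "x \<in> S" for x
    using walk_expect_untouched[of S "{x}" \<theta> t] sum_weights_fixing_one[OF S(1) that \<theta>] S that ppos[of "n - 1"]
    by (simp add: pSuc p_def)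
  have two: "?ex (\<lambda>g V. if {x, y} \<subseteq> V then 1 else 0) = r * p\<^sup>2" if "x \<in> S" "y \<in> S" "x \<noteq> y" for x y
  proof -
    have "?ex (\<lambda>g V. if {x, y} \<subseteq> V then 1 else 0) =
        (\<theta>\<^sup>2 / ((\<theta> + real n - 1) * (\<theta> + real n - 2))) ^ t"
      using walk_expect_untouched[of S "{x, y}" \<theta> t] sum_weights_fixing_two[OF S(1) that \<theta>] S that ppos[of "n - 2"]
      by (simp add: pSuc3 mult_ac)
    also have "\<theta>\<^sup>2 / ((\<theta> + real n - 1) * (\<theta> + real n - 2)) =
        ((\<theta> + real n - 1) / (\<theta> + real n - 2)) * (\<theta> / (\<theta> + real n - 1))\<^sup>2"
      using \<theta>n by (simp add: power2_eq_square)
    also have "(((\<theta> + real n - 1) / (\<theta> + real n - 2)) * (\<theta> / (\<theta> + real n - 1))\<^sup>2) ^ t = r * p\<^sup>2"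
    proof -
      have "(v\<^sup>2) ^ t = (v ^ t)\<^sup>2" for v :: real by (metis power_mult mult.commute)
      then show ?thesis by (simp only: r_def p_def power_mult_distrib)
    qed
    finally show ?thesis .
  qed
  define I where "I = (\<lambda>(x :: nat) (g :: nat \<Rightarrow> nat) V. if {x} \<subseteq> V then 1 else 0 :: real)"
  define U where "U = (\<lambda>(g :: nat \<Rightarrow> nat) V. \<Sum>x\<in>S. I x g V)"
  have U_card: "U g V = card V" if "V \<subseteq> S" for g V
  proof -
    have "S \<inter> V = V" using that by auto
    then show ?thesis using S by (simp add: U_def I_def sum.If_cases)
  qed
  have EU: "?ex U = a"
    unfolding U_def walk_expect_sum[OF S(1)] using one S by (simp add: I_def a_def)
  have r1: "r \<ge> 1" unfolding r_def using \<theta>n by (intro one_le_power) simp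
  have EU2: "?ex (\<lambda>g V. (U g V)\<^sup>2) \<le> a + r * a\<^sup>2"
  proof -
    have "(\<lambda>g V. (U g V)\<^sup>2) = (\<lambda>g V. \<Sum>x\<in>S. \<Sum>y\<in>S. if {x, y} \<subseteq> V then 1 else 0)"
      unfolding U_def I_def power2_eq_square sum_product by (intro ext sum.cong refl) auto
    then have "?ex (\<lambda>g V. (U g V)\<^sup>2) = (\<Sum>x\<in>S. \<Sum>y\<in>S. ?ex (\<lambda>g V. if {x, y} \<subseteq> V then 1 else 0))"
      by (simp only: walk_expect_sum[OF S(1)])
    also have "\<dots> \<le> (\<Sum>x\<in>S. \<Sum>y\<in>S. (if y = x then p else 0) + r * p\<^sup>2)"
    proof (intro sum_mono)
      fix x y assume xy: "x \<in> S" "y \<in> S"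
      show "?ex (\<lambda>g V. if {x, y} \<subseteq> V then 1 else 0) \<le> (if y = x then p else 0) + r * p\<^sup>2"
        using two[OF xy] one[OF xy(1)] r1 by (cases "y = x") auto
    qed
    also have "\<dots> = a + r * a\<^sup>2"
      using S by (simp add: sum.distrib a_def power2_eq_square algebra_simps)
    finally show ?thesis .
  qed
  have E1: "?ex (\<lambda>g V. 1) = 1"
    unfolding walk_expect_state using cycle_op_const[OF S(1) \<theta>, of 1]
    by (induction t) (simp_all add: funpow_swap1)
  have var: "?ex (\<lambda>g V. (U g V - a)\<^sup>2) \<le> a + (r - 1) * a\<^sup>2"
  proof -
    have "(\<lambda>g V. (U g V - a)\<^sup>2) = (\<lambda>g V. 1 * (1 * (U g V)\<^sup>2 + (- 2 * a) * U g V) + a\<^sup>2 * 1)"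
      by (intro ext) (simp add: power2_eq_square algebra_simps)
    then have "?ex (\<lambda>g V. (U g V - a)\<^sup>2) = ?ex (\<lambda>g V. (U g V)\<^sup>2) - 2 * a * ?ex U + a\<^sup>2 * ?ex (\<lambda>g V. 1)"
      by (simp only: walk_expect_add_scaled) simp
    then show ?thesis using EU EU2 E1 by (simp add: power2_eq_square algebra_simps)
  qed
  define fixed where "fixed = (\<lambda>g :: nat \<Rightarrow> nat. real (card {x\<in>S. g x = x}))"
  define T where "T = {g\<in>?G. fixed g \<ge> a / 2}"
  let ?law = "walk_law \<theta> S t"
  have law_sum: "(\<Sum>g\<in>?G. ?law g) = 1"
    using walk_expect_state_eq_sum[OF S(1), of \<theta> t "\<lambda>_. 1"] E1 by simp
  have "(\<Sum>g\<in>T. ?law g) = (\<Sum>g\<in>?G. if fixed g \<ge> a / 2 then ?law g else 0)"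
    unfolding T_def by (rule sum.inter_filter[OF finG])
  also have "\<dots> = (\<Sum>g\<in>?G. ?law g * (if fixed g \<ge> a / 2 then 1 else 0))"
    by (intro sum.cong refl) simp
  also have "\<dots> = ?ex (\<lambda>g V. if fixed g \<ge> a / 2 then 1 else 0)"
    by (rule walk_expect_state_eq_sum[OF S(1), symmetric])
  finally have lawT_eq: "(\<Sum>g\<in>T. ?law g) = ?ex (\<lambda>g V. if fixed g \<ge> a / 2 then 1 else 0)" .
  \<comment> \<open>Chebyshev's inequality in the form of a quadratic minorant of the indicator, so
    that linearity and monotonicity of \<open>walk_expect\<close> are enough.\<close>
  have "?ex (\<lambda>g V. 1 * 1 + (- 4 / a\<^sup>2) * (U g V - a)\<^sup>2) \<le> ?ex (\<lambda>g V. if fixed g \<ge> a / 2 then 1 else 0)"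
  proof (rule walk_expect_mono[OF \<theta>])
    fix g V assume V: "V \<subseteq> S" "\<forall>x\<in>V. g x = (x :: nat)"
    show "1 * 1 + (- 4 / a\<^sup>2) * (U g V - a)\<^sup>2 \<le> (if fixed g \<ge> a / 2 then 1 else 0)"
    proof (cases "fixed g \<ge> a / 2")
      case True
      then show ?thesis using a by simp
    next
      case False
      have "card V \<le> card {x\<in>S. g x = x}" using V S by (intro card_mono) auto
      then have "U g V \<le> a / 2" using False U_card[OF V(1)] by (simp add: fixed_def)
      then have "(a / 2)\<^sup>2 \<le> (a - U g V)\<^sup>2" using a by (intro power_mono) auto
      then have "a\<^sup>2 \<le> 4 * (U g V - a)\<^sup>2" by (simp add: power2_eq_square algebra_simps)
      then show ?thesis using False a by (simp add: field_simps)
    qed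
  qed
  also have "?ex (\<lambda>g V. 1 * 1 + (- 4 / a\<^sup>2) * (U g V - a)\<^sup>2) =
      1 - 4 / a\<^sup>2 * ?ex (\<lambda>g V. (U g V - a)\<^sup>2)"
    unfolding walk_expect_add_scaled E1 by simp
  finally have lawT0: "(\<Sum>g\<in>T. ?law g) \<ge> 1 - 4 / a\<^sup>2 * ?ex (\<lambda>g V. (U g V - a)\<^sup>2)"
    unfolding lawT_eq .
  have "4 / a\<^sup>2 * ?ex (\<lambda>g V. (U g V - a)\<^sup>2) \<le> 4 / a\<^sup>2 * (a + (r - 1) * a\<^sup>2)"
    using var by (intro mult_left_mono) auto
  also have "\<dots> = 4 / a + 4 * (r - 1)" using a by (simp add: power2_eq_square field_simps)
  finally have lawT: "(\<Sum>g\<in>T. ?law g) \<ge> 1 - 4 / a - 4 * (r - 1)" using lawT0 by linarith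
  have "(\<Sum>g\<in>T. 1 / fact n) \<le> (\<Sum>g\<in>T. 2 / a * fixed g / fact n)"
  proof (rule sum_mono)
    fix g assume "g \<in> T"
    then have "1 \<le> 2 / a * fixed g" using a by (simp add: T_def field_simps)
    then show "1 / fact n \<le> 2 / a * fixed g / fact n" by (rule divide_right_mono) simp
  qed
  also have "\<dots> \<le> (\<Sum>g\<in>?G. 2 / a * fixed g / fact n)"
    using a finG by (intro sum_mono2) (auto simp: T_def fixed_def)
  also have "\<dots> = 2 / a * (\<Sum>g\<in>?G. fixed g) / fact n"
    by (simp add: sum_distrib_left sum_divide_distrib)
  also have "\<dots> = 2 / a" using sum_card_fixed_points[OF S(1,3)] S by (simp add: fixed_def)
  finally have unifT: "(\<Sum>g\<in>T. 1 / fact n) \<le> 2 / a" .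
  define D where "D = (\<lambda>g. ?law g - 1 / fact n)"
  have DG: "(\<Sum>g\<in>?G. D g) = 0"
  proof -
    have "(\<Sum>g\<in>?G. 1 / fact n :: real) = fact (card S) * (1 / fact n)"
      by (rule sum_permutes_const[OF S(1)])
    also have "\<dots> = 1" by (simp add: S)
    finally show ?thesis using law_sum by (simp only: D_def sum_subtractf)
  qed
  have TG: "T \<subseteq> ?G" by (auto simp: T_def)
  have split: "(\<Sum>g\<in>?G. F g) = (\<Sum>g\<in>T. F g) + (\<Sum>g\<in>?G - T. F g)" for F :: "(nat \<Rightarrow> nat) \<Rightarrow> real"
    using sum.subset_diff[OF TG finG, of F] by simp
  have "(\<Sum>g\<in>T. D g) \<le> (\<Sum>g\<in>T. \<bar>D g\<bar>)" "- (\<Sum>g\<in>?G - T. D g) \<le> (\<Sum>g\<in>?G - T. \<bar>D g\<bar>)"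
    by (auto simp: sum_negf[symmetric] intro!: sum_mono)
  then have "2 * (\<Sum>g\<in>T. D g) \<le> (\<Sum>g\<in>?G. \<bar>D g\<bar>)" using DG split[of D] split[of "\<lambda>g. \<bar>D g\<bar>"] by linarith
  moreover have "walk_tv n \<theta> t = 1/2 * (\<Sum>g\<in>?G. \<bar>D g\<bar>)" by (simp add: walk_tv_eq D_def S_def)
  moreover have "(\<Sum>g\<in>T. D g) = (\<Sum>g\<in>T. ?law g) - (\<Sum>g\<in>T. 1 / fact n)" by (simp add: D_def sum_subtractf)
  ultimately have "walk_tv n \<theta> t \<ge> 1 - 4 / a - 4 * (r - 1) - 2 / a" using lawT unifT by linarith
  moreover have "6 / a = 4 / a + 2 / a" by (simp add: add_divide_distrib[symmetric])
  ultimately have "walk_tv n \<theta> t \<ge> 1 - 6 / a - 4 * (r - 1)" by linarith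
  then show ?thesis by (simp only: a_def)
qed

section \<open>Upper bound for the parameter \<open>\<theta> = n\<close>\<close>

lemma cycle_op_funpow_nonneg:
  assumes "\<theta> > 0" "\<And>g. 0 \<le> f g"
  shows "0 \<le> (cycle_op \<theta> S ^^ t) f g"
proof (induction t arbitrary: g)
  case (Suc t)
  have "pochhammer \<theta> (card S) > 0" using assms(1) by (rule pochhammer_pos)
  then show ?case
    using Suc assms(1) unfolding funpow.simps comp_def cycle_op_def[of _ _ "(cycle_op \<theta> S ^^ t) f"]
    by (intro sum_nonneg mult_nonneg_nonneg divide_nonneg_pos) simp_all
qed (simp add: assms)

lemma cycle_op_funpow_const:
  assumes "finite S" "\<theta> > 0"
  shows "(cycle_op \<theta> S ^^ t) (\<lambda>_. c) = (\<lambda>_. c)"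
  by (induction t) (simp_all add: cycle_op_const[OF assms])

lemma cycle_op_funpow_sum:
  assumes "finite S" "\<theta> > 0"
  shows "(\<Sum>g | g permutes S. (cycle_op \<theta> S ^^ t) f g) = (\<Sum>g | g permutes S. f g)"
  using symmetric_operator_sym[OF symmetric_operator_funpow[OF symmetric_operator_cycle_op[OF assms(1)]],
      where f = "\<lambda>_. 1" and h = f]
  by (simp add: cycle_op_funpow_const[OF assms])

lemma walk_tv_nonneg: "0 \<le> walk_tv n \<theta> t"
  by (simp add: walk_tv_eq sum_nonneg)

lemma walk_law_distribution:
  assumes "finite S" "\<theta> > 0"
  shows "0 \<le> walk_law \<theta> S t g" "(\<Sum>g | g permutes S. walk_law \<theta> S t g) = 1"
proof -
  show "0 \<le> walk_law \<theta> S t g" unfolding walk_law_def by (intro cycle_op_funpow_nonneg assms) simp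
  have "id \<in> {g. g permutes S}" by (simp add: permutes_id)
  then show "(\<Sum>g | g permutes S. walk_law \<theta> S t g) = 1"
    unfolding walk_law_def cycle_op_funpow_sum[OF assms] using finite_permutations[OF assms(1)] by simp
qed

lemma walk_tv_le_1:
  assumes "\<theta> > 0"
  shows "walk_tv n \<theta> t \<le> 1"
proof -
  have "(\<Sum>g | g permutes {1..n}. \<bar>walk_law \<theta> {1..n} t g - 1 / fact n\<bar>) \<le>
      (\<Sum>g | g permutes {1..n}. walk_law \<theta> {1..n} t g + 1 / fact n)"
  proof (rule sum_mono)
    fix g
    have "0 \<le> walk_law \<theta> {1..n} t g" using assms by (intro walk_law_distribution) auto
    then show "\<bar>walk_law \<theta> {1..n} t g - 1 / fact n\<bar> \<le> walk_law \<theta> {1..n} t g + 1 / fact n"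
      by (simp add: abs_le_iff)
  qed
  also have "\<dots> = 2"
  proof -
    have "(\<Sum>g | g permutes {1..n}. 1 / fact n :: real) = fact (card {1..n}) * (1 / fact n)"
      by (rule sum_permutes_const) simp
    also have "\<dots> = 1" by simp
    finally have "(\<Sum>g | g permutes {1..n}. 1 / fact n :: real) = 1" .
    moreover have "(\<Sum>g | g permutes {1..n}. walk_law \<theta> {1..n} t g) = 1"
      using assms by (intro walk_law_distribution) auto
    ultimately show ?thesis by (simp only: sum.distrib)
  qed
  finally show ?thesis by (simp add: walk_tv_eq)
qed

lemma sum_abs_le_sqrt:
  fixes f :: "'b \<Rightarrow> real"
  shows "(\<Sum>x\<in>A. \<bar>f x\<bar>) \<le> sqrt (real (card A) * (\<Sum>x\<in>A. (f x)\<^sup>2))"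
proof (rule real_le_rsqrt)
  show "(\<Sum>x\<in>A. \<bar>f x\<bar>)\<^sup>2 \<le> real (card A) * (\<Sum>x\<in>A. (f x)\<^sup>2)"
    using Cauchy_Schwarz_ineq_sum[of "\<lambda>_. 1" "\<lambda>x. \<bar>f x\<bar>" A] by simp
qed

lemma sum_square_centred:
  fixes f :: "'b \<Rightarrow> real"
  assumes A: "finite A" "A \<noteq> {}" and W: "(\<Sum>x\<in>A. f x) = W"
  shows "(\<Sum>x\<in>A. (f x - W / card A)\<^sup>2) \<le> (\<Sum>x\<in>A. (f x)\<^sup>2)"
proof -
  define v where "v = W / card A"
  have "real (card A) > 0" using A by (simp add: card_gt_0_iff)
  then have Wv: "W = card A * v" by (simp add: v_def)
  have "(\<Sum>x\<in>A. (f x - v)\<^sup>2) = (\<Sum>x\<in>A. (f x)\<^sup>2 + v\<^sup>2 - 2 * v * f x)"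
    by (intro sum.cong refl) (simp add: power2_eq_square algebra_simps)
  also have "\<dots> = (\<Sum>x\<in>A. (f x)\<^sup>2) + card A * v\<^sup>2 - 2 * v * W"
    by (simp only: sum.distrib sum_subtractf sum_distrib_left[symmetric] W sum_constant)
  also have "\<dots> = (\<Sum>x\<in>A. (f x)\<^sup>2) - card A * v\<^sup>2"
    by (simp add: Wv power2_eq_square algebra_simps)
  also have "\<dots> \<le> (\<Sum>x\<in>A. (f x)\<^sup>2)" by simp
  finally show ?thesis by (simp only: v_def)
qed

text \<open>The first \<open>s\<close> steps only serve to make the law comparable, up to a small error, to a measure
  with density at most \<open>n ^ i0\<close>; the remaining \<open>t\<close> steps are controlled in \<open>L\<^sup>2\<close>.\<close>

lemma walk_tv_two_phase:
  fixes w :: "nat \<Rightarrow> real" and i0 s t n :: nat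
  assumes n: "n \<ge> 1" and w: "\<And>m. w m \<ge> 0" "c \<ge> 0"
    and bound: "\<And>m. 1 \<le> m \<Longrightarrow> m < n \<Longrightarrow> eig_bound n m ^ (2 * t) \<le> w m + c"
  shows "walk_tv n (real n) (t + s) \<le> (\<Sum>k<n. ((real n - 1) / (real n + k)) ^ s) / (real i0 + 1) +
    sqrt ((\<Sum>m\<in>{1..<n}. w m * (real (n choose m) * (fact n / fact m))) + c * real n ^ i0)"
proof -
  define S where "S = {1..n}"
  have S: "finite S" "card S = n" by (auto simp: S_def)
  let ?G = "{g. g permutes S}" and ?P = "cycle_op (real n) S"
  have finG: "finite ?G" using S by (simp add: finite_permutations)
  have cardG: "card ?G = fact n" using S by (simp add: card_permutations)
  have neG: "?G \<noteq> {}" using permutes_id by blast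
  have npos: "real n > 0" using n by simp
  obtain X where X: "\<And>g. walk_law (real n) S s g = (\<Sum>i\<le>n. X i g)" "\<And>i g. 0 \<le> X i g"
    "\<And>i g. \<not> g permutes S \<Longrightarrow> X i g = 0"
    "\<And>i g. X i g \<le> real n ^ i / fact n * (\<Sum>h\<in>?G. X i h)" "(\<Sum>i\<le>n. \<Sum>h\<in>?G. X i h) = 1"
    "(\<Sum>i\<le>n. real i * (\<Sum>h\<in>?G. X i h)) = (\<Sum>k<n. ((real n - 1) / (real n + k)) ^ s)"
    using walk_law_mixture[of S "real n" n s] n S by auto
  define m where "m = (\<lambda>i. \<Sum>h\<in>?G. X i h)"
  have m0: "0 \<le> m i" for i unfolding m_def by (intro sum_nonneg X(2))
  \<comment> \<open>Components with at most \<open>i0\<close> unrandomised points have density at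
    most \<open>real n ^ i0 / fact n\<close>; the mass of the others is controlled by Markov's
    inequality.\<close>
  define lo where "lo = {i. i \<le> n \<and> i \<le> i0}"
  define hi where "hi = {i. i \<le> n \<and> i0 < i}"
  have lohi: "{..n} = lo \<union> hi" "lo \<inter> hi = {}" "finite lo" "finite hi" by (auto simp: lo_def hi_def)
  have split: "(\<Sum>i\<le>n. F i) = (\<Sum>i\<in>lo. F i) + (\<Sum>i\<in>hi. F i)" for F :: "nat \<Rightarrow> real"
    unfolding lohi(1) using lohi by (intro sum.union_disjoint)
  define \<mu> where "\<mu> = (\<lambda>g. \<Sum>i\<in>lo. X i g)"
  define \<rho> where "\<rho> = (\<lambda>g. \<Sum>i\<in>hi. X i g)"
  define W where "W = (\<Sum>i\<in>lo. m i)"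
  have \<mu>0: "0 \<le> \<mu> g" and \<rho>0: "0 \<le> \<rho> g" for g unfolding \<mu>_def \<rho>_def by (intro sum_nonneg X(2))+
  have mass_\<mu>: "(\<Sum>g\<in>?G. \<mu> g) = W" unfolding \<mu>_def W_def m_def by (rule sum.swap)
  have mass_\<rho>': "(\<Sum>g\<in>?G. \<rho> g) = (\<Sum>i\<in>hi. m i)" unfolding \<rho>_def m_def by (rule sum.swap)
  have "W + (\<Sum>i\<in>hi. m i) = 1" using X(5) unfolding split W_def m_def .
  then have mass_\<rho>: "(\<Sum>g\<in>?G. \<rho> g) = 1 - W" using mass_\<rho>' by simp
  have W01: "0 \<le> W" "W \<le> 1"
    using m0 \<rho>0 mass_\<rho> sum_nonneg[of ?G \<rho>] by (auto simp: W_def intro: sum_nonneg)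
  have tail: "1 - W \<le> (\<Sum>k<n. ((real n - 1) / (real n + k)) ^ s) / (real i0 + 1)"
  proof -
    have "(real i0 + 1) * (1 - W) = (\<Sum>i\<in>hi. (real i0 + 1) * m i)"
      using mass_\<rho> mass_\<rho>' by (simp only: sum_distrib_left[symmetric])
    also have "\<dots> \<le> (\<Sum>i\<in>hi. real i * m i)"
      using m0 by (intro sum_mono mult_right_mono) (auto simp: hi_def)
    also have "\<dots> \<le> (\<Sum>i\<le>n. real i * m i)"
      unfolding split using m0 by (simp add: sum_nonneg)
    also have "\<dots> = (\<Sum>k<n. ((real n - 1) / (real n + k)) ^ s)" using X(6) by (simp add: m_def)
    finally show ?thesis by (simp add: le_divide_eq mult.commute)
  qed
  have \<mu>_le: "\<mu> g \<le> real n ^ i0 / fact n" for g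
  proof -
    have "\<mu> g \<le> (\<Sum>i\<in>lo. real n ^ i0 / fact n * m i)"
      unfolding \<mu>_def
    proof (rule sum_mono)
      fix i assume "i \<in> lo"
      then have "real n ^ i \<le> real n ^ i0" using n by (intro power_increasing) (auto simp: lo_def)
      then have "real n ^ i / fact n * m i \<le> real n ^ i0 / fact n * m i"
        using m0 by (intro mult_right_mono divide_right_mono) auto
      then show "X i g \<le> real n ^ i0 / fact n * m i" using X(4)[of i g] by (simp add: m_def)
    qed
    also have "\<dots> = real n ^ i0 / fact n * W" by (simp add: W_def sum_distrib_left)
    also have "\<dots> \<le> real n ^ i0 / fact n * 1" using W01 by (intro mult_left_mono) auto
    finally show ?thesis by simp
  qed
  \<comment> \<open>Removing the mean makes \<open>\<phi>\<close> orthogonal to the constants, which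
    the walk does not contract.\<close>
  define \<phi> where "\<phi> = (\<lambda>g. \<mu> g - W / fact n)"
  have \<phi>2: "(\<Sum>g\<in>?G. (\<phi> g)\<^sup>2) \<le> real n ^ i0 / fact n"
  proof -
    have "(\<Sum>g\<in>?G. (\<phi> g)\<^sup>2) \<le> (\<Sum>g\<in>?G. (\<mu> g)\<^sup>2)"
      using sum_square_centred[OF finG neG mass_\<mu>] by (simp add: \<phi>_def cardG)
    also have "\<dots> \<le> (\<Sum>g\<in>?G. real n ^ i0 / fact n * \<mu> g)"
      unfolding power2_eq_square using \<mu>0 \<mu>_le by (intro sum_mono mult_right_mono)
    also have "\<dots> = real n ^ i0 / fact n * W" by (simp add: sum_distrib_left[symmetric] mass_\<mu> del: times_divide_eq_left)
    also have "\<dots> \<le> real n ^ i0 / fact n * 1" using W01 by (intro mult_left_mono) auto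
    finally show ?thesis by simp
  qed
  have avg_\<phi>: "avg_op A \<phi> g = avg_op A \<mu> g - W / fact n" if "A \<subseteq> S" for A g
  proof -
    have "finite A" using that S finite_subset by blast
    then have "(\<Sum>h | h permutes A. \<phi> (h \<circ> g)) = (\<Sum>h | h permutes A. \<mu> (h \<circ> g)) - fact (card A) * (W / fact n)"
      by (simp add: \<phi>_def sum_subtractf card_permutations)
    then show ?thesis by (simp add: avg_op_def diff_divide_distrib)
  qed
  \<comment> \<open>Averaging a measure of mass at most 1 over Sym(\<open>A\<close>) gives values at
    most \<open>1 / fact (card A)\<close>. This takes the place of any knowledge of
    multiplicities.\<close>
  have avg2: "(\<Sum>g\<in>?G. (avg_op A \<phi> g)\<^sup>2) \<le> 1 / fact (card A)" if A: "A \<subseteq> S" for A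
  proof -
    have finA: "finite A" using A S finite_subset by blast
    have sum_avg: "(\<Sum>g\<in>?G. avg_op A \<mu> g) = W"
      using symmetric_operator_sym[OF symmetric_operator_avg_op[OF S(1) A], where f = "\<lambda>_. 1" and h = \<mu>] finA mass_\<mu>
      by (simp add: avg_op_of_invariant)
    have nonneg: "0 \<le> avg_op A \<mu> g" for g unfolding avg_op_def using \<mu>0 by (intro divide_nonneg_nonneg sum_nonneg) auto
    have le: "avg_op A \<mu> g \<le> 1 / fact (card A)" if g: "g \<in> ?G" for g
    proof -
      have inj: "inj_on (\<lambda>h. h \<circ> g) {h. h permutes A}"
      proof (rule inj_onI)
        fix x y assume "x \<circ> g = y \<circ> g"
        then have "x \<circ> (g \<circ> inv' g) = y \<circ> (g \<circ> inv' g)" by (simp only: comp_assoc[symmetric])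
        then show "x = y" using g by (simp add: permutes_inv_o)
      qed
      have "(\<lambda>h. h \<circ> g) ` {h. h permutes A} \<subseteq> ?G"
        using g A permutes_subset permutes_compose by blast
      then have "(\<Sum>h | h permutes A. \<mu> (h \<circ> g)) \<le> (\<Sum>g\<in>?G. \<mu> g)"
        using sum_mono2[OF finG, of "(\<lambda>h. h \<circ> g) ` {h. h permutes A}" \<mu>] \<mu>0 sum.reindex[OF inj, of \<mu>]
        by (simp add: comp_def)
      then show ?thesis using mass_\<mu> W01 by (simp add: avg_op_def divide_right_mono)
    qed
    have "(\<Sum>g\<in>?G. (avg_op A \<phi> g)\<^sup>2) \<le> (\<Sum>g\<in>?G. (avg_op A \<mu> g)\<^sup>2)"
      using sum_square_centred[OF finG neG sum_avg] by (simp add: avg_\<phi>[OF A] cardG)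
    also have "\<dots> \<le> (\<Sum>g\<in>?G. 1 / fact (card A) * avg_op A \<mu> g)"
      unfolding power2_eq_square using nonneg le by (intro sum_mono mult_right_mono)
    also have "\<dots> = 1 / fact (card A) * W" by (simp only: sum_distrib_left[symmetric] sum_avg)
    also have "\<dots> \<le> 1 / fact (card A) * 1" using W01 by (intro mult_left_mono) auto
    finally show ?thesis by simp
  qed
  have avgS: "avg_op S \<phi> g = 0" if g: "g \<in> ?G" for g
  proof -
    have "g permutes S" using g by simp
    then have "(\<Sum>h\<in>?G. \<mu> (h \<circ> g)) = W"
      using sum_permutations_compose_right[of g S \<mu>] mass_\<mu> by simp
    then have "avg_op S \<mu> g = W / fact n" by (simp only: avg_op_def S)
    then show ?thesis using avg_\<phi>[OF order_refl, of g] by simp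
  qed
  \<comment> \<open>The index \<open>n\<close> belongs to the eigenvalue 1 and gets weight 1. It
    contributes nothing, because the average of \<open>\<phi>\<close> over all of \<open>S\<close>
    is 0.\<close>
  define w' where "w' = w(n := 1)"
  let ?C = "\<lambda>k. {A. A \<subseteq> S \<and> card A = k}"
  have eig1: "eig_bound n n = 1" using pochhammer_pos[OF npos, of n] by (simp add: eig_bound_def)
  have "(\<Sum>g\<in>?G. ((?P ^^ t) \<phi> g)\<^sup>2) \<le>
      (\<Sum>k=1..n. w' k * (\<Sum>A\<in>?C k. \<Sum>g\<in>?G. (avg_op A \<phi> g)\<^sup>2)) + c * (\<Sum>g\<in>?G. (\<phi> g)\<^sup>2)"
    unfolding S_def
  proof (rule walk_spectral_bound[OF n])
    show "0 \<le> w' k" for k using w(1) by (simp add: w'_def)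
    show "eig_bound n k ^ (2 * t) \<le> w' k + c" if "1 \<le> k" "k \<le> n" for k
      using bound[of k] that w(2) eig1 by (cases "k = n") (auto simp: w'_def)
  qed (rule w)
  also have "\<dots> \<le> (\<Sum>k\<in>{1..<n}. w k * (real (n choose k) * (1 / fact k))) + c * (real n ^ i0 / fact n)"
  proof (rule add_mono)
    have "{1..n} = insert n {1..<n}" using n by auto
    then have "(\<Sum>k=1..n. w' k * (\<Sum>A\<in>?C k. \<Sum>g\<in>?G. (avg_op A \<phi> g)\<^sup>2)) =
        w' n * (\<Sum>A\<in>?C n. \<Sum>g\<in>?G. (avg_op A \<phi> g)\<^sup>2) +
        (\<Sum>k\<in>{1..<n}. w' k * (\<Sum>A\<in>?C k. \<Sum>g\<in>?G. (avg_op A \<phi> g)\<^sup>2))" by simp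
    moreover have "A = S" if "A \<in> ?C n" for A using that S by (simp add: card_subset_eq)
    then have "(\<Sum>A\<in>?C n. \<Sum>g\<in>?G. (avg_op A \<phi> g)\<^sup>2) = 0"
      using avgS by (intro sum.neutral ballI) auto
    moreover have "(\<Sum>k\<in>{1..<n}. w' k * (\<Sum>A\<in>?C k. \<Sum>g\<in>?G. (avg_op A \<phi> g)\<^sup>2)) \<le>
        (\<Sum>k\<in>{1..<n}. w k * (real (n choose k) * (1 / fact k)))"
    proof (rule sum_mono)
      fix k assume k: "k \<in> {1..<n}"
      have "(\<Sum>A\<in>?C k. \<Sum>g\<in>?G. (avg_op A \<phi> g)\<^sup>2) \<le> (\<Sum>A\<in>?C k. 1 / fact k)"
      proof (rule sum_mono)
        fix A assume "A \<in> ?C k"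
        then show "(\<Sum>g\<in>?G. (avg_op A \<phi> g)\<^sup>2) \<le> 1 / fact k" using avg2[of A] by simp
      qed
      also have "\<dots> = real (n choose k) * (1 / fact k)" using n_subsets[OF S(1), of k] S by simp
      finally have "w k * (\<Sum>A\<in>?C k. \<Sum>g\<in>?G. (avg_op A \<phi> g)\<^sup>2) \<le> w k * (real (n choose k) * (1 / fact k))"
        using w(1) by (rule mult_left_mono)
      moreover have "w' k = w k" using k by (simp add: w'_def)
      ultimately show "w' k * (\<Sum>A\<in>?C k. \<Sum>g\<in>?G. (avg_op A \<phi> g)\<^sup>2) \<le> w k * (real (n choose k) * (1 / fact k))"
        by (simp only:)
    qed
    ultimately show "(\<Sum>k=1..n. w' k * (\<Sum>A\<in>?C k. \<Sum>g\<in>?G. (avg_op A \<phi> g)\<^sup>2)) \<le>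
        (\<Sum>k\<in>{1..<n}. w k * (real (n choose k) * (1 / fact k)))" by simp
    show "c * (\<Sum>g\<in>?G. (\<phi> g)\<^sup>2) \<le> c * (real n ^ i0 / fact n)"
      using \<phi>2 w(2) by (rule mult_left_mono)
  qed
  finally have L2: "(\<Sum>g\<in>?G. ((?P ^^ t) \<phi> g)\<^sup>2) \<le>
      (\<Sum>k\<in>{1..<n}. w k * (real (n choose k) * (1 / fact k))) + c * (real n ^ i0 / fact n)" .
  define B where "B = (\<Sum>m\<in>{1..<n}. w m * (real (n choose m) * (fact n / fact m))) + c * real n ^ i0"
  have "fact n * (\<Sum>g\<in>?G. ((?P ^^ t) \<phi> g)\<^sup>2) \<le>
      fact n * ((\<Sum>k\<in>{1..<n}. w k * (real (n choose k) * (1 / fact k))) + c * (real n ^ i0 / fact n))"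
    using L2 by (rule mult_left_mono) simp
  also have "\<dots> = B"
    by (simp add: B_def distrib_left sum_distrib_left mult_ac)
  finally have "sqrt (fact n * (\<Sum>g\<in>?G. ((?P ^^ t) \<phi> g)\<^sup>2)) \<le> sqrt B"
    by (rule real_sqrt_le_mono)
  moreover have "(\<Sum>g\<in>?G. \<bar>(?P ^^ t) \<phi> g\<bar>) \<le> sqrt (fact n * (\<Sum>g\<in>?G. ((?P ^^ t) \<phi> g)\<^sup>2))"
    using sum_abs_le_sqrt[of "(?P ^^ t) \<phi>" ?G] by (simp only: cardG of_nat_fact)
  ultimately have L1: "(\<Sum>g\<in>?G. \<bar>(?P ^^ t) \<phi> g\<bar>) \<le> sqrt B" by linarith
  have law: "walk_law (real n) S (t + s) g - 1 / fact n = (?P ^^ t) \<phi> g + ((?P ^^ t) \<rho> g - (1 - W) / fact n)" for g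
  proof -
    have symP: "symmetric_operator ?G (?P ^^ t)"
      by (rule symmetric_operator_funpow[OF symmetric_operator_cycle_op[OF S(1)]])
    have "walk_law (real n) S s = (\<lambda>g. 1 * \<mu> g + 1 * \<rho> g)"
      using X(1) by (auto simp: split \<mu>_def \<rho>_def)
    then have "walk_law (real n) S (t + s) = (\<lambda>g. 1 * (?P ^^ t) \<mu> g + 1 * (?P ^^ t) \<rho> g)"
      unfolding symmetric_operator_lin[OF symP, symmetric] by (simp add: walk_law_def funpow_add)
    moreover have "(\<lambda>g. \<phi> g) = (\<lambda>g. 1 * \<mu> g + (-1) * (W / fact n))" by (simp add: \<phi>_def)
    then have "(?P ^^ t) \<phi> = (\<lambda>g. 1 * (?P ^^ t) \<mu> g + (-1) * (W / fact n))"
      using symmetric_operator_lin[OF symP, of 1 \<mu> "-1" "\<lambda>_. W / fact n"]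
      by (simp add: cycle_op_funpow_const[OF S(1) npos])
    ultimately show ?thesis by (simp add: diff_divide_distrib)
  qed
  have \<rho>P: "0 \<le> (?P ^^ t) \<rho> g" for g by (intro cycle_op_funpow_nonneg npos \<rho>0)
  have "(\<Sum>g\<in>?G. \<bar>walk_law (real n) S (t + s) g - 1 / fact n\<bar>) \<le>
      (\<Sum>g\<in>?G. \<bar>(?P ^^ t) \<phi> g\<bar> + ((?P ^^ t) \<rho> g + (1 - W) / fact n))"
  proof (rule sum_mono)
    fix g
    have "0 \<le> (1 - W) / fact n" using W01 by simp
    then show "\<bar>walk_law (real n) S (t + s) g - 1 / fact n\<bar> \<le> \<bar>(?P ^^ t) \<phi> g\<bar> + ((?P ^^ t) \<rho> g + (1 - W) / fact n)"
      unfolding law using \<rho>P[of g] by linarith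
  qed
  also have "\<dots> = (\<Sum>g\<in>?G. \<bar>(?P ^^ t) \<phi> g\<bar>) + ((1 - W) + (1 - W))"
  proof -
    have "(\<Sum>g\<in>?G. (1 - W) / fact n) = fact (card S) * ((1 - W) / fact n)"
      by (rule sum_permutes_const[OF S(1)])
    also have "\<dots> = 1 - W" by (simp add: S)
    finally show ?thesis
      by (simp only: sum.distrib cycle_op_funpow_sum[OF S(1) npos] mass_\<rho>)
  qed
  finally have "2 * walk_tv n (real n) (t + s) \<le> sqrt B + 2 * (1 - W)"
    using L1 unfolding walk_tv_eq S_def[symmetric] by simp
  moreover have "0 \<le> sqrt B"
  proof -
    have "0 \<le> (\<Sum>g\<in>?G. \<bar>(?P ^^ t) \<phi> g\<bar>)" by (intro sum_nonneg) auto
    then show ?thesis using L1 by linarith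
  qed
  moreover have "v \<le> u + b" if "2 * v \<le> b + 2 * u" "0 \<le> b" for u v b :: real using that by linarith
  ultimately have "walk_tv n (real n) (t + s) \<le> (1 - W) + sqrt B" by blast
  also have "\<dots> \<le> (\<Sum>k<n. ((real n - 1) / (real n + k)) ^ s) / (real i0 + 1) + sqrt B"
    using tail by (rule add_right_mono)
  finally show ?thesis by (simp only: B_def)
qed

section \<open>Asymptotics\<close>

lemma power_le_pochhammer:
  fixes x :: real
  assumes "x \<ge> 0"
  shows "x ^ k \<le> pochhammer x k"
proof (induction k)
  case (Suc k)
  have "x ^ k * x \<le> pochhammer x k * (x + real k)"
    using Suc assms order_trans[OF zero_le_power[OF assms] Suc] by (intro mult_mono) auto
  then show ?case by (simp add: pochhammer_Suc mult.commute)
qed simp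

lemma eig_bound_eq:
  assumes "n \<ge> 1" "m \<le> n"
  shows "eig_bound n m = (real n + min m (n - m)) ^ (n - m) / pochhammer (real n + m) (n - m)"
proof -
  have "pochhammer (real n) n = pochhammer (real n) m * pochhammer (real n + m) (n - m)"
    using assms(2) by (rule pochhammer_product)
  moreover have "pochhammer (real n) m > 0" using assms(1) by (intro pochhammer_pos) simp
  ultimately show ?thesis by (simp add: eig_bound_def)
qed

lemma eig_bound_nonneg: "n \<ge> 1 \<Longrightarrow> 0 \<le> eig_bound n m"
  unfolding eig_bound_def by (intro divide_nonneg_pos mult_nonneg_nonneg) (auto intro: pochhammer_pos pochhammer_nonneg)

text \<open>Numerators are at most \<open>(1 + \<eta>) * n\<close> and denominators at least
  \<open>(2 - \<eta>) * n\<close>. The limiting ratio 1/2 for each box outside the first row is the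
  origin of log 2 in the cutoff time.\<close>

lemma eig_bound_small:
  assumes n: "n \<ge> 1" "m \<le> n" and \<eta>: "\<eta> < 1" "real (n - m) \<le> \<eta> * n"
  shows "eig_bound n m \<le> ((1 + \<eta>) / (2 - \<eta>)) ^ (n - m)"
proof -
  have m: "real m \<ge> (1 - \<eta>) * n" using n \<eta>(2) by (simp add: of_nat_diff algebra_simps)
  have \<eta>0: "\<eta> \<ge> 0" using \<eta>(2) n(1) by (metis of_nat_0_le_iff order_trans zero_le_mult_iff not_one_le_zero of_nat_le_0_iff)
  have base: "real n + min m (n - m) \<le> (1 + \<eta>) * n" using \<eta>(2) by (simp add: algebra_simps min_def)
  have pos: "(2 - \<eta>) * n > 0" using n \<eta> by simp
  have den: "((2 - \<eta>) * n) ^ (n - m) \<le> pochhammer (real n + m) (n - m)"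
  proof -
    have "((2 - \<eta>) * n) ^ (n - m) \<le> (real n + m) ^ (n - m)"
      using m pos by (intro power_mono) (auto simp: algebra_simps)
    also have "\<dots> \<le> pochhammer (real n + m) (n - m)" by (rule power_le_pochhammer) simp
    finally show ?thesis .
  qed
  have "eig_bound n m \<le> ((1 + \<eta>) * n) ^ (n - m) / ((2 - \<eta>) * n) ^ (n - m)"
    unfolding eig_bound_eq[OF n] using base den pos
    by (intro frac_le power_mono) auto
  also have "\<dots> = ((1 + \<eta>) / (2 - \<eta>)) ^ (n - m)" using n by (simp add: power_divide[symmetric])
  finally show ?thesis .
qed

text \<open>Of the \<open>n - m\<close> factors of the denominator, half exceed \<open>n + m\<close> by about \<open>(n - m) / 2\<close>.\<close>

lemma eig_bound_large:
  assumes n: "n \<ge> 1" "m \<le> n" and \<eta>: "\<eta> > 0" "\<eta> * n \<ge> 2" "real (n - m) > \<eta> * n"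
  shows "eig_bound n m \<le> exp (- (\<eta> / 2 * ln (1 + \<eta> / 8)) * n)"
proof -
  define j where "j = n - m"
  define a where "a = j div 2"
  \<comment> \<open>\<open>\<eta> * n \<ge> 2\<close> absorbs the rounding in
    \<open>j div 2\<close>. The 8 in the final bound arises from \<open>x \<le> 2 * n\<close>, which
    turns \<open>\<eta> / 4 * n\<close> into at least \<open>\<eta> / 8 * x\<close>.\<close>
  have a: "real a \<ge> \<eta> / 4 * n" "a \<le> j" "real (j - a) \<ge> \<eta> / 2 * n"
  proof -
    have "2 * real a \<ge> real j - 1" unfolding a_def by linarith
    then show "real a \<ge> \<eta> / 4 * n" using \<eta> by (simp add: j_def)
    show "a \<le> j" by (simp add: a_def)
    have "2 * real (j - a) \<ge> real j" unfolding a_def by linarith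
    then show "real (j - a) \<ge> \<eta> / 2 * n" using \<eta> by (simp add: j_def)
  qed
  define x where "x = real n + m"
  have x: "x > 0" "x \<le> 2 * n" using n by (auto simp: x_def)
  have q: "0 \<le> x / (x + a)" "x / (x + a) \<le> 1 / (1 + \<eta> / 8)"
  proof -
    show "0 \<le> x / (x + a)" using x by simp
    have "\<eta> / 8 * x \<le> \<eta> / 8 * (2 * n)" using x \<eta>(1) by (intro mult_left_mono) auto
    then have "\<eta> / 8 * x \<le> a" using a(1) by simp
    then have "x * (1 + \<eta> / 8) \<le> x + a" by (simp add: algebra_simps)
    then have "x / (x + a) \<le> x / (x * (1 + \<eta> / 8))"
      using x \<eta>(1) by (intro divide_left_mono mult_pos_pos add_pos_nonneg) auto
    then show "x / (x + a) \<le> 1 / (1 + \<eta> / 8)" using x by simp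
  qed
  have den: "x ^ a * (x + a) ^ (j - a) \<le> pochhammer x j"
  proof -
    have "pochhammer x j = pochhammer x a * pochhammer (x + a) (j - a)"
      using a(2) by (rule pochhammer_product)
    moreover have "x ^ a \<le> pochhammer x a" "(x + a) ^ (j - a) \<le> pochhammer (x + a) (j - a)"
      using x by (intro power_le_pochhammer, simp)+
    ultimately show ?thesis using x by (simp add: mult_mono pochhammer_nonneg)
  qed
  have "eig_bound n m \<le> x ^ j / (x ^ a * (x + a) ^ (j - a))"
    unfolding eig_bound_eq[OF n] j_def[symmetric] x_def[symmetric] using den x
    by (intro frac_le power_mono) (auto simp: x_def)
  also have "\<dots> = (x / (x + a)) ^ (j - a)"
  proof -
    have "x ^ j = x ^ a * x ^ (j - a)" using a(2) by (simp add: power_add[symmetric])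
    then show ?thesis using x by (simp add: power_divide)
  qed
  also have "\<dots> \<le> (1 / (1 + \<eta> / 8)) ^ (j - a)" using q by (intro power_mono)
  also have "\<dots> = exp (- ln (1 + \<eta> / 8) * real (j - a))"
  proof -
    have "1 / (1 + \<eta> / 8) = exp (- ln (1 + \<eta> / 8))" using \<eta>(1) by (simp add: exp_minus inverse_eq_divide)
    then show ?thesis by (simp only: exp_of_nat2_mult)
  qed
  also have "\<dots> \<le> exp (- ln (1 + \<eta> / 8) * (\<eta> / 2 * n))"
    using a(3) \<eta>(1) by (simp add: mult_left_mono)
  finally show ?thesis by (simp add: mult_ac)
qed

lemma powr_log2_swap: "x > 0 \<Longrightarrow> n > 0 \<Longrightarrow> x powr (c * log 2 n) = n powr (c * log 2 x)"
  by (simp add: powr_def log_def)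

text \<open>Terms with small \<open>k\<close> decay slowly, but there are only about
  \<open>\<delta> * n\<close> of them; the others decay geometrically in \<open>s\<close>. So a
  number of steps tending to infinity, however slowly, leaves few unrandomised points compared with
  \<open>n\<close>.\<close>

lemma untouched_sum_le:
  assumes n: "n \<ge> 1" and \<delta>: "\<delta> > 0"
  shows "(\<Sum>k<n. ((real n - 1) / (real n + real k)) ^ s) \<le> \<delta> * n + 1 + n * (1 / (1 + \<delta>)) ^ s"
proof -
  have "(\<Sum>k<n. ((real n - 1) / (real n + k)) ^ s) \<le> (\<Sum>k<n. (if real k < \<delta> * n then 1 else 0) + (1 / (1 + \<delta>)) ^ s)"
  proof (rule sum_mono)
    fix k :: nat
    have r: "0 \<le> (real n - 1) / (real n + k)" using n by simp
    show "((real n - 1) / (real n + k)) ^ s \<le> (if real k < \<delta> * n then 1 else 0) + (1 / (1 + \<delta>)) ^ s"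
    proof (cases "real k < \<delta> * n")
      case True
      have "((real n - 1) / (real n + k)) ^ s \<le> 1" using r n by (intro power_le_one) auto
      then show ?thesis using True \<delta> by (simp add: add_increasing2)
    next
      case False
      have "(real n - 1) / (real n + k) \<le> real n / (real n + \<delta> * n)"
        using False n \<delta> by (intro frac_le add_pos_nonneg) auto
      also have "\<dots> = 1 / (1 + \<delta>)"
      proof -
        have "real n + \<delta> * n = (1 + \<delta>) * n" by (simp add: algebra_simps)
        then show ?thesis using n by simp
      qed
      finally show ?thesis using False r by (simp add: power_mono)
    qed
  qed
  also have "\<dots> = real (card {k. k < n \<and> real k < \<delta> * n}) + n * (1 / (1 + \<delta>)) ^ s"
    by (simp add: sum.distrib sum.If_cases Int_def)
  also have "card {k. k < n \<and> real k < \<delta> * n} \<le> card {..<nat \<lceil>\<delta> * n\<rceil>}"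
    by (intro card_mono) (auto simp: less_ceiling_iff zless_nat_eq_int_zless)
  then have "real (card {k. k < n \<and> real k < \<delta> * n}) \<le> \<delta> * n + 1"
  proof -
    assume "card {k. k < n \<and> real k < \<delta> * n} \<le> card {..<nat \<lceil>\<delta> * n\<rceil>}"
    then have "real (card {k. k < n \<and> real k < \<delta> * n}) \<le> real (nat \<lceil>\<delta> * n\<rceil>)" by simp
    also have "\<dots> = of_int \<lceil>\<delta> * n\<rceil>" using \<delta> by simp
    also have "\<dots> \<le> \<delta> * n + 1" by (rule of_int_ceiling_le_add_one)
    finally show ?thesis .
  qed
  finally show ?thesis by simp
qed

lemma binomial_fact_le:
  assumes "m \<le> n"
  shows "real (n choose m) * (fact n / fact m) \<le> real n ^ (2 * (n - m))"
proof -
  have "real (n choose m) \<le> real n ^ (n - m)"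
  proof -
    have "n choose m = n choose (n - m)" using assms by (rule binomial_symmetric)
    also have "\<dots> \<le> n ^ (n - m)" by (rule binomial_le_pow) simp
    finally show ?thesis by (metis of_nat_le_iff of_nat_power)
  qed
  moreover have "fact n / fact m \<le> real n ^ (n - m)"
  proof -
    have "fact n div fact (n - (n - m)) \<le> n ^ (n - m)" by (rule fact_div_fact_le_pow) simp
    then have "fact n div fact m \<le> n ^ (n - m)" using assms by simp
    moreover have "fact m dvd (fact n :: nat)" using assms by (rule fact_dvd)
    then have "real (fact n div fact m) = fact n / fact m" by (simp add: real_of_nat_div)
    ultimately show ?thesis by (metis of_nat_le_iff of_nat_power)
  qed
  ultimately have "real (n choose m) * (fact n / fact m) \<le> real n ^ (n - m) * real n ^ (n - m)"
    by (intro mult_mono) auto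
  then show ?thesis by (simp add: mult_2 power_add)
qed

section \<open>Estimates on both sides of the cutoff time\<close>

lemma nat_floor_bounds:
  fixes x :: real
  assumes "x \<ge> 0"
  shows "real (nat \<lfloor>x\<rfloor>) \<le> x" "real (nat \<lfloor>x\<rfloor>) \<ge> x - 1"
proof -
  have "real (nat \<lfloor>x\<rfloor>) = of_int \<lfloor>x\<rfloor>" using assms by simp
  then show "real (nat \<lfloor>x\<rfloor>) \<le> x" "real (nat \<lfloor>x\<rfloor>) \<ge> x - 1" by linarith+
qed

lemma sum_power_reversed_le:
  fixes y :: real
  assumes "0 \<le> y" "y \<le> 1/2"
  shows "(\<Sum>m\<in>{1..<n}. y ^ (n - m)) \<le> 2 * y"
proof (induction n)
  case 0
  then show ?case using assms by simp
next
  case (Suc n)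
  show ?case
  proof (cases "n = 0")
    case True
    then show ?thesis using assms by simp
  next
    case False
    then have "{1..<Suc n} = insert n {1..<n}" by auto
    then have "(\<Sum>m\<in>{1..<Suc n}. y ^ (Suc n - m)) = y + (\<Sum>m\<in>{1..<n}. y ^ (Suc n - m))" by simp
    also have "(\<Sum>m\<in>{1..<n}. y ^ (Suc n - m)) = y * (\<Sum>m\<in>{1..<n}. y ^ (n - m))"
      unfolding sum_distrib_left by (intro sum.cong refl) (simp add: Suc_diff_le)
    also have "y + \<dots> \<le> y + y * (2 * y)" using Suc.IH assms(1) by (intro add_left_mono mult_left_mono)
    also have "\<dots> \<le> 2 * y" using mult_left_mono[OF assms(2,1)] by simp
    finally show ?thesis .
  qed
qed

text \<open>The \<open>- 1\<close> leaves room for rounding a real time down. With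
  \<open>L = log 2 n\<close>, the surplus \<open>\<epsilon> * L\<close> is shared out: one quarter
  for the first phase, one quarter to absorb the \<open>- 1\<close>, one half for the L2
  phase.\<close>

lemma walk_tv_upper_eventually:
  assumes \<epsilon>: "0 < \<epsilon>" "\<epsilon> < 1"
  shows "\<forall>\<^sub>F n in sequentially. \<forall>T::nat. real T \<ge> (1 + \<epsilon>) * log 2 n - 1 \<longrightarrow> walk_tv n (real n) T < \<epsilon>"
proof -
  \<comment> \<open>Chosen so that \<open>x * (1 + \<epsilon> / 2) = 1 + \<epsilon> / 8\<close>. For
    a ratio \<open>r\<close> below \<open>2 powr (- x)\<close>, the product of
    \<open>r ^ (2 * t)\<close> and the multiplicity factor \<open>real n ^ 2\<close> is then at most
    \<open>real n powr (- \<epsilon> / 4)\<close>. As \<open>x < 1\<close>, such a ratio is attained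
    for small \<open>\<eta>\<close>.\<close>
  define x where "x = (1 + \<epsilon> / 8) / (1 + \<epsilon> / 2)"
  have "x < 1" using \<epsilon> by (simp add: x_def)
  then have half: "1 / 2 < 2 powr (- x)" using powr_less_mono[of "-1" "- x" 2] by simp
  have "((\<lambda>\<eta>::real. (1 + \<eta>) / (2 - \<eta>)) \<longlongrightarrow> (1 + 0) / (2 - 0)) (at_right 0)"
    by (intro tendsto_intros) simp
  then have "\<forall>\<^sub>F \<eta> in at_right 0. (1 + \<eta>) / (2 - \<eta>) < 2 powr (- x)"
    using half by (intro order_tendstoD) auto
  then have "\<forall>\<^sub>F \<eta> in at_right 0. \<eta> \<in> {0<..<1} \<and> (1 + \<eta>) / (2 - \<eta>) < 2 powr (- x)"
    using eventually_at_right_real[of 0 1] by (intro eventually_conj) auto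
  then obtain \<eta> where \<eta>: "0 < \<eta>" "\<eta> < 1" "(1 + \<eta>) / (2 - \<eta>) < 2 powr (- x)"
    using eventually_happens'[OF trivial_limit_at_right_real] by (metis (no_types, lifting) greaterThanLessThan_iff)
  define r where "r = (1 + \<eta>) / (2 - \<eta>)"
  have r: "0 < r" "r < 2 powr (- x)" using \<eta> by (auto simp: r_def)
  have "2 powr (- x) \<le> 2 powr 0" using \<epsilon> by (intro powr_mono) (auto simp: x_def)
  then have r1: "r \<le> 1" using r by simp
  define c0 where "c0 = \<eta> / 2 * ln (1 + \<eta> / 8)"
  have c0: "c0 > 0" using \<eta> by (simp add: c0_def)
  \<comment> \<open>Dividing \<open>\<delta> * n\<close> by \<open>c0 * n\<close> in the tail of the
    first phase gives exactly \<open>\<epsilon> / 8\<close>; all other errors tend to 0 and are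
    collected in \<open>err\<close>.\<close>
  define \<delta> where "\<delta> = c0 * \<epsilon> / 8"
  have \<delta>: "\<delta> > 0" using c0 \<epsilon> by (simp add: \<delta>_def)
  define b where "b = ln (1 + \<delta>)"
  have b: "b > 0" using \<delta> by (simp add: b_def)
  define \<kappa> where "\<kappa> = \<epsilon> / 4"
  have \<kappa>: "\<kappa> > 0" using \<epsilon> by (simp add: \<kappa>_def)
  define err where "err = (\<lambda>n::nat. 1 / (c0 * n) + 1 / c0 * exp (- (b * (\<kappa> * log 2 n - 1))) +
    sqrt (2 * real n powr (- \<kappa>) + exp (- (c0 * n * ln n))))"
  have "err \<longlonglongrightarrow> 0 + 1 / c0 * 0 + sqrt (2 * 0 + 0)"
    unfolding err_def
  proof (intro tendsto_intros)
    show "(\<lambda>n. 1 / (c0 * real n)) \<longlonglongrightarrow> 0" using c0 by real_asymp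
    show "(\<lambda>n. real n powr (- \<kappa>)) \<longlonglongrightarrow> 0" using \<kappa> by real_asymp
    show "(\<lambda>n. exp (- (c0 * real n * ln (real n)))) \<longlonglongrightarrow> 0" using c0 by real_asymp
    define \<gamma> where "\<gamma> = b * \<kappa> / ln 2"
    have "\<gamma> > 0" using b \<kappa> by (simp add: \<gamma>_def)
    then have "(\<lambda>n. exp (b - \<gamma> * ln (real n))) \<longlonglongrightarrow> 0" by real_asymp
    moreover have "b - \<gamma> * ln (real n) = - (b * (\<kappa> * log 2 (real n) - 1))" for n
      by (simp add: \<gamma>_def log_def algebra_simps)
    ultimately show "(\<lambda>n. exp (- (b * (\<kappa> * log 2 (real n) - 1)))) \<longlonglongrightarrow> 0" by simp
  qed
  then have "err \<longlonglongrightarrow> 0" by simp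
  then have ev1: "\<forall>\<^sub>F n in sequentially. err n < 7 / 8 * \<epsilon>" using \<epsilon> by (intro order_tendstoD) auto
  have "filterlim (\<lambda>n. log 2 (real n)) at_top sequentially" by real_asymp
  then have ev2: "\<forall>\<^sub>F n in sequentially. log 2 (real n) \<ge> 4 / \<epsilon>" by (simp add: filterlim_at_top)
  have "filterlim (\<lambda>n. \<eta> * real n) at_top sequentially" using \<eta> by real_asymp
  then have ev3: "\<forall>\<^sub>F n in sequentially. \<eta> * real n \<ge> 2" by (simp add: filterlim_at_top)
  have "(\<lambda>n. real n powr (- \<kappa>)) \<longlonglongrightarrow> 0" using \<kappa> by real_asymp
  then have ev4: "\<forall>\<^sub>F n in sequentially. real n powr (- \<kappa>) < 1 / 2" by (intro order_tendstoD) auto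
  show ?thesis
    using ev1 ev2 ev3 ev4 eventually_ge_at_top[of 2]
  proof eventually_elim
    case (elim n)
    define L where "L = log 2 (real n)"
    have n: "n \<ge> 1" "real n \<ge> 1" using elim(5) by auto
    have L: "L \<ge> 4 / \<epsilon>" using elim(2) by (simp add: L_def)
    have L0: "L > 0" using L \<epsilon> by (meson divide_pos_pos less_le_trans zero_less_numeral)
    have \<epsilon>L: "\<epsilon> / 4 * L \<ge> 1" using L \<epsilon> by (simp add: field_simps)
    have lnL: "ln (real n) \<le> L"
    proof -
      have "ln (real n) \<ge> 0" using n by simp
      then have "ln (real n) * ln 2 \<le> ln (real n) * 1" using ln_2_less_1 by (intro mult_left_mono) auto
      then show ?thesis by (simp add: L_def log_def le_divide_eq)
    qed
    show ?case
    proof (intro allI impI)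
      fix T :: nat assume T: "real T \<ge> (1 + \<epsilon>) * log 2 (real n) - 1"
      define s where "s = nat \<lfloor>\<kappa> * L\<rfloor>"
      have "\<kappa> * L \<ge> 0" using \<kappa> L0 by simp
      then have s: "real s \<le> \<kappa> * L" "real s \<ge> \<kappa> * L - 1" unfolding s_def by (rule nat_floor_bounds)+
      define t where "t = T - s"
      have TL: "real T - \<kappa> * L \<ge> (1 + \<epsilon> / 2) * L"
        using T \<epsilon>L by (simp add: L_def[symmetric] \<kappa>_def algebra_simps)
      have "(1 + \<epsilon> / 2) * L \<ge> 0" using L0 \<epsilon> by simp
      then have sT: "s \<le> T" using TL s by linarith
      then have t: "T = t + s" "real t \<ge> (1 + \<epsilon> / 2) * L" using TL s by (auto simp: t_def of_nat_diff)
      have "1 * L \<le> (1 + \<epsilon> / 2) * L" using L0 \<epsilon> by (intro mult_right_mono) auto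
      then have tL: "real t \<ge> ln (real n)" using t(2) lnL by linarith
      \<comment> \<open>The density \<open>real n ^ i0\<close> is then at most
        \<open>exp (c0 * n * ln n)\<close>, half the exponent that \<open>c\<close> provides once
        \<open>t \<ge> ln n\<close>.\<close>
      define i0 where "i0 = nat \<lfloor>c0 * n\<rfloor>"
      have "c0 * n \<ge> 0" using c0 by simp
      then have i0: "real i0 \<le> c0 * n" "real i0 + 1 \<ge> c0 * n" using nat_floor_bounds[of "c0 * n"] by (auto simp: i0_def)
      define c where "c = exp (- (2 * (c0 * n * ln n)))"
      \<comment> \<open>Only diagrams with few boxes outside the first row get a weight of their
        own; the eigenvalues of all others are charged to \<open>c\<close>.\<close>
      define w where "w = (\<lambda>m. if real (n - m) \<le> \<eta> * n then eig_bound n m ^ (2 * t) else 0)"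
      have w0: "w m \<ge> 0" for m using eig_bound_nonneg[OF n(1)] by (simp add: w_def)
      have bound: "eig_bound n m ^ (2 * t) \<le> w m + c" if "1 \<le> m" "m < n" for m
      proof (cases "real (n - m) \<le> \<eta> * n")
        case True
        then show ?thesis by (simp add: w_def c_def)
      next
        case False
        then have "eig_bound n m \<le> exp (- c0 * n)"
          using eig_bound_large[of n m \<eta>] n that elim(3) \<eta> by (simp add: c0_def)
        then have "eig_bound n m ^ (2 * t) \<le> exp (- c0 * n) ^ (2 * t)"
          using eig_bound_nonneg[OF n(1)] by (intro power_mono) auto
        also have "\<dots> = exp (- (2 * (c0 * n * t)))" by (simp add: exp_of_nat_mult[symmetric] mult_ac)
        also have "\<dots> \<le> c" unfolding c_def using tL c0 by (simp add: mult_left_mono)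
        finally show ?thesis using False by (simp add: w_def)
      qed
      define y where "y = real n powr (- \<kappa>)"
      have y: "0 \<le> y" "y \<le> 1 / 2" using elim(4) by (auto simp: y_def)
      have rt: "r ^ (2 * t) * real n ^ 2 \<le> y"
      proof -
        have "r ^ (2 * t) = r powr (2 * t)" using r powr_realpow[of r "2 * t"] by simp
        also have "\<dots> \<le> r powr (2 * ((1 + \<epsilon> / 2) * L))"
          using r r1 t(2) by (intro powr_mono') auto
        also have "\<dots> \<le> (2 powr (- x)) powr (2 * ((1 + \<epsilon> / 2) * L))"
          using r L0 \<epsilon> by (intro powr_mono2) auto
        also have "\<dots> = 2 powr (- (2 * (1 + \<epsilon> / 8)) * L)"
        proof -
          have "x * (1 + \<epsilon> / 2) = 1 + \<epsilon> / 8" using \<epsilon> by (simp add: x_def)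
          then have "- x * (2 * ((1 + \<epsilon> / 2) * L)) = - (2 * (1 + \<epsilon> / 8)) * L"
            by (metis (no_types, opaque_lifting) mult.assoc mult.left_commute mult_minus_left)
          then show ?thesis by (simp only: powr_powr)
        qed
        also have "\<dots> = real n powr (- (2 * (1 + \<epsilon> / 8)))"
          using n powr_log2_swap[of 2 "real n" "- (2 * (1 + \<epsilon> / 8))"] by (simp add: L_def)
        finally have "r ^ (2 * t) \<le> real n powr (- (2 * (1 + \<epsilon> / 8)))" .
        then have "r ^ (2 * t) * real n ^ 2 \<le> real n powr (- (2 * (1 + \<epsilon> / 8))) * real n ^ 2"
          by (rule mult_right_mono) simp
        also have "\<dots> = real n powr (- (2 * (1 + \<epsilon> / 8))) * real n powr 2" using n by simp
        also have "\<dots> = y" unfolding powr_add[symmetric] y_def \<kappa>_def by (simp add: algebra_simps)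
        finally show ?thesis .
      qed
      have "(\<Sum>m\<in>{1..<n}. w m * (real (n choose m) * (fact n / fact m))) \<le> (\<Sum>m\<in>{1..<n}. y ^ (n - m))"
      proof (rule sum_mono)
        fix m assume m: "m \<in> {1..<n}"
        show "w m * (real (n choose m) * (fact n / fact m)) \<le> y ^ (n - m)"
        proof (cases "real (n - m) \<le> \<eta> * n")
          case True
          have "eig_bound n m \<le> r ^ (n - m)"
            using eig_bound_small[of n m \<eta>] n m \<eta> True by (simp add: r_def)
          then have "w m \<le> (r ^ (n - m)) ^ (2 * t)"
            using True eig_bound_nonneg[OF n(1)] by (simp add: w_def power_mono)
          moreover have "real (n choose m) * (fact n / fact m) \<le> real n ^ (2 * (n - m))"
            using m by (intro binomial_fact_le) auto
          ultimately have "w m * (real (n choose m) * (fact n / fact m)) \<le>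
              (r ^ (n - m)) ^ (2 * t) * real n ^ (2 * (n - m))"
            using w0[of m] r by (intro mult_mono) auto
          also have "\<dots> = (r ^ (2 * t) * real n ^ 2) ^ (n - m)"
            by (simp add: power_mult_distrib power_mult[symmetric] mult.commute)
          also have "\<dots> \<le> y ^ (n - m)" using rt r by (intro power_mono) auto
          finally show ?thesis .
        next
          case False
          then show ?thesis using y by (simp add: w_def)
        qed
      qed
      also have "\<dots> \<le> 2 * y" using y by (rule sum_power_reversed_le)
      finally have sum_w: "(\<Sum>m\<in>{1..<n}. w m * (real (n choose m) * (fact n / fact m))) \<le> 2 * y" .
      have "real n ^ i0 = real n powr i0" using n by (simp add: powr_realpow)
      also have "\<dots> \<le> real n powr (c0 * n)" using n i0 by (intro powr_mono) auto
      also have "\<dots> = exp (c0 * n * ln n)" using n by (simp add: powr_def)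
      finally have "c * real n ^ i0 \<le> c * exp (c0 * n * ln n)" by (intro mult_left_mono) (auto simp: c_def)
      also have "\<dots> = exp (- (c0 * n * ln n))" by (simp add: c_def exp_add[symmetric])
      finally have c_le: "c * real n ^ i0 \<le> exp (- (c0 * n * ln n))" .
      define q where "q = (\<Sum>k<n. ((real n - 1) / (real n + k)) ^ s)"
      have q_le: "q \<le> \<delta> * n + 1 + n * exp (- (b * (\<kappa> * L - 1)))"
      proof -
        have "(1 / (1 + \<delta>)) ^ s = exp (- b) ^ s" using \<delta> by (simp add: b_def exp_minus inverse_eq_divide)
        also have "\<dots> = exp (- (b * s))" by (simp add: exp_of_nat_mult[symmetric] mult.commute)
        also have "\<dots> \<le> exp (- (b * (\<kappa> * L - 1)))" using s(2) b by simp
        finally have "n * (1 / (1 + \<delta>)) ^ s \<le> n * exp (- (b * (\<kappa> * L - 1)))" by (intro mult_left_mono) auto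
        then show ?thesis using untouched_sum_le[OF n(1) \<delta>, of s] by (simp add: q_def)
      qed
      have q0: "0 \<le> q" unfolding q_def using n by (intro sum_nonneg zero_le_power divide_nonneg_nonneg) auto
      have cn: "c0 * n > 0" using c0 n by simp
      have "q / (real i0 + 1) \<le> q / (c0 * n)"
        using q0 i0(2) cn by (intro divide_left_mono mult_pos_pos[of "c0 * n"]) auto
      also have "\<dots> \<le> (\<delta> * n + 1 + n * exp (- (b * (\<kappa> * L - 1)))) / (c0 * n)"
        using q_le cn by (intro divide_right_mono) auto
      also have "\<dots> = \<epsilon> / 8 + 1 / (c0 * n) + 1 / c0 * exp (- (b * (\<kappa> * L - 1)))"
        using c0 n by (simp add: \<delta>_def field_simps)
      finally have first: "q / (real i0 + 1) \<le> \<epsilon> / 8 + 1 / (c0 * n) + 1 / c0 * exp (- (b * (\<kappa> * L - 1)))" .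
      have "walk_tv n (real n) T \<le> q / (real i0 + 1) +
          sqrt ((\<Sum>m\<in>{1..<n}. w m * (real (n choose m) * (fact n / fact m))) + c * real n ^ i0)"
        unfolding t(1) q_def by (rule walk_tv_two_phase[OF n(1) w0 _ bound]) (auto simp: c_def)
      also have "\<dots> \<le> (\<epsilon> / 8 + 1 / (c0 * n) + 1 / c0 * exp (- (b * (\<kappa> * L - 1)))) +
          sqrt (2 * y + exp (- (c0 * n * ln n)))"
        using first sum_w c_le by (intro add_mono real_sqrt_le_mono) auto
      also have "\<dots> = \<epsilon> / 8 + err n" by (simp add: err_def L_def y_def)
      finally show "walk_tv n (real n) T < \<epsilon>" using elim(1) by linarith
    qed
  qed
qed

text \<open>For \<theta> = n a point survives one step with probability n / (2n - 1), at least 1/2,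
  so the mean number of untouched points is at least \<open>n powr \<epsilon>\<close>. The
  correlation \<open>r - 1\<close> vanishes because T is small compared with n.\<close>

lemma walk_tv_lower_eventually:
  assumes \<epsilon>: "0 < \<epsilon>" "\<epsilon> < 1"
  shows "\<forall>\<^sub>F n in sequentially. \<forall>T::nat. real T \<le> (1 - \<epsilon>) * log 2 n \<longrightarrow> walk_tv n (real n) T > 1 - \<epsilon>"
proof -
  have "(\<lambda>n::nat. 6 * real n powr (- \<epsilon>) + 4 * (exp (log 2 n / n) - 1)) \<longlonglongrightarrow> 0"
    using \<epsilon> by real_asymp
  then have "\<forall>\<^sub>F n in sequentially. 6 * real n powr (- \<epsilon>) + 4 * (exp (log 2 n / n) - 1) < \<epsilon>"
    using \<epsilon> by (intro order_tendstoD) auto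
  then show ?thesis
    using eventually_ge_at_top[of 2]
  proof eventually_elim
    case (elim n)
    define L where "L = log 2 (real n)"
    have n: "n \<ge> 2" "real n \<ge> 2" using elim(2) by auto
    have L0: "L \<ge> 0" using n by (simp add: L_def)
    show ?case
    proof (intro allI impI)
      fix T :: nat assume "real T \<le> (1 - \<epsilon>) * log 2 (real n)"
      then have T: "real T \<le> (1 - \<epsilon>) * L" by (simp add: L_def)
      have "(1 - \<epsilon>) * L \<le> 1 * L" using L0 \<epsilon> by (intro mult_right_mono) auto
      then have TL: "real T \<le> L" using T by simp
      define p where "p = (real n / (real n + real n - 1)) ^ T"
      define r where "r = ((real n + real n - 1) / (real n + real n - 2)) ^ T"
      have "real n powr (- (1 - \<epsilon>)) = 2 powr (- (1 - \<epsilon>) * L)"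
        using n powr_log2_swap[of 2 "real n" "- (1 - \<epsilon>)"] by (simp add: L_def)
      also have "\<dots> \<le> 2 powr (- real T)" using T by (intro powr_mono) (auto simp: algebra_simps)
      also have "\<dots> = (1 / 2) ^ T" by (simp add: powr_minus powr_realpow power_one_over inverse_eq_divide)
      also have "\<dots> \<le> p" unfolding p_def using n by (intro power_mono) (auto simp: field_simps)
      finally have "real n * real n powr (- (1 - \<epsilon>)) \<le> real n * p" by (intro mult_left_mono) auto
      moreover have "real n * real n powr (- (1 - \<epsilon>)) = real n powr \<epsilon>"
      proof -
        have "real n powr 1 * real n powr (- (1 - \<epsilon>)) = real n powr \<epsilon>" unfolding powr_add[symmetric] by simp
        then show ?thesis using n by simp
      qed
      ultimately have np: "real n powr \<epsilon> \<le> real n * p" by simp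
      have pos: "real n powr \<epsilon> > 0" using n by simp
      have "p > 0" unfolding p_def using n by (intro zero_less_power divide_pos_pos) auto
      then have "6 / (real n * p) \<le> 6 / real n powr \<epsilon>" using n np pos by (intro divide_left_mono mult_pos_pos) auto
      then have 1: "6 / (real n * p) \<le> 6 * real n powr (- \<epsilon>)" by (simp add: powr_minus divide_inverse)
      have "(real n + real n - 1) / (real n + real n - 2) = 1 + 1 / (real n + real n - 2)"
        using n by (simp add: field_simps)
      also have "\<dots> \<le> 1 + 1 / real n" using n by (intro add_left_mono divide_left_mono) auto
      also have "\<dots> \<le> exp (1 / real n)" by (rule exp_ge_add_one_self)
      finally have "r \<le> exp (1 / real n) ^ T" unfolding r_def using n by (intro power_mono) auto
      also have "\<dots> = exp (real T / n)" by (simp add: exp_of_nat_mult[symmetric])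
      also have "\<dots> \<le> exp (L / n)" using TL n by (simp add: divide_right_mono)
      finally have 2: "r \<le> exp (L / n)" .
      have 3: "1 - 6 / (real n * p) - 4 * (r - 1) \<le> walk_tv n (real n) T"
        unfolding p_def r_def using n by (intro walk_tv_ge) auto
      have arith: "1 - e < v" if "1 - a - 4 * (u - 1) \<le> v" "a \<le> a'" "u \<le> z" "a' + 4 * (z - 1) < e"
        for v a a' u z e :: real using that by argo
      show "walk_tv n (real n) T > 1 - \<epsilon>"
        by (rule arith[OF 3 1 2]) (use elim(1) in \<open>simp only: L_def\<close>)
    qed
  qed
qed

lemma diagonal_sequence:
  fixes H :: "real \<Rightarrow> nat \<Rightarrow> bool"
  assumes "\<And>\<epsilon>. 0 < \<epsilon> \<Longrightarrow> \<epsilon> < 1 \<Longrightarrow> eventually (H \<epsilon>) sequentially"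
  obtains e where "\<And>n. 0 < e n" "\<And>n. e n < 1" "e \<longlonglongrightarrow> 0" "eventually (\<lambda>n. H (e n) n) sequentially"
proof -
  have "\<exists>N. \<forall>n\<ge>N. H (1 / (real k + 2)) n" for k :: nat
    using assms[of "1 / (real k + 2)"] by (simp add: eventually_sequentially)
  then obtain N where N: "\<And>k n. n \<ge> N k \<Longrightarrow> H (1 / (real k + 2)) n" by metis
  define A where "A = (\<lambda>n. insert 0 {k. k \<le> n \<and> N k \<le> n})"
  define K where "K = (\<lambda>n. Max (A n))"
  define e where "e = (\<lambda>n. 1 / (real (K n) + 2))"
  have finA: "finite (A n)" "A n \<noteq> {}" for n by (auto simp: A_def)
  have "H (e n) n" if "n \<ge> N 0" for n
  proof -
    have "K n \<in> A n" unfolding K_def using finA by (rule Max_in)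
    then have "N (K n) \<le> n" using that by (auto simp: A_def)
    then show ?thesis unfolding e_def by (rule N)
  qed
  then have ev: "eventually (\<lambda>n. H (e n) n) sequentially" by (auto simp: eventually_sequentially)
  have "filterlim K at_top sequentially"
    unfolding filterlim_at_top
  proof
    fix k
    have "k \<le> K n" if "n \<ge> max k (N k)" for n
      unfolding K_def using that by (intro Max_ge finA) (auto simp: A_def)
    then show "eventually (\<lambda>n. k \<le> K n) sequentially" by (rule eventually_sequentiallyI)
  qed
  moreover have "(\<lambda>k::nat. 1 / (real k + 2)) \<longlonglongrightarrow> 0" by real_asymp
  ultimately have "e \<longlonglongrightarrow> 0" unfolding e_def by (rule filterlim_compose[rotated])
  then show ?thesis using ev by (intro that[of e]) (auto simp: e_def)
qed

text \<open>Any window that is negligible compared with \<open>log n\<close> but shrinks slowly enough will do.\<close>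

lemma walk_tv_has_cutoff: "has_cutoff (\<lambda>n. walk_tv n (real n)) (\<lambda>n. ln (real n) / ln 2)"
proof -
  define H where "H = (\<lambda>\<epsilon> n. (\<forall>T::nat. real T \<ge> (1 + \<epsilon>) * log 2 n - 1 \<longrightarrow> walk_tv n (real n) T < \<epsilon>) \<and>
     (\<forall>T::nat. real T \<le> (1 - \<epsilon>) * log 2 n \<longrightarrow> walk_tv n (real n) T > 1 - \<epsilon>))"
  have "eventually (H \<epsilon>) sequentially" if "0 < \<epsilon>" "\<epsilon> < 1" for \<epsilon>
    unfolding H_def by (intro eventually_conj walk_tv_upper_eventually walk_tv_lower_eventually that)
  then obtain e where e: "\<And>n. 0 < e n" "\<And>n. e n < 1" "e \<longlonglongrightarrow> 0" "eventually (\<lambda>n. H (e n) n) sequentially"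
    by (rule diagonal_sequence[of H]) auto
  define L where "L = (\<lambda>n::nat. ln (real n) / ln 2)"
  have L_log: "L n = log 2 (real n)" for n by (simp add: L_def log_def)
  \<comment> \<open>\<open>L n\<close> is not positive for \<open>n < 2\<close>; the value 1 there
    only serves positivity of the window.\<close>
  define w where "w = (\<lambda>n. if n \<ge> 2 then e n * L n else 1)"
  have L0: "L n > 0" if "n \<ge> 2" for n using that by (simp add: L_def)
  let ?d = "\<lambda>\<alpha> n. walk_tv n (real n) (nat \<lfloor>L n + \<alpha> * w n\<rfloor>)"
  have "(\<lambda>n. w n / L n) \<longlonglongrightarrow> 0"
  proof (rule Lim_transform_eventually[OF e(3)])
    show "\<forall>\<^sub>F n in sequentially. e n = w n / L n"
      using eventually_ge_at_top[of 2] by eventually_elim (use L0 in \<open>force simp: w_def\<close>)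
  qed
  moreover have "((\<lambda>\<alpha>. liminf (\<lambda>n. ereal (?d \<alpha> n))) \<longlongrightarrow> 1) at_bot"
  proof (rule tendsto_eventually, unfold eventually_at_bot_linorder, intro exI[of _ "-1"] allI impI)
    \<comment> \<open>The vanishing margin is built into \<open>w\<close>, so already every
      \<open>\<alpha> \<le> - 1\<close> has limit 1, and the lower limit is constant near minus
      infinity.\<close>
    fix \<alpha> :: real assume \<alpha>: "\<alpha> \<le> - 1"
    have "(\<lambda>n. ?d \<alpha> n) \<longlonglongrightarrow> 1"
    proof (rule tendsto_sandwich[of "\<lambda>n. 1 - e n" _ _ "\<lambda>_. 1"])
      show "\<forall>\<^sub>F n in sequentially. 1 - e n \<le> ?d \<alpha> n"
        using e(4) eventually_ge_at_top[of 2]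
      proof eventually_elim
        case (elim n)
        have "\<alpha> * (e n * L n) \<le> - 1 * (e n * L n)"
          using \<alpha> e(1)[of n] L0[OF elim(2)] by (intro mult_right_mono) auto
        then have "L n + \<alpha> * w n \<le> (1 - e n) * L n" using elim(2) by (simp add: w_def algebra_simps)
        \<comment> \<open>\<open>nat\<close> sends a negative time to 0, and this 0 too has to lie
          below the threshold.\<close>
        moreover have "0 \<le> (1 - e n) * L n" using e(2)[of n] L0[OF elim(2)] by simp
        ultimately have "real (nat \<lfloor>L n + \<alpha> * w n\<rfloor>) \<le> (1 - e n) * log 2 (real n)"
          unfolding L_log[symmetric] by linarith
        then have "?d \<alpha> n > 1 - e n" using elim(1) unfolding H_def by blast
        then show ?case by simp
      qed
      show "\<forall>\<^sub>F n in sequentially. ?d \<alpha> n \<le> 1"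
        using eventually_ge_at_top[of 2] by eventually_elim (intro walk_tv_le_1, simp)
      show "(\<lambda>n. 1 - e n) \<longlonglongrightarrow> 1" using tendsto_diff[OF tendsto_const e(3), of 1] by simp
    qed simp
    then show "liminf (\<lambda>n. ereal (?d \<alpha> n)) = 1"
      by (intro lim_imp_Liminf) (auto simp: one_ereal_def)
  qed
  moreover have "((\<lambda>\<alpha>. limsup (\<lambda>n. ereal (?d \<alpha> n))) \<longlongrightarrow> 0) at_top"
  proof (rule tendsto_eventually, unfold eventually_at_top_linorder, intro exI[of _ 1] allI impI)
    fix \<alpha> :: real assume \<alpha>: "1 \<le> \<alpha>"
    have "(\<lambda>n. ?d \<alpha> n) \<longlonglongrightarrow> 0"
    proof (rule tendsto_sandwich[of "\<lambda>_. 0" _ _ e])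
      show "\<forall>\<^sub>F n in sequentially. ?d \<alpha> n \<le> e n"
        using e(4) eventually_ge_at_top[of 2]
      proof eventually_elim
        case (elim n)
        have "1 * (e n * L n) \<le> \<alpha> * (e n * L n)"
          using \<alpha> e(1)[of n] L0[OF elim(2)] by (intro mult_right_mono) auto
        then have "(1 + e n) * L n \<le> L n + \<alpha> * w n" using elim(2) by (simp add: w_def algebra_simps)
        then have "(1 + e n) * log 2 (real n) - 1 \<le> real (nat \<lfloor>L n + \<alpha> * w n\<rfloor>)"
          unfolding L_log[symmetric] by linarith
        then have "?d \<alpha> n < e n" using elim(1) unfolding H_def by blast
        then show ?case by simp
      qed
    qed (use e(3) walk_tv_nonneg in auto)
    then show "limsup (\<lambda>n. ereal (?d \<alpha> n)) = 0"
      by (intro lim_imp_Limsup) (auto simp: zero_ereal_def)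
  qed
  moreover have "\<forall>n. w n > 0" using e(1) L0 by (simp add: w_def)
  ultimately have "cutoff_with_window (\<lambda>n. walk_tv n (real n)) L w"
    unfolding cutoff_with_window_def by blast
  then show ?thesis unfolding has_cutoff_def L_def by blast
qed

theorem theorem1p1:
  shows "(\<forall>\<theta>::real. \<theta> > 1 \<longrightarrow>
            (\<exists>C::real. \<forall>n::nat. \<forall>\<alpha>::real. \<forall>t::nat.
               n \<ge> 1 \<longrightarrow> \<alpha> > 1 \<longrightarrow> real t \<ge> \<alpha> * ((\<theta>\<^sup>2 + 1) / 2) \<longrightarrow>
               walk_tv n \<theta> t < C * exp (- \<alpha>)))
       \<and> has_cutoff (\<lambda>n. walk_tv n (real n)) (\<lambda>n. ln (real n) / ln 2)"
  using walk_tv_fixed_parameter walk_tv_has_cutoff by blast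

end
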